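(* Let $n\ge1$, let $x_1,\ldots,x_n\in\mathbb{R}$ be distinct, and let $x\in\mathbb{R}$. Put $X=\operatorname{diag}(x_1,\ldots,x_n)$, $\widetilde X=\operatorname{diag}(x,x_1,\ldots,x_n)$, and let $\operatorname{conv}(\widetilde X)\subset\mathbb{R}$ be the convex hull of the points $x,x_1,\ldots,x_n$. Then for any $f\in C^n(\operatorname{conv}(\widetilde X))$, $$f(x)-I^{\mathrm g}_{\{x_k\}_{k=1}^n}f(x)=\frac{\prod_{k=1}^n(x-x_k)}{n!\,Z_{\{x_k,x_k\}_{k=1}^n}}\int_{S^{2n+1}}\int_{\mathbb{U}(n)}e^{\operatorname{tr}(XU^\dagger P_{\mathbf v}^\dagger\widetilde XP_{\mathbf v}U)}\,e^{-x^2/2}\Big[\prod_{k=1}^n\Big(\frac{d}{dq}-x_k\Big)\Big]\big(e^{q^2/2}f(q)\big)\Big|_{q=\mathbf v^\dagger\widetilde X\mathbf v}\,d\mathbf v\,dU .$$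
   Context: Gaussian RBF interpolation: for distinct nodes $x_1,\ldots,x_n\in\mathbb{R}$, $I^{\mathrm g}_{\{x_k\}_{k=1}^n}f$ is the unique function of the form $y\mapsto\sum_{k=1}^nc_ke^{-(y-x_k)^2/2}$ that agrees with $f$ at $x_1,\ldots,x_n$ (the matrix $(e^{-(x_m-x_k)^2/2})_{k,m=1}^n$ is invertible). Notation: $^\dagger$ denotes the Hermitian conjugate. $\mathbb{U}(n)$ is the group of unitary $n\times n$ matrices, and $dU$ is its Haar measure, normalized to total mass $1$. $Z_{\{x_k,x_k\}_{k=1}^n}=\int_{\mathbb{U}(n)}e^{\operatorname{tr}(XU^\dagger XU)}dU>0$. $\int_{S^{2n+1}}\cdot\,d\mathbf v$ denotes integration over the normalized (total mass $1$) Lebesgue measure on the unit sphere $S^{2n+1}=\{\mathbf v:|\mathbf v|=1\}$ in $\mathbb{C}^{n+1}$. For $\mathbf v\in S^{2n+1}$, $P_{\mathbf v}:\mathbb{C}^n\to\mathbb{C}^{n+1}$ is any linear isometry of $\mathbb{C}^n$ onto the orthogonal complement of $\mathbf v$ in $\mathbb{C}^{n+1}$, chosen to depend measurably on $\mathbf v$. The product $\prod_k(\frac{d}{dq}-x_k)$ is a composition of differential operators applied to the function $q\mapsto e^{q^2/2}f(q)$, and the result is evaluated at the real number $q=\mathbf v^\dagger\widetilde X\mathbf v\in\operatorname{conv}(\widetilde X)$. *)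

theory Defs
  imports "HOL-Probability.Probability"
begin

subsection \<open>Gaussian interpolation\<close>

definition gauss_interpolant :: "('n::finite \<Rightarrow> real) \<Rightarrow> (real \<Rightarrow> real) \<Rightarrow> real \<Rightarrow> real" where
  "gauss_interpolant x f =
     (THE g. (\<exists>c :: 'n \<Rightarrow> real. g = (\<lambda>y. \<Sum>k\<in>UNIV. c k * exp (- (y - x k)\<^sup>2 / 2))) \<and>
             (\<forall>k. g (x k) = f (x k)))"


subsection \<open>Differentiation on a subset of the real line\<close>

text \<open>Derivatives are taken within \<open>K\<close>, hence are one-sided at the end points of a compact
  interval \<open>K\<close>, and only the values of the function on \<open>K\<close> matter for the derivative at points
  of \<open>K\<close>. If \<open>K\<close> is a single point, every function is of class \<open>C\<^sup>n\<close> on \<open>K\<close> and its derivative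
  is an unspecified number.\<close>

definition deriv_within :: "real set \<Rightarrow> (real \<Rightarrow> real) \<Rightarrow> real \<Rightarrow> real" where
  "deriv_within K g q = vector_derivative g (at q within K)"

definition Cn_on :: "nat \<Rightarrow> real set \<Rightarrow> (real \<Rightarrow> real) \<Rightarrow> bool" where
  "Cn_on n K f \<longleftrightarrow>
     (\<forall>i<n. (deriv_within K ^^ i) f differentiable_on K) \<and>
     continuous_on K ((deriv_within K ^^ n) f)"

text \<open>The composition of the operators \<open>d/dq - a\<close> for \<open>a\<close> in a list, the head outermost.\<close>

definition diff_op_prod :: "real set \<Rightarrow> real list \<Rightarrow> (real \<Rightarrow> real) \<Rightarrow> real \<Rightarrow> real" where
  "diff_op_prod K as g = foldr (\<lambda>a h q. deriv_within K h q - a * h q) as g"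


subsection \<open>Complex matrices\<close>

definition hconj :: "complex^'n^'m \<Rightarrow> complex^'m^'n"  (\<open>_\<^sup>\<dagger>\<close> [1000] 1000) where
  "A\<^sup>\<dagger> = (\<chi> i j. cnj (A $ j $ i))"

definition hprod :: "complex^'n \<Rightarrow> complex^'n \<Rightarrow> complex" where
  "hprod v w = (\<Sum>i\<in>UNIV. cnj (v $ i) * w $ i)"

definition diag_mat :: "('n \<Rightarrow> real) \<Rightarrow> complex^'n^'n" where
  "diag_mat d = (\<chi> i j. if i = j then complex_of_real (d i) else 0)"

definition unitary_group :: "(complex^'n^'n) set" where
  "unitary_group = {U. U\<^sup>\<dagger> ** U = mat 1 \<and> U ** U\<^sup>\<dagger> = mat 1}"

definition isometry_onto_perp :: "complex^'m \<Rightarrow> complex^'n^'m \<Rightarrow> bool" where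
  "isometry_onto_perp v P \<longleftrightarrow>
     (\<forall>u. norm (P *v u) = norm u) \<and> range (\<lambda>u. P *v u) = {w. hprod v w = 0}"


subsection \<open>Measures on the unitary group and on the sphere\<close>

definition is_unitary_haar :: "(complex^'n^'n) measure \<Rightarrow> bool" where
  "is_unitary_haar M \<longleftrightarrow>
     prob_space M \<and>
     sets M = sets (restrict_space borel unitary_group) \<and>
     (\<forall>V\<in>unitary_group. distr M M (\<lambda>U. V ** U) = M)"

definition unitary_Z ::
  "(complex^'n^'n) measure \<Rightarrow> (complex^'n^'n) \<Rightarrow> complex" where
  "unitary_Z M X = (LINT U|M. exp (trace (X ** U\<^sup>\<dagger> ** X ** U)))"

text \<open>Normalized surface measure as cone measure: the radial projection (\<^term>\<open>sgn\<close>) of the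
  normalized Lebesgue measure on the unit ball. The restriction makes the sphere the underlying
  space, so that integrands need not be measurable, or meaningful, elsewhere.\<close>

definition sphere_measure :: "'a::euclidean_space measure" where
  "sphere_measure =
     restrict_space (distr (uniform_measure lborel (cball 0 1)) borel sgn) (sphere 0 1)"

end

theory Submission
  imports Defs
begin

text \<open>Put \<open>F q = exp (q\<^sup>2 / 2) * f q\<close>. Up to the factor \<open>exp (- x\<^sup>2 / 2)\<close> the interpolation error is
  \<open>F x - (\<Sum>m. l m * F (x\<^sub>m))\<close>, a functional that annihilates the exponentials with exponents \<open>x\<^sub>k\<close>, hence
  is bounded by the sup norm of \<open>(\<Prod>k. d/dq - x\<^sub>k) F\<close>. By density it suffices to take \<open>F q = exp (s * q)\<close>. For this
  \<open>F\<close> the error is the quotient of the determinants of \<open>exp (s\<^sub>i * b\<^sub>j)\<close> of sizes \<open>n + 1\<close> and \<open>n\<close>. The right-hand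
  side is the quotient of two Harish-Chandra--Itzykson--Zuber integrals, because the law of the unitary matrix with first
  column \<open>v\<close> and remaining columns \<open>P v ** U\<close> is invariant under left multiplication.

  For the Harish-Chandra--Itzykson--Zuber formula let \<open>Y\<close> be a random Hermitian matrix with spectrum \<open>s\<close> and
  conjugation invariant law, \<open>I b\<close> the expectation of \<open>exp (\<Sum>i. b\<^sub>i * Y\<^sub>i\<^sub>i)\<close> and \<open>\<Delta>\<close> the Vandermonde determinant.
  Differentiating the invariance along elementary rotations expresses the expectations of the principal minors of \<open>Y\<close>,
  weighted with this exponential, recursively; \<open>\<Delta>\<^sub>S\<inverse> (\<Prod>i\<in>S. \<partial>\<^sub>i) (\<Delta>\<^sub>S I)\<close> satisfies the same recursion. As
  \<open>Y - s\<^sub>j\<close> is singular, \<open>(\<Prod>i. \<partial>\<^sub>i - s\<^sub>j) (\<Delta> I) = 0\<close> for every \<open>j\<close>. Integration over a cube of side \<open>h\<close> gives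
  \<open>(\<Prod>i. T\<^sub>i - exp (s\<^sub>j * h)) (\<Delta> I) = 0\<close> with the shifts \<open>T\<^sub>i\<close> by \<open>h\<close>. Thus \<open>\<Prod>i. z - T\<^sub>i\<close> acts on \<open>\<Delta> I\<close> as
  \<open>\<Prod>j. z - exp (s\<^sub>j * h)\<close>, and with \<open>z = T\<^sub>i\<close> one finds in each variable the linear recurrence that the
  determinant of \<open>exp (s\<^sub>i * b\<^sub>j)\<close> satisfies as well. Antisymmetric solutions on a lattice are determined by their value
  at one arithmetic progression, where the determinant is a Vandermonde determinant; then \<open>h\<close> tends to \<open>0\<close>.\<close>

subsection \<open>Determinants as functions of their entries\<close>

text \<open>Indices come from an arbitrary finite type with a rank function \<open>r\<close>, so
  that passing from \<open>n\<close> to \<open>n + 1\<close> is the passage from \<open>'n\<close>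
  to \<open>'n option\<close>. Several variables are never differentiated at once: \<Delta> times
  the weight is a determinant whose row \<open>p\<close> depends on \<open>b p\<close> alone, so
  mixed derivatives and cube integrals are taken one row at a time under the expectation.
  Derivatives are replaced by shifts because a recurrence on a lattice can be settled by finite
  induction, without any regularity or uniqueness theorem for the differential equations. The
  constant in the formula is found as the step \<open>h\<close> shrinks: the progression collapses
  to a constant vector, where the trace alone fixes the expectation, and dividing by a power of
  \<open>h\<close> turns the Vandermonde determinant of \<open>exp (h * s q)\<close> into that of
  \<open>s\<close>. The factor \<open>n!\<close> is the quotient of the Vandermonde determinants of
  \<open>0, ..., n\<close> and \<open>0, ..., n - 1\<close>. The same formula at
  \<open>b = s = x\<close> shows that the exponential matrix of the nodes is invertible, so the
  interpolant exists. If \<open>x0\<close> is a node, a Vandermonde factor degenerates; then both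
  sides vanish and the case is settled directly.\<close>

definition mdet :: "('n::finite \<Rightarrow> 'n \<Rightarrow> complex) \<Rightarrow> complex" where
  "mdet f = det (\<chi> p q. f p q)"

definition unit_row :: "'n \<Rightarrow> 'n \<Rightarrow> complex" where
  "unit_row p q = (if p = q then 1 else 0)"

definition col_upd :: "('n \<Rightarrow> 'n \<Rightarrow> complex) \<Rightarrow> 'n \<Rightarrow> ('n \<Rightarrow> complex) \<Rightarrow> 'n \<Rightarrow> 'n \<Rightarrow> complex" where
  "col_upd f j c = (\<lambda>p q. if q = j then c p else f p q)"

lemma mdet_perm: "mdet f = (\<Sum>\<sigma> | \<sigma> permutes UNIV. of_int (sign \<sigma>) * (\<Prod>p\<in>UNIV. f p (\<sigma> p)))"
  by (simp add: mdet_def det_def)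

lemma mdet_transpose: "mdet (\<lambda>p q. f q p) = mdet f"
proof -
  have "transpose (\<chi> p q. f p q) = (\<chi> p q. f q p)"
    by (simp add: transpose_def)
  then show ?thesis
    unfolding mdet_def by (metis det_transpose)
qed

lemma mdet_row_sum:
  assumes "finite T"
  shows "mdet (f(p := \<lambda>q. \<Sum>t\<in>T. c t * g t q)) = (\<Sum>t\<in>T. c t * mdet (f(p := g t)))"
proof -
  have *: "(\<Prod>a\<in>UNIV. (f(p := h)) a (\<sigma> a)) = h (\<sigma> p) * (\<Prod>a\<in>UNIV - {p}. f a (\<sigma> a))" for h \<sigma>
    by (subst prod.remove[of _ p]) (auto intro!: prod.cong)
  show ?thesis
    unfolding mdet_perm * sum_distrib_left sum_distrib_right
    by (subst sum.swap) (intro sum.cong refl, simp add: mult_ac)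
qed

lemma mdet_col_sum:
  assumes "finite T"
  shows "mdet (col_upd f j (\<lambda>p. \<Sum>t\<in>T. c t * g t p)) = (\<Sum>t\<in>T. c t * mdet (col_upd f j (g t)))"
proof -
  have *: "mdet (col_upd f j h) = mdet ((\<lambda>q p. f p q)(j := h))" for h
    by (subst mdet_transpose[symmetric]) (rule arg_cong[where f=mdet], auto simp: col_upd_def fun_eq_iff)
  show ?thesis
    unfolding * by (rule mdet_row_sum[OF assms])
qed

lemma mdet_permute_rows:
  assumes "\<pi> permutes UNIV"
  shows "mdet (\<lambda>p. f (\<pi> p)) = of_int (sign \<pi>) * mdet f"
  using det_permute_rows[OF assms, of "\<chi> p q. f p q"] by (simp add: mdet_def)

lemma mdet_eq_rows:
  assumes "p \<noteq> p'" "f p = f p'"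
  shows "mdet f = 0"
  unfolding mdet_def
  by (rule det_identical_rows[OF assms(1)]) (simp add: row_def assms(2))

lemma mdet_eq_cols:
  assumes "q \<noteq> q'" "\<And>p. f p q = f p q'"
  shows "mdet f = 0"
  by (subst mdet_transpose[symmetric]) (rule mdet_eq_rows[OF assms(1)], use assms(2) in auto)

text \<open>A permutation that does not send \<open>p\<close> to \<open>j\<close> meets a zero in
  the unit row. Those that do never pick column \<open>j\<close> in another row, so the entries
  there are free.\<close>

lemma mdet_unit_row_cong:
  assumes "f p = unit_row j" "g p = unit_row j"
    and "\<And>a q. a \<noteq> p \<Longrightarrow> q \<noteq> j \<Longrightarrow> f a q = g a q"
  shows "mdet f = mdet g"
  unfolding mdet_perm
proof (rule sum.cong[OF refl], rule arg_cong2[where f="(*)"], rule refl)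
  fix \<sigma> assume "\<sigma> \<in> {\<sigma>. \<sigma> permutes (UNIV :: 'a set)}"
  then have \<sigma>: "inj \<sigma>" by (auto dest: permutes_inj)
  show "(\<Prod>p\<in>UNIV. f p (\<sigma> p)) = (\<Prod>p\<in>UNIV. g p (\<sigma> p))"
  proof (cases "\<sigma> p = j")
    case True
    have "f a (\<sigma> a) = g a (\<sigma> a)" for a
      using assms True \<sigma> by (cases "a = p") (auto dest: injD)
    then show ?thesis by simp
  next
    case False
    then have "f p (\<sigma> p) = 0" "g p (\<sigma> p) = 0"
      by (auto simp: assms unit_row_def)
    then show ?thesis by (metis UNIV_I finite prod_zero)
  qed
qed

lemma mdet_unit_col_cong:
  assumes "\<And>a. f a j = unit_row p a" "\<And>a. g a j = unit_row p a"
    and "\<And>a q. a \<noteq> p \<Longrightarrow> q \<noteq> j \<Longrightarrow> f a q = g a q"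
  shows "mdet f = mdet g"
  by (subst (1 2) mdet_transpose[symmetric])
     (rule mdet_unit_row_cong[where p=j and j=p], use assms in auto)

lemma sum_unit_row: "(\<Sum>p\<in>UNIV. c p * unit_row p q) = c (q :: 'n::finite)"
  by (simp add: unit_row_def if_distrib cong: if_cong)

text \<open>The \<open>k \<times> k\<close> determinant with entries \<open>lam p m\<close>, \<open>m < k\<close>, where \<open>p\<close> runs through the \<open>k\<close> indices of
  smallest rank \<open>r\<close>. It is padded by rows of the identity matrix, so that all sizes live on the same
  index type.\<close>

definition pdet :: "('n::finite \<Rightarrow> nat) \<Rightarrow> nat \<Rightarrow> ('n \<Rightarrow> nat \<Rightarrow> complex) \<Rightarrow> complex" where
  "pdet r k lam = mdet (\<lambda>p q. if r p < k then lam p (r q) else unit_row p q)"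

lemma pdet_0: "pdet r 0 lam = 1"
  by (simp add: pdet_def mdet_def unit_row_def flip: mat_def)

lemma sum_enum:
  fixes r :: "'n::finite \<Rightarrow> nat"
  assumes "bij_betw r UNIV {..<CARD('n)}" "k < CARD('n)"
  shows "(\<Sum>q | r q \<le> k. h (r q)) = (\<Sum>m\<le>k. h m)"
proof (rule sum.reindex_bij_betw)
  show "bij_betw r {q. r q \<le> k} {..k}"
  proof (rule bij_betw_subset[OF assms(1)])
    have "m \<in> r ` {q. r q \<le> k}" if "m \<le> k" for m
    proof -
      have "m \<in> range r" using assms that by (auto simp: bij_betw_def)
      then show ?thesis using that by auto
    qed
    then show "r ` {q. r q \<le> k} = {..k}" by auto
  qed simp
qed

text \<open>Combining the columns with the coefficients of \<open>Q\<close> into column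
  \<open>j\<close> multiplies the determinant by the coefficient of the last column. Laplace
  expansion along the new column then gives the right-hand side: in the cofactor of row
  \<open>p\<close>, row \<open>j\<close> takes the place of row \<open>p\<close>, at the cost of a
  sign. Choosing \<open>Q\<close> with prescribed roots kills most terms of the expansion.\<close>

lemma pdet_expand:
  fixes r :: "'n::finite \<Rightarrow> nat" and lam :: "'n \<Rightarrow> nat \<Rightarrow> complex"
  assumes r: "bij_betw r UNIV {..<CARD('n)}" and j: "r j = k" and Q: "degree Q \<le> k"
  defines "L \<equiv> \<lambda>p. \<Sum>m\<le>k. coeff Q m * lam p m"
  shows "coeff Q k * pdet r (Suc k) lam =
     L j * pdet r k lam - (\<Sum>p | r p < k. L p * pdet r k (lam \<circ> Transposition.transpose p j))"
proof -
  define B where "B = (\<lambda>p q. if r p < Suc k then lam p (r q) else unit_row p q)"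
  define x where "x p = (if r p \<le> k then L p else 0)" for p
  have k: "k < CARD('n)" using r j by (auto simp: bij_betw_def)
  have rinj: "r p = r q \<longleftrightarrow> p = q" for p q
    using r by (auto simp: bij_betw_def inj_on_def)
  have x1: "x p = (\<Sum>q | r q \<le> k. coeff Q (r q) * B p q)" for p
    using sum_enum[OF r k, of "\<lambda>m. coeff Q m * lam p m"]
    by (auto simp: x_def B_def L_def less_Suc_eq_le unit_row_def intro!: sum.neutral)
  have "mdet (col_upd B j x) = (\<Sum>q | r q \<le> k. coeff Q (r q) * mdet (col_upd B j (\<lambda>p. B p q)))"
    unfolding x1 by (rule mdet_col_sum) simp
  also have "\<dots> = (\<Sum>q | r q \<le> k. if q = j then coeff Q k * mdet B else 0)"
  proof (rule sum.cong[OF refl])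
    fix q
    show "coeff Q (r q) * mdet (col_upd B j (\<lambda>p. B p q)) = (if q = j then coeff Q k * mdet B else 0)"
    proof (cases "q = j")
      case True
      have "col_upd B j (\<lambda>p. B p j) = B" by (auto simp: col_upd_def fun_eq_iff)
      with True j show ?thesis by simp
    next
      case False
      then have "mdet (col_upd B j (\<lambda>p. B p q)) = 0"
        by (intro mdet_eq_cols[where q=q and q'=j]) (auto simp: col_upd_def)
      with False show ?thesis by simp
    qed
  qed
  also have "\<dots> = coeff Q k * mdet B"
    using j by simp
  finally have 1: "mdet (col_upd B j x) = coeff Q k * pdet r (Suc k) lam"
    by (simp add: pdet_def B_def)
  have "mdet (col_upd B j x) = mdet (col_upd B j (\<lambda>q. \<Sum>p\<in>UNIV. x p * unit_row p q))"
    by (simp add: sum_unit_row)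
  also have "\<dots> = (\<Sum>p\<in>UNIV. x p * mdet (col_upd B j (unit_row p)))"
    by (rule mdet_col_sum) simp
  also have "\<dots> = (\<Sum>p | r p \<le> k. L p * mdet (col_upd B j (unit_row p)))"
    by (rule sum.mono_neutral_cong_right) (auto simp: x_def)
  also have "{p. r p \<le> k} = insert j {p. r p < k}"
    using j rinj by (auto simp: le_less)
  also have "(\<Sum>p\<in>\<dots>. L p * mdet (col_upd B j (unit_row p))) =
    L j * mdet (col_upd B j (unit_row j)) + (\<Sum>p | r p < k. L p * mdet (col_upd B j (unit_row p)))"
    using j by (subst sum.insert) auto
  also have "mdet (col_upd B j (unit_row j)) = pdet r k lam"
    unfolding pdet_def
    apply (subst mdet_unit_col_cong[where f="col_upd B j (unit_row j)" and j=j and p=j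
        and g="col_upd (\<lambda>p q. if r p < k then lam p (r q) else unit_row p q) j (unit_row j)"])
    subgoal by (simp add: col_upd_def)
    subgoal by (simp add: col_upd_def)
    subgoal for a q using j rinj[of a j] by (auto simp: col_upd_def B_def less_Suc_eq)
    apply (rule mdet_unit_row_cong[where p=j and j=j])
    using j by (auto simp: fun_eq_iff col_upd_def unit_row_def)
  also have "(\<Sum>p | r p < k. L p * mdet (col_upd B j (unit_row p))) =
      (\<Sum>p | r p < k. - (L p * pdet r k (lam \<circ> Transposition.transpose p j)))"
  proof (rule sum.cong[OF refl])
    fix p assume "p \<in> {p. r p < k}"
    then have p: "r p < k" "p \<noteq> j" using j by auto
    let ?M = "\<lambda>a q. if r a < k then (lam \<circ> Transposition.transpose p j) a (r q) else unit_row a q"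
    let ?C = "col_upd B j (unit_row p)"
    have "Transposition.transpose p j permutes UNIV" by (simp add: permutes_swap_id)
    from mdet_permute_rows[OF this, of ?C]
    have "mdet (\<lambda>a. ?C (Transposition.transpose p j a)) = - mdet ?C"
      using p by (simp add: sign_swap_id)
    moreover have "mdet (\<lambda>a. ?C (Transposition.transpose p j a)) = mdet (col_upd ?M j (unit_row j))"
    proof (rule mdet_unit_col_cong[where j=j and p=j])
      fix a q assume aq: "a \<noteq> j" "q \<noteq> j"
      show "?C (Transposition.transpose p j a) q = col_upd ?M j (unit_row j) a q"
      proof (cases "a = p")
        case True then show ?thesis using aq p j by (simp add: col_upd_def B_def)
      next
        case False
        then have "r a \<noteq> k" using j rinj aq by metis
        then show ?thesis using aq False by (auto simp: col_upd_def B_def less_Suc_eq)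
      qed
    next
      fix a show "?C (Transposition.transpose p j a) j = unit_row j a"
        using p(2) by (auto simp: col_upd_def unit_row_def Transposition.transpose_def split: if_splits)
    qed (auto simp: col_upd_def)
    moreover have "\<dots> = mdet ?M"
      by (rule mdet_unit_row_cong[where p=j and j=j])
         (use j in \<open>auto simp: fun_eq_iff col_upd_def unit_row_def\<close>)
    ultimately show "L p * mdet ?C = - (L p * pdet r k (lam \<circ> Transposition.transpose p j))"
      by (simp add: pdet_def)
  qed
  finally show ?thesis
    using 1 by (simp add: sum_negf)
qed

section \<open>Vandermonde determinants and their mixed derivative\<close>

definition vand :: "('n::finite \<Rightarrow> nat) \<Rightarrow> nat \<Rightarrow> ('n \<Rightarrow> complex) \<Rightarrow> complex" where
  "vand r k a = pdet r k (\<lambda>p m. a p ^ m)"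

text \<open>Multiplied by \<open>exp (\<Sum>p. a p * c p)\<close>, this is \<open>\<Prod>p. \<partial>/\<partial>a p\<close> applied to the Vandermonde determinant of
  \<open>a\<close> times \<open>exp (\<Sum>p. a p * c p)\<close>.\<close>

definition dvand :: "('n::finite \<Rightarrow> nat) \<Rightarrow> nat \<Rightarrow> ('n \<Rightarrow> complex) \<Rightarrow> ('n \<Rightarrow> complex) \<Rightarrow> complex" where
  "dvand r k a c = pdet r k (\<lambda>p m. c p * a p ^ m + of_nat m * a p ^ (m - 1))"

lemma poly_sum_le:
  fixes z :: "'a::comm_ring_1"
  assumes "degree Q \<le> k"
  shows "(\<Sum>m\<le>k. coeff Q m * z ^ m) = poly Q z"
  unfolding poly_altdef
  by (rule sum.mono_neutral_right) (use assms in \<open>auto simp: coeff_eq_0\<close>)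

lemma pderiv_sum_le:
  fixes z :: "'a::idom"
  assumes "degree Q \<le> k"
  shows "(\<Sum>m\<le>k. coeff Q m * (of_nat m * z ^ (m - 1))) = poly (pderiv Q) z"
proof (cases k)
  case 0
  then obtain c where "Q = [:c:]" using assms by (metis degree_eq_zeroE le_zero_eq)
  then show ?thesis using 0 by simp
next
  case (Suc l)
  have "degree (pderiv Q) \<le> l"
    using assms Suc by (intro degree_le) (auto simp: coeff_pderiv coeff_eq_0)
  then have "poly (pderiv Q) z = (\<Sum>m\<le>l. coeff (pderiv Q) m * z ^ m)"
    by (simp add: poly_sum_le)
  also have "\<dots> = (\<Sum>m\<le>l. coeff Q (Suc m) * (of_nat (Suc m) * z ^ m))"
    by (simp add: coeff_pderiv mult_ac)
  also have "\<dots> = (\<Sum>m\<le>k. coeff Q m * (of_nat m * z ^ (m - 1)))"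
    unfolding Suc by (subst sum.atMost_Suc_shift) simp
  finally show ?thesis ..
qed

lemma card_enum:
  fixes r :: "'n::finite \<Rightarrow> nat"
  assumes "bij_betw r UNIV {..<CARD('n)}" "k \<le> CARD('n)"
  shows "card {q. r q < k} = k"
proof -
  have "bij_betw r {q. r q < k} {..<k}"
  proof (rule bij_betw_subset[OF assms(1)])
    have "m \<in> r ` {q. r q < k}" if "m < k" for m
    proof -
      have "m \<in> range r" using assms that by (auto simp: bij_betw_def)
      then show ?thesis using that by auto
    qed
    then show "r ` {q. r q < k} = {..<k}" by auto
  qed simp
  then show ?thesis by (simp add: bij_betw_same_card)
qed

lemma prod_linear_poly:
  fixes a :: "'n \<Rightarrow> complex"
  assumes "finite S"
  shows "degree (\<Prod>p\<in>S. [:- a p, 1:]) = card S" "coeff (\<Prod>p\<in>S. [:- a p, 1:]) (card S) = 1"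
    "poly (\<Prod>p\<in>S. [:- a p, 1:]) z = (\<Prod>p\<in>S. z - a p)"
    "poly (pderiv (\<Prod>p\<in>S. [:- a p, 1:])) z = (\<Sum>p\<in>S. \<Prod>q\<in>S - {p}. z - a q)"
proof -
  show d: "degree (\<Prod>p\<in>S. [:- a p, 1:]) = card S"
    by (subst degree_prod_eq_sum_degree) auto
  have "lead_coeff (\<Prod>p\<in>S. [:- a p, 1:]) = 1"
    by (simp add: lead_coeff_prod)
  then show "coeff (\<Prod>p\<in>S. [:- a p, 1:]) (card S) = 1" by (simp only: d)
  show "poly (\<Prod>p\<in>S. [:- a p, 1:]) z = (\<Prod>p\<in>S. z - a p)"
    by (simp add: poly_prod)
  show "poly (pderiv (\<Prod>p\<in>S. [:- a p, 1:])) z = (\<Sum>p\<in>S. \<Prod>q\<in>S - {p}. z - a q)"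
    by (simp add: pderiv_prod poly_sum poly_prod pderiv_pCons)
qed

context
  fixes r :: "'n::finite \<Rightarrow> nat" and j :: 'n and k :: nat
  assumes r: "bij_betw r UNIV {..<CARD('n)}" and j: "r j = k"
begin

lemma k_le: "k \<le> CARD('n)"
  using r j rangeI[of r j] by (auto simp: bij_betw_def)

text \<open>The monic \<open>Q\<close> with roots \<open>a p\<close> for all earlier
  \<open>p\<close> leaves only the term of \<open>j\<close> in \<open>pdet_expand\<close>.\<close>

lemma vand_Suc: "vand r (Suc k) a = (\<Prod>p | r p < k. a j - a p) * vand r k a"
proof -
  let ?S = "{p. r p < k}"
  let ?P = "\<Prod>p\<in>?S. [:- a p, 1:]"
  have c: "card ?S = k" by (rule card_enum[OF r k_le])
  have d: "degree ?P \<le> k" using prod_linear_poly(1)[of ?S a] c by simp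
  have z: "poly ?P (a p) = 0" if "r p < k" for p
    using that by (auto simp: prod_linear_poly(3))
  show ?thesis
    using pdet_expand[OF r j d, of "\<lambda>p m. a p ^ m"] prod_linear_poly(2)[of ?S a] c
    by (simp add: poly_sum_le[OF d] vand_def z) (simp add: prod_linear_poly(3))
qed

text \<open>Here \<open>Q\<close> has all earlier points except \<open>a p\<close> as roots. Its
  degree is below \<open>k\<close>, so the left-hand side of \<open>pdet_expand\<close> vanishes and
  the terms of \<open>j\<close> and \<open>p\<close> must balance.\<close>

lemma vand_transpose:
  assumes "r p < k"
  shows "(\<Prod>q\<in>{q. r q < k} - {p}. a p - a q) * vand r k (a \<circ> Transposition.transpose p j) =
         (\<Prod>q\<in>{q. r q < k} - {p}. a j - a q) * vand r k a"
proof -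
  let ?S = "{q. r q < k}"
  let ?Q = "\<Prod>p\<in>?S - {p}. [:- a p, 1:]"
  have c: "card (?S - {p}) < k" using card_enum[OF r k_le] assms by (simp add: card_gt_0_iff) 
  have d: "degree ?Q \<le> k" "coeff ?Q k = 0"
    using prod_linear_poly(1)[of "?S - {p}" a] c by (auto intro: coeff_eq_0)
  have z: "poly ?Q (a q) = 0" if "r q < k" "q \<noteq> p" for q
    using that by (auto simp: prod_linear_poly(3))
  have "(\<Sum>q | r q < k. poly ?Q (a q) * vand r k (a \<circ> Transposition.transpose q j)) =
     (\<Sum>q | r q < k. if q = p then poly ?Q (a p) * vand r k (a \<circ> Transposition.transpose p j) else 0)"
    by (rule sum.cong) (auto simp: z)
  also have "\<dots> = poly ?Q (a p) * vand r k (a \<circ> Transposition.transpose p j)"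
    using assms by simp
  finally show ?thesis
    using pdet_expand[OF r j d(1), of "\<lambda>p m. a p ^ m"] d(2)
    by (simp add: poly_sum_le[OF d(1)] vand_def o_def) (simp add: prod_linear_poly(3))
qed

text \<open>With the \<open>Q\<close> of \<open>vand_Suc\<close>, the combined entry is
  \<open>c p\<close> times \<open>Q\<close> plus the derivative of \<open>Q\<close>, both at
  \<open>a p\<close>. At the earlier points only the derivative survives, and there it is the
  product over the remaining points.\<close>

lemma dvand_Suc:
  "dvand r (Suc k) a c = (c j * (\<Prod>p | r p < k. a j - a p)
       + (\<Sum>p | r p < k. \<Prod>q\<in>{q. r q < k} - {p}. a j - a q)) * dvand r k a c
     - (\<Sum>p | r p < k. (\<Prod>q\<in>{q. r q < k} - {p}. a p - a q) *
           dvand r k (a \<circ> Transposition.transpose p j) (c \<circ> Transposition.transpose p j))"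
proof -
  let ?S = "{p. r p < k}"
  let ?P = "\<Prod>p\<in>?S. [:- a p, 1:]"
  have c: "card ?S = k" by (rule card_enum[OF r k_le])
  have d: "degree ?P \<le> k" using prod_linear_poly(1)[of ?S a] c by simp
  have z: "poly ?P (a p) = 0" if "r p < k" for p
    using that by (auto simp: prod_linear_poly(3))
  have z': "poly (pderiv ?P) (a p) = (\<Prod>q\<in>?S - {p}. a p - a q)" if "r p < k" for p
  proof -
    have "(\<Sum>p'\<in>?S. \<Prod>q\<in>?S - {p'}. a p - a q) =
        (\<Sum>p'\<in>?S. if p' = p then \<Prod>q\<in>?S - {p}. a p - a q else 0)"
      using that by (intro sum.cong) auto
    also have "\<dots> = (\<Prod>q\<in>?S - {p}. a p - a q)"
      using that by simp
    finally show ?thesis by (simp add: prod_linear_poly(4))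
  qed
  have L: "(\<Sum>m\<le>k. coeff ?P m * (c p * a p ^ m + of_nat m * a p ^ (m - 1))) =
      c p * poly ?P (a p) + poly (pderiv ?P) (a p)" for p
    unfolding poly_sum_le[OF d, symmetric] pderiv_sum_le[OF d, symmetric] sum_distrib_left sum.distrib[symmetric]
    by (rule sum.cong) (simp_all only: distrib_left mult.left_commute)
  show ?thesis
    using pdet_expand[OF r j d, of "\<lambda>p m. c p * a p ^ m + of_nat m * a p ^ (m - 1)"] prod_linear_poly(2)[of ?S a] c
    unfolding L
    by (simp add: dvand_def z z' o_def)
       (simp add: prod_linear_poly(3,4))
qed

end

lemma vand_prod:
  fixes r :: "'n::finite \<Rightarrow> nat"
  assumes r: "bij_betw r UNIV {..<CARD('n)}" and "k \<le> CARD('n)"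
  shows "vand r k a = (\<Prod>q | r q < k. \<Prod>p | r p < r q. a q - a p)"
  using assms(2)
proof (induction k)
  case 0
  then show ?case by (simp add: vand_def pdet_0)
next
  case (Suc k)
  then have "k \<in> range r" using r by (auto simp: bij_betw_def)
  then obtain j where j: "r j = k" by auto
  have rinj: "r p = r q \<longleftrightarrow> p = q" for p q
    using r by (auto simp: bij_betw_def inj_on_def)
  have "{q. r q < Suc k} = insert j {q. r q < k}"
    using j rinj by (auto simp: less_Suc_eq)
  then show ?case
    using Suc j by (simp add: vand_Suc[OF r j])
qed

section \<open>Principal minors, their cofactors and infinitesimal rotations\<close>

definition minor :: "'n::finite set \<Rightarrow> ('n \<Rightarrow> 'n \<Rightarrow> complex) \<Rightarrow> complex" where
  "minor S Y = mdet (\<lambda>p q. if p \<in> S then Y p q else unit_row p q)"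

text \<open>For \<open>i\<close> in \<open>S\<close> and \<open>j\<close> outside, the determinant
  of this matrix is the cofactor of the entry \<open>(j, i)\<close> in the minor on
  \<open>insert j S\<close>.\<close>

definition border_mat :: "'n::finite set \<Rightarrow> 'n \<Rightarrow> 'n \<Rightarrow> ('n \<Rightarrow> 'n \<Rightarrow> complex) \<Rightarrow> 'n \<Rightarrow> 'n \<Rightarrow> complex" where
  "border_mat S i j Y = (\<lambda>p q. if p \<in> S then Y p q else if p = j then unit_row i q else unit_row p q)"

lemma minor_insert:
  assumes "j \<notin> S"
  shows "minor (insert j S) Y = Y j j * minor S Y + (\<Sum>i\<in>S. Y j i * mdet (border_mat S i j Y))"
proof -
  let ?f = "\<lambda>p q. if p \<in> insert j S then Y p q else unit_row p q"
  have "?f = ?f(j := \<lambda>q. \<Sum>i\<in>UNIV. Y j i * unit_row i q)"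
    by (auto simp: fun_eq_iff sum_unit_row)
  then have "minor (insert j S) Y = (\<Sum>i\<in>UNIV. Y j i * mdet (?f(j := unit_row i)))"
    unfolding minor_def using mdet_row_sum[of UNIV ?f j "\<lambda>i. Y j i" unit_row] by simp
  also have "\<dots> = (\<Sum>i\<in>insert j S. Y j i * mdet (?f(j := unit_row i)))"
  proof (rule sum.mono_neutral_right)
    show "\<forall>i\<in>UNIV - insert j S. Y j i * mdet (?f(j := unit_row i)) = 0"
    proof
      fix i assume "i \<in> UNIV - insert j S"
      then have "mdet (?f(j := unit_row i)) = 0"
        by (intro mdet_eq_rows[where p=i and p'=j]) auto
      then show "Y j i * mdet (?f(j := unit_row i)) = 0" by simp
    qed
  qed auto
  also have "\<dots> = Y j j * mdet (?f(j := unit_row j)) + (\<Sum>i\<in>S. Y j i * mdet (?f(j := unit_row i)))"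
    using assms by simp
  also have "?f(j := unit_row j) = (\<lambda>p q. if p \<in> S then Y p q else unit_row p q)"
    using assms by (auto simp: fun_eq_iff)
  also have "(\<Sum>i\<in>S. Y j i * mdet (?f(j := unit_row i))) = (\<Sum>i\<in>S. Y j i * mdet (border_mat S i j Y))"
  proof (rule sum.cong[OF refl])
    fix i
    have "?f(j := unit_row i) = border_mat S i j Y"
      using assms by (auto simp: fun_eq_iff border_mat_def)
    then show "Y j i * mdet (?f(j := unit_row i)) = Y j i * mdet (border_mat S i j Y)" by simp
  qed
  finally show ?thesis by (simp add: minor_def)
qed

lemma mdet_row_upd_eq_col_upd:
  "mdet (f(p := unit_row j)) = mdet (col_upd f j (unit_row p))"
proof -
  have "mdet (f(p := unit_row j)) = mdet ((col_upd f j (unit_row p))(p := unit_row j))"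
    by (rule mdet_unit_row_cong[where p=p and j=j]) (auto simp: col_upd_def)
  also have "\<dots> = mdet (col_upd f j (unit_row p))"
    by (rule mdet_unit_col_cong[where p=p and j=j]) (auto simp: col_upd_def unit_row_def)
  finally show ?thesis .
qed

text \<open>This is the expansion along column \<open>j\<close> of the matrix whose column
  \<open>j\<close> has been overwritten by column \<open>i\<close>.\<close>

lemma mdet_alien_cofactors:
  assumes "i \<noteq> j"
  shows "(\<Sum>p\<in>UNIV. f p i * mdet (f(p := unit_row j))) = 0"
proof -
  have "(\<Sum>p\<in>UNIV. f p i * mdet (f(p := unit_row j))) = mdet (col_upd f j (\<lambda>q. \<Sum>p\<in>UNIV. f p i * unit_row p q))"
    by (simp add: mdet_row_upd_eq_col_upd mdet_col_sum)
  also have "\<dots> = 0"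
    unfolding sum_unit_row
    by (rule mdet_eq_cols[OF assms]) (use assms in \<open>auto simp: col_upd_def\<close>)
  finally show ?thesis .
qed

lemma mdet_row_linear:
  "mdet (f(p := \<lambda>q. c * g q + d * h q)) = c * mdet (f(p := g)) + d * mdet (f(p := h))"
  using mdet_row_sum[of "UNIV :: bool set" f p "\<lambda>t. if t then c else d" "\<lambda>t. if t then g else h"]
  by (simp add: UNIV_bool add.commute)

text \<open>The derivative of a bordered minor along \<open>E\<^sub>i\<^sub>j Y - Y E\<^sub>i\<^sub>j\<close>.\<close>

lemma border_rotation:
  fixes Y :: "'n::finite \<Rightarrow> 'n \<Rightarrow> complex"
  assumes "i \<in> S" "j \<notin> S"
  shows "(\<Sum>p\<in>S. mdet ((border_mat S i j Y)(p := \<lambda>q. (if p = i then Y j q else 0) - (if q = j then Y p i else 0)))) =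
    minor S Y - minor (insert j (S - {i})) Y"
proof -
  let ?B = "border_mat S i j Y"
  have ij: "i \<noteq> j" using assms by auto
  have row: "(\<lambda>q. (if p = i then Y j q else 0) - (if q = j then Y p i else 0)) =
     (\<lambda>q. (if p = i then 1 else 0) * Y j q + (- Y p i) * unit_row j q)" for p
    by (auto simp: fun_eq_iff unit_row_def)
  have "(\<Sum>p\<in>S. mdet (?B(p := \<lambda>q. (if p = i then Y j q else 0) - (if q = j then Y p i else 0)))) =
    (\<Sum>p\<in>S. if p = i then mdet (?B(i := Y j)) else 0) - (\<Sum>p\<in>S. ?B p i * mdet (?B(p := unit_row j)))"
    unfolding row mdet_row_linear sum_subtractf[symmetric]
    by (rule sum.cong) (auto simp: border_mat_def[of S i j Y])
  also have "(\<Sum>p\<in>S. if p = i then mdet (?B(i := Y j)) else 0) = mdet (?B(i := Y j))"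
    using assms by simp
  also have "mdet (?B(i := Y j)) = - minor (insert j (S - {i})) Y"
  proof -
    have "Transposition.transpose i j permutes UNIV" by (simp add: permutes_swap_id)
    from mdet_permute_rows[OF this, of "?B(i := Y j)"]
    have "mdet (\<lambda>p. (?B(i := Y j)) (Transposition.transpose i j p)) = - mdet (?B(i := Y j))"
      using ij by (simp add: sign_swap_id)
    moreover have "(\<lambda>p. (?B(i := Y j)) (Transposition.transpose i j p)) =
       (\<lambda>p q. if p \<in> insert j (S - {i}) then Y p q else unit_row p q)"
      using assms ij by (auto simp: fun_eq_iff border_mat_def Transposition.transpose_def)
    ultimately show ?thesis by (simp add: minor_def)
  qed
  also have "(\<Sum>p\<in>S. ?B p i * mdet (?B(p := unit_row j))) = - minor S Y"
  proof -
    have "0 = (\<Sum>p\<in>UNIV. ?B p i * mdet (?B(p := unit_row j)))"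
      by (rule mdet_alien_cofactors[OF ij, symmetric])
    also have "\<dots> = (\<Sum>p\<in>insert j S. ?B p i * mdet (?B(p := unit_row j)))"
      by (rule sum.mono_neutral_right) (use assms in \<open>auto simp: border_mat_def unit_row_def\<close>)
    also have "\<dots> = mdet (?B(j := unit_row j)) + (\<Sum>p\<in>S. ?B p i * mdet (?B(p := unit_row j)))"
      using assms by (simp add: border_mat_def unit_row_def)
    also have "?B(j := unit_row j) = (\<lambda>p q. if p \<in> S then Y p q else unit_row p q)"
      using assms by (auto simp: fun_eq_iff border_mat_def)
    finally have "minor S Y + (\<Sum>p\<in>S. ?B p i * mdet (?B(p := unit_row j))) = 0"
      unfolding minor_def by (rule sym)
    then show ?thesis by (rule eq_neg_iff_add_eq_0[THEN iffD2, OF trans[OF add.commute]])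
  qed
  finally show ?thesis by (simp only: minus_diff_minus minus_diff_eq)
qed

subsection \<open>Differentiating conjugation invariance\<close>

lemma continuous_on_mdet [continuous_intros]:
  assumes "\<And>p q. continuous_on S (\<lambda>x. f x p q)"
  shows "continuous_on S (\<lambda>x. mdet (f x))"
  unfolding mdet_perm by (intro continuous_intros assms)

lemma has_vector_derivative_mdet:
  assumes "\<And>p q. ((\<lambda>t. f t p q) has_vector_derivative f' p q) (at t)"
  shows "((\<lambda>t. mdet (f t)) has_vector_derivative (\<Sum>p\<in>UNIV. mdet ((f t)(p := f' p)))) (at t)"
proof -
  have *: "(\<Prod>a\<in>UNIV. ((f t)(p := h)) a (\<sigma> a)) = h (\<sigma> p) * (\<Prod>a\<in>UNIV - {p}. f t a (\<sigma> a))" for h \<sigma> p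
    by (subst prod.remove[of _ p]) (auto intro!: prod.cong)
  have "((\<lambda>t. \<Prod>p\<in>UNIV. f t p (\<sigma> p)) has_vector_derivative
      (\<Sum>p\<in>UNIV. f' p (\<sigma> p) * (\<Prod>a\<in>UNIV - {p}. f t a (\<sigma> a)))) (at t)" for \<sigma>
    using has_derivative_prod[of UNIV "\<lambda>p t. f t p (\<sigma> p)" "\<lambda>p y. y *\<^sub>R f' p (\<sigma> p)" t UNIV] assms
    by (simp add: has_vector_derivative_def scaleR_sum_right)
  then have "((\<lambda>t. mdet (f t)) has_vector_derivative
      (\<Sum>\<sigma> | \<sigma> permutes UNIV. of_int (sign \<sigma>) * (\<Sum>p\<in>UNIV. f' p (\<sigma> p) * (\<Prod>a\<in>UNIV - {p}. f t a (\<sigma> a))))) (at t)"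
    unfolding mdet_perm
    by (intro has_vector_derivative_sum has_vector_derivative_mult_right)
  then show ?thesis
    unfolding mdet_perm * sum_distrib_left by (subst sum.swap)
qed

text \<open>Difference quotients are the form to which dominated convergence applies.\<close>

lemma has_vector_derivative_iff_tendsto:
  "(f has_vector_derivative D) (at t) \<longleftrightarrow> ((\<lambda>u. (f u - f t) /\<^sub>R (u - t)) \<longlongrightarrow> D) (at t)"
proof -
  have "norm ((f u - f t) /\<^sub>R (u - t) - D) = norm (f u - f t - (u - t) *\<^sub>R D) / norm (u - t)" if "u \<noteq> t" for u
  proof -
    have "(f u - f t) /\<^sub>R (u - t) - D = (f u - f t - (u - t) *\<^sub>R D) /\<^sub>R (u - t)"
      using that by (simp add: scaleR_diff_right)
    then show ?thesis by (simp add: divide_inverse mult.commute)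
  qed
  then have "((\<lambda>u. norm ((f u - f t) /\<^sub>R (u - t) - D)) \<longlongrightarrow> 0) (at t) \<longleftrightarrow>
      ((\<lambda>u. norm (f u - f t - (u - t) *\<^sub>R D) / norm (u - t)) \<longlongrightarrow> 0) (at t)"
    by (intro Lim_cong_within) auto
  then show ?thesis
    unfolding has_vector_derivative_def has_derivative_iff_norm tendsto_norm_zero_iff LIM_zero_iff
    by (simp add: bounded_linear_scaleR_left)
qed

text \<open>If \<open>K ** K ** K = - K\<close>, this is the matrix exponential of
  \<open>t *\<^sub>R K\<close> (Rodrigues' formula). The closed form replaces the exponential
  series.\<close>

definition rot :: "complex^'n^'n \<Rightarrow> real \<Rightarrow> complex^'n^'n" where
  "rot K t = mat 1 + sin t *\<^sub>R K + (1 - cos t) *\<^sub>R (K ** K)"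

lemma matrix_add_rdistrib: "(A + B) ** C = A ** C + B ** (C :: complex^'n^'m)"
  by (vector matrix_matrix_mult_def sum.distrib[symmetric] field_simps)

lemma matrix_scaleR_left: "(c *\<^sub>R A) ** B = c *\<^sub>R (A ** (B :: complex^'n^'m))"
  by (simp add: matrix_matrix_mult_def vec_eq_iff scaleR_sum_right)

lemma matrix_scaleR_right: "A ** (c *\<^sub>R B) = c *\<^sub>R (A ** (B :: complex^'n^'m))"
  by (simp add: matrix_matrix_mult_def vec_eq_iff scaleR_sum_right)

lemma hconj_add: "(A + B)\<^sup>\<dagger> = A\<^sup>\<dagger> + B\<^sup>\<dagger>"
  and hconj_scaleR: "(c *\<^sub>R A)\<^sup>\<dagger> = c *\<^sub>R A\<^sup>\<dagger>"
  and hconj_one: "(mat 1)\<^sup>\<dagger> = mat 1"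
  and hconj_mult: "(A ** C)\<^sup>\<dagger> = C\<^sup>\<dagger> ** A\<^sup>\<dagger>"
  and hconj_hconj: "(A\<^sup>\<dagger>)\<^sup>\<dagger> = A"
  by (auto simp: hconj_def vec_eq_iff mat_def matrix_matrix_mult_def mult.commute)

lemma matrix_minus_left: "(- A) ** B = - (A ** (B :: complex^'n^'m))"
  and matrix_minus_right: "A ** (- B) = - (A ** (B :: complex^'n^'m))"
  by (simp_all add: matrix_matrix_mult_def vec_eq_iff sum_negf)

text \<open>The span of the identity, \<open>K\<close> and \<open>K ** K\<close> is closed under
  multiplication; unitarity is the multiplication rule there together with the Pythagorean identity
  for sine and cosine.\<close>

lemma rot_unitary:
  assumes "K\<^sup>\<dagger> = - K" "K ** K ** K = - K"
  shows "rot K t \<in> unitary_group"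
proof -
  define L where "L = K ** K"
  have KL: "K ** L = - K" "L ** K = - K"
    using assms(2) by (simp_all add: L_def matrix_mul_assoc)
  have LL: "L ** L = - L"
    by (metis KL(1) L_def matrix_minus_right matrix_mul_assoc)
  have h: "(rot K t)\<^sup>\<dagger> = mat 1 - sin t *\<^sub>R K + (1 - cos t) *\<^sub>R L"
    by (simp add: rot_def L_def hconj_add hconj_scaleR hconj_one hconj_mult assms(1)
        matrix_minus_left matrix_minus_right)
  have "(sin t)\<^sup>2 = 1 - (cos t)\<^sup>2" by (simp add: sin_squared_eq)
  then have s: "sin t * sin t = 1 - cos t * cos t" by (simp add: power2_eq_square)
  have *: "(mat 1 + a *\<^sub>R K + c *\<^sub>R L) ** (mat 1 + b *\<^sub>R K + d *\<^sub>R L) =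
      mat 1 + (a + b - a * d - c * b) *\<^sub>R K + (c + d + a * b - c * d) *\<^sub>R L" for a b c d
  proof -
    have "(mat 1 + a *\<^sub>R K + c *\<^sub>R L) ** (mat 1 + b *\<^sub>R K + d *\<^sub>R L) =
      mat 1 + b *\<^sub>R K + d *\<^sub>R L + (a *\<^sub>R K + b *\<^sub>R a *\<^sub>R L + d *\<^sub>R a *\<^sub>R (- K))
       + (c *\<^sub>R L + b *\<^sub>R c *\<^sub>R (- K) + d *\<^sub>R c *\<^sub>R (- L))"
      by (simp only: matrix_add_ldistrib matrix_add_rdistrib matrix_scaleR_left matrix_scaleR_right KL LL
       L_def[symmetric] matrix_mul_lid matrix_mul_rid scaleR_right_distrib ac_simps)
    then show ?thesis by (simp add: vec_eq_iff scaleR_conv_of_real algebra_simps)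
  qed
  have **: "2 * (1 - cos t) - sin t * sin t - (1 - cos t) * (1 - cos t) = 0"
    unfolding s by (simp add: algebra_simps)
  have "(rot K t)\<^sup>\<dagger> ** rot K t = mat 1" "rot K t ** (rot K t)\<^sup>\<dagger> = mat 1"
    unfolding h unfolding rot_def L_def[symmetric]
    using *[of "sin t" "1 - cos t" "- sin t" "1 - cos t"] *[of "- sin t" "1 - cos t" "sin t" "1 - cos t"] **
    by simp_all
  then show ?thesis by (simp add: unitary_group_def)
qed

lemma rot_has_vector_derivative:
  assumes "K ** K ** K = - K"
  shows "((\<lambda>t. rot K t $ p $ q) has_vector_derivative (K ** rot K t) $ p $ q) (at t)"
proof -
  have "K ** (mat 1 + a *\<^sub>R K + c *\<^sub>R (K ** K)) = (1 - c) *\<^sub>R K + a *\<^sub>R (K ** K)" for a c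
    using assms
    by (simp add: matrix_add_ldistrib matrix_scaleR_right matrix_mul_assoc scaleR_left_diff_distrib)
  from this[of "sin t" "1 - cos t"] have "K ** rot K t = cos t *\<^sub>R K + sin t *\<^sub>R (K ** K)"
    by (simp add: rot_def)
  then show ?thesis
    by (simp add: rot_def) (auto intro!: derivative_eq_intros)
qed

lemma rot_conj_entry:
  "(W ** A ** W\<^sup>\<dagger>) $ p $ q = (\<Sum>b\<in>UNIV. \<Sum>a\<in>UNIV. W $ p $ a * A $ a $ b * cnj (W $ q $ b))"
  by (simp add: matrix_matrix_mult_def hconj_def sum_distrib_right)

lemma rot_conj_has_vector_derivative:
  fixes A K :: "complex^'n^'n"
  assumes "K\<^sup>\<dagger> = - K" "K ** K ** K = - K"
  defines "C \<equiv> \<lambda>t. rot K t ** A ** (rot K t)\<^sup>\<dagger>"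
  shows "((\<lambda>t. C t $ p $ q) has_vector_derivative (K ** C t - C t ** K) $ p $ q) (at t)"
proof -
  let ?W = "rot K t"
  have "K ** C t - C t ** K = (K ** ?W) ** A ** ?W\<^sup>\<dagger> + ?W ** A ** (K ** ?W)\<^sup>\<dagger>"
    by (simp add: C_def matrix_mul_assoc hconj_mult assms(1) matrix_minus_right)
  also have "\<dots> $ p $ q = (\<Sum>b\<in>UNIV. \<Sum>a\<in>UNIV. (K ** ?W) $ p $ a * A $ a $ b * cnj (?W $ q $ b)
       + ?W $ p $ a * A $ a $ b * cnj ((K ** ?W) $ q $ b))"
    by (simp add: matrix_matrix_mult_def hconj_def sum_distrib_right sum.distrib)
  finally show ?thesis
    unfolding C_def rot_conj_entry
    by (simp only:)
       (auto intro!: derivative_eq_intros has_vector_derivative_sum has_vector_derivative_mult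
         has_vector_derivative_cnj rot_has_vector_derivative[OF assms(2)] simp: algebra_simps)
qed

lemma continuous_on_rot_conj:
  fixes f :: "'a::real_normed_vector \<Rightarrow> real"
  assumes "continuous_on S f" "continuous_on S g"
  shows "continuous_on S (\<lambda>x. (rot K (f x) ** g x ** (rot K (f x))\<^sup>\<dagger>) $ p $ q)"
  unfolding rot_conj_entry rot_def by (simp, intro continuous_intros continuous_on_sin continuous_on_cos assms)

text \<open>The exponential of the trace of \<open>diag_mat b ** A\<close>.\<close>

definition wt :: "('n::finite \<Rightarrow> real) \<Rightarrow> complex^'n^'n \<Rightarrow> complex" where
  "wt b A = exp (\<Sum>p\<in>UNIV. of_real (b p) * A $ p $ p)"

section \<open>Expectations under a conjugation invariant law\<close>

locale conj_invariant = prob_space M for M :: "'w measure" +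
  fixes Y :: "'w \<Rightarrow> complex^'n::finite^'n"
  assumes Y_measurable [measurable]: "Y \<in> borel_measurable M"
    and Y_bounded: "\<exists>R. \<forall>w\<in>space M. norm (Y w) \<le> R"
    and Y_conj: "\<And>W f. W \<in> unitary_group \<Longrightarrow> continuous_on UNIV f \<Longrightarrow>
       (LINT w|M. f (W ** Y w ** W\<^sup>\<dagger>) :: complex) = (LINT w|M. f (Y w))"
begin

definition Ex :: "(complex^'n^'n \<Rightarrow> complex) \<Rightarrow> complex" where
  "Ex f = (LINT w|M. f (Y w))"

lemma Ex_conj:
  assumes "W \<in> unitary_group" "continuous_on UNIV f"
  shows "Ex (\<lambda>A. f (W ** A ** W\<^sup>\<dagger>)) = Ex f"
  using Y_conj[OF assms] by (simp add: Ex_def)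

lemma Y_compose_measurable [measurable]:
  assumes "continuous_on UNIV (f :: complex^'n^'n \<Rightarrow> complex)"
  shows "(\<lambda>w. f (Y w)) \<in> borel_measurable M"
  using borel_measurable_continuous_onI[OF assms] Y_measurable by measurable

lemma Y_compact: "\<exists>C. compact C \<and> (\<forall>w\<in>space M. Y w \<in> C)"
proof -
  obtain R where "\<forall>w\<in>space M. norm (Y w) \<le> R" using Y_bounded ..
  then show ?thesis by (intro exI[of _ "cball 0 R"]) auto
qed

lemma Y_integrable:
  assumes "continuous_on UNIV (f :: complex^'n^'n \<Rightarrow> complex)"
  shows "integrable M (\<lambda>w. f (Y w))"
proof -
  obtain C where C: "compact C" "\<And>w. w \<in> space M \<Longrightarrow> Y w \<in> C"
    using Y_compact by blast
  have "compact (f ` C)"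
    using assms C by (intro compact_continuous_image) (auto intro: continuous_on_subset)
  then obtain B where "\<And>A. A \<in> C \<Longrightarrow> norm (f A) \<le> B"
    by (force dest!: compact_imp_bounded simp: bounded_iff)
  then show ?thesis
    using C Y_compose_measurable[OF assms] by (intro integrable_const_bound[of _ B]) auto
qed

lemma Ex_add: "continuous_on UNIV f \<Longrightarrow> continuous_on UNIV g \<Longrightarrow> Ex (\<lambda>A. f A + g A) = Ex f + Ex g"
  and Ex_diff: "continuous_on UNIV f \<Longrightarrow> continuous_on UNIV g \<Longrightarrow> Ex (\<lambda>A. f A - g A) = Ex f - Ex g"
  and Ex_mult: "Ex (\<lambda>A. c * f A) = c * Ex f"
  and Ex_sum: "(\<And>i. i \<in> I \<Longrightarrow> continuous_on UNIV (F i)) \<Longrightarrow> Ex (\<lambda>A. \<Sum>i\<in>I. F i A) = (\<Sum>i\<in>I. Ex (F i))"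
  unfolding Ex_def
  by (auto intro!: Bochner_Integration.integral_add Bochner_Integration.integral_diff
      Bochner_Integration.integral_sum Y_integrable)

lemma Ex_tendsto:
  fixes f :: "nat \<Rightarrow> complex^'n^'n \<Rightarrow> complex"
  assumes "\<And>n. continuous_on UNIV (f n)" "continuous_on UNIV g"
    and "\<And>w. w \<in> space M \<Longrightarrow> (\<lambda>n. f n (Y w)) \<longlonglongrightarrow> g (Y w)"
    and "\<And>n w. w \<in> space M \<Longrightarrow> norm (f n (Y w)) \<le> B"
  shows "(\<lambda>n. Ex (f n)) \<longlonglongrightarrow> Ex g"
  unfolding Ex_def
  by (rule integral_dominated_convergence[where w="\<lambda>_. B"])
     (use assms in \<open>auto intro: Y_compose_measurable\<close>)

text \<open>Boundedness of \<open>Y\<close> confines everything to a compact set, where the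
  continuous derivative is bounded. The mean value inequality turns this bound into a dominating
  constant for the difference quotients.\<close>

lemma Ex_has_vector_derivative:
  fixes f :: "real \<Rightarrow> complex^'n^'n \<Rightarrow> complex"
  assumes f: "\<And>t. continuous_on UNIV (f t)"
    and f': "continuous_on UNIV (\<lambda>x. f' (fst x) (snd x))"
    and d: "\<And>t A. ((\<lambda>t. f t A) has_vector_derivative f' t A) (at t)"
  shows "((\<lambda>t. Ex (f t)) has_vector_derivative Ex (f' t)) (at t)"
proof -
  obtain C where C: "compact C" "\<And>w. w \<in> space M \<Longrightarrow> Y w \<in> C"
    using Y_compact by blast
  have "compact ((\<lambda>x. f' (fst x) (snd x)) ` (cball t 1 \<times> C))"
    by (intro compact_continuous_image compact_Times C compact_cball continuous_on_subset[OF f']) auto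
  then obtain B where B: "\<And>x. x \<in> cball t 1 \<times> C \<Longrightarrow> norm (f' (fst x) (snd x)) \<le> B"
    by (force dest!: compact_imp_bounded simp: bounded_iff)
  have B': "norm (f' u A) \<le> B" if "u \<in> cball t 1" "A \<in> C" for u A
    using B[of "(u, A)"] that by simp
  have lip: "norm (f u A - f t A) \<le> B * norm (u - t)" if "u \<in> cball t 1" "A \<in> C" for u A
  proof (rule differentiable_bound[of "cball t 1" "\<lambda>u. f u A" "\<lambda>u y. y *\<^sub>R f' u A"])
    fix v assume "v \<in> cball t 1"
    then show "onorm (\<lambda>y. y *\<^sub>R f' v A) \<le> B"
      using B'[of v A] that
      by (intro onorm_le) (simp add: mult.commute[of B] mult_left_mono)
    show "((\<lambda>u. f u A) has_derivative (\<lambda>y. y *\<^sub>R f' v A)) (at v within cball t 1)"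
      using d[of A v] by (auto simp: has_vector_derivative_def intro: has_derivative_at_withinI)
  qed (use that in auto)
  have cf': "continuous_on UNIV (f' t)" for t
    using continuous_on_compose2[OF f', of UNIV "\<lambda>A. (t, A)"] by (simp add: continuous_on_Pair)
  have "((\<lambda>u. (Ex (f u) - Ex (f t)) /\<^sub>R (u - t)) \<longlongrightarrow> Ex (f' t)) (at t)"
    unfolding tendsto_at_iff_sequentially comp_def
  proof (intro allI impI)
    fix X :: "nat \<Rightarrow> real"
    assume X: "\<forall>i. X i \<in> UNIV - {t}" "X \<longlonglongrightarrow> t"
    then obtain N where N: "\<And>n. n \<ge> N \<Longrightarrow> dist (X n) t < 1"
      by (metis lim_sequentially zero_less_one)
    have "(\<lambda>n. Ex (\<lambda>A. inverse (X (n + N) - t) *\<^sub>R (f (X (n + N)) A - f t A))) \<longlonglongrightarrow> Ex (f' t)"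
    proof (rule Ex_tendsto)
      show "continuous_on UNIV (\<lambda>A. inverse (X (n + N) - t) *\<^sub>R (f (X (n + N)) A - f t A))" for n
        by (intro continuous_intros f)
      show "continuous_on UNIV (f' t)" by (rule cf')
      fix w assume w: "w \<in> space M"
      have "((\<lambda>u. (f u (Y w) - f t (Y w)) /\<^sub>R (u - t)) \<longlongrightarrow> f' t (Y w)) (at t)"
        using d[of "Y w" t] by (simp only: has_vector_derivative_iff_tendsto)
      then have "(\<lambda>n. (f (X n) (Y w) - f t (Y w)) /\<^sub>R (X n - t)) \<longlonglongrightarrow> f' t (Y w)"
        using X by (auto simp: tendsto_at_iff_sequentially comp_def)
      then show "(\<lambda>n. inverse (X (n + N) - t) *\<^sub>R (f (X (n + N)) (Y w) - f t (Y w))) \<longlonglongrightarrow> f' t (Y w)"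
        by (rule LIMSEQ_ignore_initial_segment)
      fix n
      have "norm (f (X (n + N)) (Y w) - f t (Y w)) \<le> B * \<bar>X (n + N) - t\<bar>"
        using lip[of "X (n + N)" "Y w"] N[of "n + N"] C w by (auto simp: dist_commute)
      moreover have "\<bar>X (n + N) - t\<bar> > 0" using X(1) by auto
      ultimately show "norm (inverse (X (n + N) - t) *\<^sub>R (f (X (n + N)) (Y w) - f t (Y w))) \<le> B"
        unfolding norm_scaleR abs_inverse by (simp add: inverse_eq_divide pos_divide_le_eq)
    qed
    moreover have "Ex (\<lambda>A. inverse c *\<^sub>R (f u A - f t A)) = (Ex (f u) - Ex (f t)) /\<^sub>R c" for c u
      unfolding scaleR_conv_of_real Ex_mult Ex_diff[OF f f] by simp
    ultimately show "(\<lambda>n. (Ex (f (X n)) - Ex (f t)) /\<^sub>R (X n - t)) \<longlonglongrightarrow> Ex (f' t)"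
      by (simp add: LIMSEQ_offset[where k=N])
  qed
  then show ?thesis
    by (simp only: has_vector_derivative_iff_tendsto)
qed

end

lemma has_vector_derivative_exp:
  fixes h :: "real \<Rightarrow> complex"
  assumes "(h has_vector_derivative h') (at t)"
  shows "((\<lambda>t. exp (h t)) has_vector_derivative h' * exp (h t)) (at t)"
  using field_vector_diff_chain_at[OF assms DERIV_exp] by (simp add: o_def)

lemma continuous_on_matrixI:
  fixes f :: "'a::topological_space \<Rightarrow> complex^'n^'m"
  assumes "\<And>p q. continuous_on S (\<lambda>x. f x $ p $ q)"
  shows "continuous_on S f"
proof -
  have "continuous_on S (\<lambda>x. \<chi> p q. f x $ p $ q)"
    by (intro continuous_on_vec_lambda assms)
  then show ?thesis by simp
qed

lemma continuous_on_matrix_mult: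
  fixes f :: "'a::topological_space \<Rightarrow> complex^'n^'m" and g :: "'a \<Rightarrow> complex^'k^'n"
  assumes "continuous_on S f" "continuous_on S g"
  shows "continuous_on S (\<lambda>x. f x ** g x)"
  by (rule continuous_on_matrixI) (simp add: matrix_matrix_mult_def, intro continuous_intros assms)

lemma mdet_zero_row: "mdet (f(p := \<lambda>q. 0)) = 0"
  using mdet_row_sum[of "{}" f p] by simp

lemma continuous_on_wt [continuous_intros]:
  "continuous_on S f \<Longrightarrow> continuous_on S (\<lambda>x. wt b (f x))"
  unfolding wt_def by (intro continuous_intros)

section \<open>Elementary rotations and row determinants\<close>

definition elem_rot :: "'n \<Rightarrow> 'n \<Rightarrow> complex \<Rightarrow> complex^'n^'n" where
  "elem_rot i j z = (\<chi> p q. if p = i \<and> q = j then z else if p = j \<and> q = i then - cnj z else 0)"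

lemma elem_rot_left:
  assumes "i \<noteq> j"
  shows "(elem_rot i j z ** A) $ p $ q = (if p = i then z * A $ j $ q else if p = j then - cnj z * A $ i $ q else 0)"
proof -
  have "(elem_rot i j z ** A) $ p $ q = (\<Sum>k\<in>UNIV. elem_rot i j z $ p $ k * A $ k $ q)"
    by (simp add: matrix_matrix_mult_def)
  also have "\<dots> = (\<Sum>k\<in>UNIV. if p = i \<and> k = j then z * A $ j $ q else if p = j \<and> k = i then - cnj z * A $ i $ q else 0)"
    by (rule sum.cong) (auto simp: elem_rot_def)
  finally show ?thesis using assms by (auto cong: if_cong)
qed

lemma elem_rot_right:
  assumes "i \<noteq> j"
  shows "(A ** elem_rot i j z) $ p $ q = (if q = j then z * A $ p $ i else if q = i then - cnj z * A $ p $ j else 0)"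
proof -
  have "(A ** elem_rot i j z) $ p $ q = (\<Sum>k\<in>UNIV. A $ p $ k * elem_rot i j z $ k $ q)"
    by (simp add: matrix_matrix_mult_def)
  also have "\<dots> = (\<Sum>k\<in>UNIV. if k = i \<and> q = j then z * A $ p $ i else if k = j \<and> q = i then - cnj z * A $ p $ j else 0)"
    by (rule sum.cong) (auto simp: elem_rot_def)
  finally show ?thesis using assms by (auto cong: if_cong)
qed

text \<open>For a unimodular \<open>z\<close> the square of this matrix is minus the projection onto
  the coordinates \<open>i\<close> and \<open>j\<close>, so \<open>rot\<close> applies.\<close>

lemma elem_rot_props:
  assumes "i \<noteq> j" "cmod z = 1"
  shows "(elem_rot i j z)\<^sup>\<dagger> = - elem_rot i j z"
    "elem_rot i j z ** elem_rot i j z ** elem_rot i j z = - elem_rot i j z"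
proof -
  show "(elem_rot i j z)\<^sup>\<dagger> = - elem_rot i j z"
    using assms by (auto simp: hconj_def elem_rot_def vec_eq_iff)
  have "z * cnj z = 1" using assms complex_norm_square[of z] by simp
  then have "z * (cnj z * w) = w" "cnj z * (z * w) = w" for w
    by (simp_all add: mult.assoc[symmetric]) (simp add: mult.commute)
  with assms(1) show "elem_rot i j z ** elem_rot i j z ** elem_rot i j z = - elem_rot i j z"
    by (simp add: matrix_mul_assoc[symmetric] vec_eq_iff elem_rot_left) (simp add: elem_rot_def)
qed

definition row_mix :: "'n set \<Rightarrow> ('n \<Rightarrow> 'n \<Rightarrow> complex) \<Rightarrow> complex^'n^'n \<Rightarrow> 'n \<Rightarrow> 'n \<Rightarrow> complex" where
  "row_mix S C A = (\<lambda>p q. if p \<in> S then A $ p $ q else C p q)"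

text \<open>The derivative of \<open>mdet (row_mix S C A) * wt b A\<close> in direction \<open>H\<close>.\<close>

definition row_mix_deriv ::
  "'n::finite set \<Rightarrow> ('n \<Rightarrow> 'n \<Rightarrow> complex) \<Rightarrow> ('n \<Rightarrow> real) \<Rightarrow> ('n \<Rightarrow> 'n \<Rightarrow> complex) \<Rightarrow> complex^'n^'n \<Rightarrow> complex" where
  "row_mix_deriv S C b H A = ((\<Sum>p\<in>S. mdet ((row_mix S C A)(p := H p)))
      + mdet (row_mix S C A) * (\<Sum>p\<in>UNIV. of_real (b p) * H p p)) * wt b A"

lemma row_mix_deriv_linear:
  "row_mix_deriv S C b (\<lambda>p q. c * H p q + d * G p q) A = c * row_mix_deriv S C b H A + d * row_mix_deriv S C b G A"
  unfolding row_mix_deriv_def mdet_row_linear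
  by (simp add: sum.distrib algebra_simps sum_distrib_left)

lemma continuous_on_fun_upd2:
  assumes "\<And>p q. continuous_on S (\<lambda>x. f x p q)" "\<And>q. continuous_on S (\<lambda>x. g x q)"
  shows "continuous_on S (\<lambda>x. ((f x)(i := g x)) p q)"
  using assms by (cases "p = i") auto

lemma continuous_on_row_mix:
  "continuous_on T f \<Longrightarrow> continuous_on T (\<lambda>x. row_mix S C (f x) p q)"
  unfolding row_mix_def by (cases "p \<in> S") (auto intro!: continuous_intros)

lemma continuous_on_row_mix_deriv:
  assumes "\<And>p q. continuous_on T (\<lambda>x. H x p q)" "continuous_on T f"
  shows "continuous_on T (\<lambda>x. row_mix_deriv S C b (H x) (f x))"
  unfolding row_mix_deriv_def
  by (intro continuous_intros continuous_on_fun_upd2 continuous_on_row_mix assms)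

context conj_invariant
begin

text \<open>Conjugation by \<open>rot K t\<close> does not change the expectation of
  \<open>mdet (row_mix S C A) * wt b A\<close>; its derivative at \<open>t = 0\<close> is the
  commutator direction.\<close>

lemma Ex_row_mix_rot:
  assumes K: "K\<^sup>\<dagger> = - K" "K ** K ** K = - K"
  shows "Ex (\<lambda>A. row_mix_deriv S C b (\<lambda>p q. (K ** A - A ** K) $ p $ q) A) = 0"
proof -
  define Z where "Z t A = rot K t ** A ** (rot K t)\<^sup>\<dagger>" for t A
  define f where "f A = mdet (row_mix S C A) * wt b A" for A
  define g where "g A = row_mix_deriv S C b (\<lambda>p q. (K ** A - A ** K) $ p $ q) A" for A
  have cZ: "continuous_on T (\<lambda>x. Z (u x) (v x))" if "continuous_on T u" "continuous_on T v"
    for u and v :: "'x::real_normed_vector \<Rightarrow> _" and T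
    unfolding Z_def by (rule continuous_on_matrixI) (rule continuous_on_rot_conj[OF that])
  have "((\<lambda>t. Ex (\<lambda>A. f (Z t A))) has_vector_derivative Ex (\<lambda>A. g (Z 0 A))) (at 0)"
  proof (rule Ex_has_vector_derivative)
    fix t :: real
    show "continuous_on UNIV (\<lambda>A. f (Z t A))"
      unfolding f_def by (intro continuous_intros continuous_on_row_mix cZ)
  next
    show "continuous_on UNIV (\<lambda>x. g (Z (fst x) (snd x)))"
      unfolding g_def
      by (intro continuous_on_row_mix_deriv cZ continuous_intros continuous_on_matrix_mult)
  next
    fix t :: real and A
    have d: "((\<lambda>t. Z t A $ p $ q) has_vector_derivative (K ** Z t A - Z t A ** K) $ p $ q) (at t)" for p q
      unfolding Z_def by (rule rot_conj_has_vector_derivative[OF K])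
    let ?H = "\<lambda>p q. (K ** Z t A - Z t A ** K) $ p $ q"
    have "((\<lambda>t. mdet (row_mix S C (Z t A))) has_vector_derivative
        (\<Sum>p\<in>UNIV. mdet ((row_mix S C (Z t A))(p := (\<lambda>q. if p \<in> S then ?H p q else 0))))) (at t)"
      using d by (intro has_vector_derivative_mdet) (auto simp: row_mix_def)
    also have "(\<Sum>p\<in>UNIV. mdet ((row_mix S C (Z t A))(p := (\<lambda>q. if p \<in> S then ?H p q else 0)))) =
        (\<Sum>p\<in>S. mdet ((row_mix S C (Z t A))(p := (\<lambda>q. if p \<in> S then ?H p q else 0))))"
      by (rule sum.mono_neutral_right) (auto simp: mdet_zero_row)
    also have "\<dots> = (\<Sum>p\<in>S. mdet ((row_mix S C (Z t A))(p := ?H p)))"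
      by (rule sum.cong) auto
    finally have 1: "((\<lambda>t. mdet (row_mix S C (Z t A))) has_vector_derivative
        (\<Sum>p\<in>S. mdet ((row_mix S C (Z t A))(p := ?H p)))) (at t)" .
    have 2: "((\<lambda>t. wt b (Z t A)) has_vector_derivative (\<Sum>p\<in>UNIV. of_real (b p) * ?H p p) * wt b (Z t A)) (at t)"
      unfolding wt_def
      by (intro has_vector_derivative_exp has_vector_derivative_sum has_vector_derivative_mult_right d)
    show "((\<lambda>t. f (Z t A)) has_vector_derivative g (Z t A)) (at t)"
      using has_vector_derivative_mult[OF 1 2]
      by (simp add: f_def g_def row_mix_deriv_def algebra_simps)
  qed
  moreover have "(\<lambda>t. Ex (\<lambda>A. f (Z t A))) = (\<lambda>t. Ex f)"
    unfolding Z_def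
    by (intro ext Ex_conj rot_unitary K) (unfold f_def, intro continuous_intros continuous_on_row_mix)
  moreover have "Z 0 A = A" for A by (simp add: Z_def rot_def hconj_one)
  ultimately have "((\<lambda>t. Ex f) has_vector_derivative Ex g) (at (0::real))" by simp
  moreover have "((\<lambda>t. Ex f) has_vector_derivative 0) (at (0::real))" by simp
  ultimately have "Ex g = 0" by (rule vector_derivative_unique_at)
  then show ?thesis by (simp only: g_def[abs_def])
qed

text \<open>The direction belongs to a single matrix unit, which generates no unitary rotation. It
  is reached because the derivative is complex linear in the direction and the anti-Hermitian
  matrices span all matrices over the complex numbers.\<close>

lemma Ex_row_mix_elem:
  assumes "i \<noteq> j"
  shows "Ex (\<lambda>A. row_mix_deriv S C b (\<lambda>p q. (if p = i then A $ j $ q else 0) - (if q = j then A $ p $ i else 0)) A) = 0"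
proof -
  define H where "H i j A p q = (if p = i then A $ j $ q else 0) - (if q = j then A $ p $ i else 0)"
    for i j p q and A :: "complex^'n^'n"
  define X where "X i j = Ex (\<lambda>A. row_mix_deriv S C b (H i j A) A)" for i j
  have c: "continuous_on UNIV (\<lambda>A. row_mix_deriv S C b (H i j A) A)" for i j
  proof (rule continuous_on_row_mix_deriv)
    fix p q
    show "continuous_on UNIV (\<lambda>A. H i j A p q)"
      unfolding H_def by (cases "p = i"; cases "q = j") (auto intro!: continuous_intros)
  qed simp
  have "z * X i j + - cnj z * X j i = 0" if "cmod z = 1" for z
  proof -
    have "(\<lambda>p q. (elem_rot i j z ** A - A ** elem_rot i j z) $ p $ q) =
        (\<lambda>p q. z * H i j A p q + - cnj z * H j i A p q)" for A
      using assms by (auto simp: fun_eq_iff elem_rot_left elem_rot_right H_def algebra_simps)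
    then have "0 = Ex (\<lambda>A. z * row_mix_deriv S C b (H i j A) A + - cnj z * row_mix_deriv S C b (H j i A) A)"
      using Ex_row_mix_rot[OF elem_rot_props[OF assms that], of S C b] by (simp only: row_mix_deriv_linear)
    also have "\<dots> = z * X i j + - cnj z * X j i"
      by (subst Ex_add) (auto intro!: continuous_intros c simp: X_def Ex_mult[of "- _", simplified] Ex_mult simp del: mult_minus_left)
    finally show ?thesis by simp
  qed
  \<comment> \<open>The two values of \<open>z\<close> show that the difference and the sum of
    \<open>X i j\<close> and \<open>X j i\<close> vanish.\<close>
  from this[of 1] this[of \<i>] have "X i j = 0" by simp
  then show ?thesis by (simp only: X_def H_def[abs_def])
qed

end

section \<open>Recursion for the expected principal minors\<close>

lemma continuous_on_pdet [continuous_intros]: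
  assumes "\<And>p m. continuous_on S (\<lambda>x. lam x p m)"
  shows "continuous_on S (\<lambda>x. pdet r k (lam x))"
proof -
  have "continuous_on S (\<lambda>x. if r p < k then lam x p (r q) else unit_row p q)" for p q
    using assms by (cases "r p < k") auto
  then show ?thesis unfolding pdet_def by (intro continuous_intros)
qed

lemma continuous_on_dvand [continuous_intros]:
  assumes "\<And>p. continuous_on S (\<lambda>x. a x p)" "\<And>p. continuous_on S (\<lambda>x. c x p)"
  shows "continuous_on S (\<lambda>x. dvand r k (a x) (c x))"
  unfolding dvand_def by (intro continuous_intros assms)

lemma continuous_on_minor [continuous_intros]:
  assumes "\<And>p q. continuous_on T (\<lambda>x. f x p q)"
  shows "continuous_on T (\<lambda>x. minor S (f x))"
proof -
  have "continuous_on T (\<lambda>x. if p \<in> S then f x p q else unit_row p q)" for p q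
    using assms by (cases "p \<in> S") auto
  then show ?thesis unfolding minor_def by (intro continuous_intros)
qed

lemma vand_cong:
  assumes "\<And>p. r p < k \<Longrightarrow> a p = a' p"
  shows "vand r k a = vand r k a'"
  unfolding vand_def pdet_def by (rule arg_cong[where f=mdet]) (auto simp: fun_eq_iff assms)

lemma dvand_cong:
  assumes "\<And>p. r p < k \<Longrightarrow> a p = a' p"
  shows "dvand r k a c = dvand r k a' c"
  unfolding dvand_def pdet_def by (rule arg_cong[where f=mdet]) (auto simp: fun_eq_iff assms)

lemma has_vector_derivative_exp_mult:
  "((\<lambda>t. exp (of_real t * c)) has_vector_derivative c * exp (of_real t * c :: complex)) (at t)"
proof (rule has_vector_derivative_exp)
  show "((\<lambda>t. of_real t * c) has_vector_derivative c) (at t)"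
    unfolding has_vector_derivative_def scaleR_conv_of_real[symmetric]
    by (intro bounded_linear_imp_has_derivative bounded_linear_scaleR_left)
qed

lemma wt_upd: "wt (b(j := b j + t)) A = wt b A * exp (of_real t * A $ j $ j)"
proof -
  have "(\<Sum>p\<in>UNIV. of_real ((b(j := b j + t)) p) * A $ p $ p) =
      (\<Sum>p\<in>UNIV. of_real (b p) * A $ p $ p + (if p = j then of_real t * A $ j $ j else 0))"
    by (rule sum.cong) (auto simp: algebra_simps)
  then show ?thesis by (simp add: wt_def sum.distrib exp_add)
qed

context conj_invariant
begin

text \<open>The row expansion of the larger minor needs the expectations of \<open>A $ j $ i\<close>
  times a cofactor. Rotation invariance of that cofactor supplies them: the derivative of the weight
  contributes exactly this product times \<open>b i - b j\<close>, and
  \<open>border_rotation\<close> gives the derivative of the cofactor as a difference of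
  minors.\<close>

lemma Ex_minor_insert:
  assumes "j \<notin> S" "inj_on b (insert j S)"
  shows "Ex (\<lambda>A. minor (insert j S) (\<lambda>p q. A $ p $ q) * wt b A) =
    Ex (\<lambda>A. A $ j $ j * minor S (\<lambda>p q. A $ p $ q) * wt b A) +
    (\<Sum>i\<in>S. (Ex (\<lambda>A. minor (insert j (S - {i})) (\<lambda>p q. A $ p $ q) * wt b A)
         - Ex (\<lambda>A. minor S (\<lambda>p q. A $ p $ q) * wt b A)) / of_real (b i - b j))"
proof -
  have cB: "continuous_on UNIV (\<lambda>A::complex^'n^'n. border_mat S i j (\<lambda>p q. A $ p $ q) p q)" for i p q
    unfolding border_mat_def by (cases "p \<in> S"; cases "p = j") (auto intro!: continuous_intros)
  have "Ex (\<lambda>A. A $ j $ i * mdet (border_mat S i j (\<lambda>p q. A $ p $ q)) * wt b A) =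
      (Ex (\<lambda>A. minor (insert j (S - {i})) (\<lambda>p q. A $ p $ q) * wt b A)
         - Ex (\<lambda>A. minor S (\<lambda>p q. A $ p $ q) * wt b A)) / of_real (b i - b j)" if i: "i \<in> S" for i
  proof -
    have ij: "i \<noteq> j" "b i \<noteq> b j" using assms i inj_onD[OF assms(2), of i j] by auto
    let ?C = "\<lambda>p. if p = j then unit_row i else unit_row p"
    let ?H = "\<lambda>A :: complex^'n^'n. \<lambda>p q. (if p = i then A $ j $ q else 0) - (if q = j then A $ p $ i else 0)"
    have rm: "row_mix S ?C A = border_mat S i j (\<lambda>p q. A $ p $ q)" for A
      by (auto simp: row_mix_def border_mat_def fun_eq_iff)
    have s: "(\<Sum>p\<in>UNIV. of_real (b p) * ?H A p p) = of_real (b i - b j) * A $ j $ i" for A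
    proof -
      have "(\<Sum>p\<in>UNIV. of_real (b p) * ?H A p p) = (\<Sum>p\<in>UNIV. (if p = i then of_real (b i) * A $ j $ i else 0)
          - (if p = j then of_real (b j) * A $ j $ i else 0))"
        by (rule sum.cong) auto
      then show ?thesis by (simp add: sum_subtractf algebra_simps)
    qed
    have "0 = Ex (\<lambda>A. row_mix_deriv S ?C b (?H A) A)"
      by (rule Ex_row_mix_elem[OF ij(1), symmetric])
    also have "(\<lambda>A. row_mix_deriv S ?C b (?H A) A) =
        (\<lambda>A. minor S (\<lambda>p q. A $ p $ q) * wt b A - minor (insert j (S - {i})) (\<lambda>p q. A $ p $ q) * wt b A
           + of_real (b i - b j) * (A $ j $ i * mdet (border_mat S i j (\<lambda>p q. A $ p $ q)) * wt b A))"
    proof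
      fix A :: "complex^'n^'n"
      show "row_mix_deriv S ?C b (?H A) A = minor S (\<lambda>p q. A $ p $ q) * wt b A
          - minor (insert j (S - {i})) (\<lambda>p q. A $ p $ q) * wt b A
          + of_real (b i - b j) * (A $ j $ i * mdet (border_mat S i j (\<lambda>p q. A $ p $ q)) * wt b A)"
        unfolding row_mix_deriv_def rm s border_rotation[OF i assms(1), of "\<lambda>p q. A $ p $ q"]
        by (simp only: ring_distribs mult_ac)
    qed
    finally have "0 = Ex (\<lambda>A. minor S (\<lambda>p q. A $ p $ q) * wt b A)
        - Ex (\<lambda>A. minor (insert j (S - {i})) (\<lambda>p q. A $ p $ q) * wt b A)
        + of_real (b i - b j) * Ex (\<lambda>A. A $ j $ i * mdet (border_mat S i j (\<lambda>p q. A $ p $ q)) * wt b A)"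
      by (subst (asm) Ex_add, (intro continuous_intros cB)+, subst (asm) Ex_diff)
         (auto intro!: continuous_intros cB simp: Ex_mult)
    then show ?thesis using ij(2) by (simp add: field_simps)
  qed
  then show ?thesis
    unfolding minor_insert[OF assms(1)] distrib_right sum_distrib_right
    by (subst Ex_add, (intro continuous_intros cB)+, subst Ex_sum) (auto intro!: continuous_intros cB)
qed

text \<open>Differentiating the weight in \<open>b j\<close> brings down the factor
  \<open>A $ j $ j\<close>, while \<open>f\<close> stays fixed.\<close>

lemma Ex_wt_derivative:
  assumes f: "continuous_on UNIV f" and 0: "\<And>t. Ex (\<lambda>A. f A * wt (b(j := b j + t)) A) = 0"
  shows "Ex (\<lambda>A. A $ j $ j * f A * wt b A) = 0"
proof -
  have "((\<lambda>t. Ex (\<lambda>A. f A * wt b A * exp (of_real t * A $ j $ j))) has_vector_derivative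
      Ex (\<lambda>A. f A * wt b A * (A $ j $ j * exp (of_real 0 * A $ j $ j)))) (at 0)"
    by (rule Ex_has_vector_derivative)
       (auto intro!: continuous_intros f continuous_on_compose2[OF f] has_vector_derivative_mult_right
         has_vector_derivative_exp_mult)
  moreover have "Ex (\<lambda>A. f A * wt b A * exp (of_real t * A $ j $ j)) = 0" for t
    using 0[of t] by (simp add: wt_upd mult.assoc)
  ultimately have "((\<lambda>t. 0) has_vector_derivative Ex (\<lambda>A. f A * wt b A * A $ j $ j)) (at (0::real))"
    by simp
  then have "Ex (\<lambda>A. f A * wt b A * A $ j $ j) = 0"
    by (rule vector_derivative_unique_at[OF _ has_vector_derivative_const])
  then show ?thesis by (simp add: mult_ac)
qed

text \<open>The right-hand side is the mixed derivative, over the coordinates in the index set, of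
  their Vandermonde determinant times \<open>Ex (wt b)\<close>. Adding one index changes the two
  sides by the same recursion, \<open>Ex_minor_insert\<close> on the left and
  \<open>dvand_Suc\<close> on the right. Since \<open>pdet\<close> always uses the \<open>k\<close>
  smallest ranks, the bijection \<open>h\<close> is what lets the induction reach other index sets
  of the same size.\<close>

lemma vand_Ex_minor:
  fixes r :: "'n \<Rightarrow> nat"
  assumes r: "bij_betw r UNIV {..<CARD('n)}" and "k \<le> CARD('n)" "bij h" "inj_on b (h ` {p. r p < k})"
  shows "vand r k (\<lambda>p. of_real (b (h p))) * Ex (\<lambda>A. minor (h ` {p. r p < k}) (\<lambda>p q. A $ p $ q) * wt b A) =
    Ex (\<lambda>A. dvand r k (\<lambda>p. of_real (b (h p))) (\<lambda>p. A $ h p $ h p) * wt b A)"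
  using assms(2-)
proof (induction k arbitrary: b h)
  case 0
  show ?case by (simp add: vand_def dvand_def pdet_0 minor_def mdet_def unit_row_def flip: mat_def)
next
  case (Suc k)
  have rinj: "r p = r q \<longleftrightarrow> p = q" for p q
    using r by (auto simp: bij_betw_def inj_on_def)
  have "k \<in> range r" using r Suc.prems(1) by (auto simp: bij_betw_def)
  then obtain j0 where j0: "r j0 = k" by auto
  define j where "j = h j0"
  define S where "S = h ` {p. r p < k}"
  have hinj: "h p = h q \<longleftrightarrow> p = q" for p q
    using Suc.prems(2) by (auto simp: bij_def inj_def)
  have set: "{p. r p < Suc k} = insert j0 {p. r p < k}"
    using j0 rinj by (auto simp: less_Suc_eq)
  have jS: "j \<notin> S" using j0 by (auto simp: j_def S_def hinj)
  have S': "h ` {p. r p < Suc k} = insert j S" by (simp add: set S_def j_def)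
  have inj: "inj_on b (insert j S)" using Suc.prems(3) by (simp add: S')
  define a :: "'n \<Rightarrow> complex" where "a p = of_real (b (h p))" for p
  define m where "m T = Ex (\<lambda>A. minor T (\<lambda>p q. A $ p $ q) * wt b A)" for T
  define V where "V = vand r k a"
  define D where "D A = dvand r k a (\<lambda>p. A $ h p $ h p)" for A :: "complex^'n^'n"
  define \<tau> where "\<tau> p = Transposition.transpose p j0" for p
  define D' where "D' p A = dvand r k (a \<circ> \<tau> p) ((\<lambda>p. A $ h p $ h p) \<circ> \<tau> p)" for p and A :: "complex^'n^'n"
  define Q where "Q p = (\<Prod>q\<in>{q. r q < k} - {p}. a j0 - a q)" for p
  define q where "q p = (\<Prod>q\<in>{q. r q < k} - {p}. a p - a q)" for p
  define P where "P = (\<Prod>p | r p < k. a j0 - a p)"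
  have PQ: "P = (a j0 - a p) * Q p" if "r p < k" for p
    unfolding P_def Q_def using that by (subst prod.remove[of _ p]) auto
  have a_ne: "a j0 - a p \<noteq> 0" if "r p < k" for p
    using inj_onD[OF inj, of j "h p"] that jS by (auto simp: a_def j_def S_def)
  have c: "continuous_on UNIV (\<lambda>A. D A * wt b A)" "continuous_on UNIV (\<lambda>A. A $ j $ j * D A * wt b A)"
     "continuous_on UNIV (\<lambda>A. D' p A * wt b A)" for p
    unfolding D_def D'_def o_def by (intro continuous_intros)+
  have IH: "V * m S = Ex (\<lambda>A. D A * wt b A)"
    unfolding V_def m_def D_def a_def S_def
    using Suc inj by (intro Suc.IH) (auto simp: S_def)
  \<comment> \<open>The induction hypothesis is differentiated in \<open>b j\<close>. As
    \<open>j\<close> lies outside \<open>S\<close>, neither \<open>V\<close> nor \<open>D\<close>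
    depends on this coordinate.\<close>
  have IHd: "V * Ex (\<lambda>A. A $ j $ j * minor S (\<lambda>p q. A $ p $ q) * wt b A) = Ex (\<lambda>A. A $ j $ j * D A * wt b A)"
  proof -
    let ?f = "\<lambda>A. V * minor S (\<lambda>p q. A $ p $ q) - D A"
    have c0: "continuous_on UNIV ?f" unfolding D_def by (intro continuous_intros)
    have "Ex (\<lambda>A. ?f A * wt (b(j := b j + t)) A) = 0" for t
    proof -
      let ?b = "b(j := b j + t)"
      have b: "?b (h p) = b (h p)" if "r p < k" for p
        using that jS by (auto simp: S_def)
      have "inj_on ?b S" using inj jS by (auto simp: inj_on_def)
      then have "vand r k (\<lambda>p. of_real (?b (h p))) * Ex (\<lambda>A. minor S (\<lambda>p q. A $ p $ q) * wt ?b A) =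
         Ex (\<lambda>A. dvand r k (\<lambda>p. of_real (?b (h p))) (\<lambda>p. A $ h p $ h p) * wt ?b A)"
        unfolding S_def by (rule Suc.IH[rotated 2]) (use Suc.prems in simp_all)
      moreover have "vand r k (\<lambda>p. of_real (?b (h p))) = V"
        unfolding V_def a_def by (rule vand_cong) (simp only: b)
      moreover have "dvand r k (\<lambda>p. of_real (?b (h p))) (\<lambda>p. A $ h p $ h p) = D A" for A
        unfolding D_def a_def by (rule dvand_cong) (simp only: b)
      ultimately have "V * Ex (\<lambda>A. minor S (\<lambda>p q. A $ p $ q) * wt ?b A) = Ex (\<lambda>A. D A * wt ?b A)"
        by simp
      moreover have "Ex (\<lambda>A. ?f A * wt ?b A) = V * Ex (\<lambda>A. minor S (\<lambda>p q. A $ p $ q) * wt ?b A) - Ex (\<lambda>A. D A * wt ?b A)"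
        unfolding left_diff_distrib mult.assoc D_def
        by (subst Ex_diff) (auto intro!: continuous_intros simp: Ex_mult)
      ultimately show ?thesis by simp
    qed
    from Ex_wt_derivative[OF c0 this]
    have "0 = Ex (\<lambda>A. V * (A $ j $ j * minor S (\<lambda>p q. A $ p $ q) * wt b A) - A $ j $ j * D A * wt b A)"
      by (simp add: algebra_simps)
    also have "\<dots> = V * Ex (\<lambda>A. A $ j $ j * minor S (\<lambda>p q. A $ p $ q) * wt b A) - Ex (\<lambda>A. A $ j $ j * D A * wt b A)"
      by (subst Ex_diff) (auto intro!: continuous_intros c simp: Ex_mult)
    finally show ?thesis by simp
  qed
  \<comment> \<open>The induction hypothesis is used with \<open>h\<close> composed with a
    transposition, which exchanges \<open>h p\<close> for \<open>j\<close> in the index set;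
    \<open>vand_transpose\<close> converts the permuted Vandermonde factor back to
    \<open>V\<close>.\<close>
  have IH': "q p * Ex (\<lambda>A. D' p A * wt b A) = Q p * V * m (insert j (S - {h p}))" if p: "r p < k" for p
  proof -
    have pj: "p \<noteq> j0" using p j0 by auto
    have "(h \<circ> \<tau> p) ` {q. r q < k} = insert j (S - {h p})"
    proof -
      have "\<tau> p ` {q. r q < k} = insert j0 ({q. r q < k} - {p})"
      proof -
        have "\<tau> p ` {q. r q < k} = \<tau> p ` insert p ({q. r q < k} - {p})"
          using p by (simp add: insert_absorb)
        also have "\<dots> = insert j0 (\<tau> p ` ({q. r q < k} - {p}))"
          unfolding image_insert by (simp only: \<tau>_def transpose_apply_first)
        also have "\<tau> p ` ({q. r q < k} - {p}) = (\<lambda>x. x) ` ({q. r q < k} - {p})"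
          using j0 by (intro image_cong) (auto simp: \<tau>_def Transposition.transpose_def)
        finally show ?thesis by simp
      qed
      then show ?thesis
        unfolding image_comp[symmetric] S_def j_def by (auto simp: hinj)
    qed
    moreover have "bij (h \<circ> \<tau> p)" using Suc.prems(2) by (simp add: \<tau>_def bij_comp)
    moreover have "inj_on b (insert j (S - {h p}))" using inj by (rule inj_on_subset) auto
    ultimately have "vand r k (a \<circ> \<tau> p) * m (insert j (S - {h p})) = Ex (\<lambda>A. D' p A * wt b A)"
      using Suc.IH[of "h \<circ> \<tau> p" b] Suc.prems(1) by (simp add: m_def D'_def a_def o_def)
    moreover have "q p * vand r k (a \<circ> \<tau> p) = Q p * V"
      unfolding q_def Q_def V_def \<tau>_def by (rule vand_transpose[OF r j0 p])
    ultimately show ?thesis by (metis mult.assoc)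
  qed
  have "Ex (\<lambda>A. dvand r (Suc k) a (\<lambda>p. A $ h p $ h p) * wt b A) =
     Ex (\<lambda>A. P * (A $ j $ j * D A * wt b A) + (\<Sum>p | r p < k. Q p) * (D A * wt b A)
        - (\<Sum>p | r p < k. q p * (D' p A * wt b A)))"
    unfolding dvand_Suc[OF r j0]
    by (simp add: P_def Q_def q_def D_def D'_def \<tau>_def j_def algebra_simps sum_distrib_left sum_distrib_right)
  also have "\<dots> = P * Ex (\<lambda>A. A $ j $ j * D A * wt b A) + (\<Sum>p | r p < k. Q p) * Ex (\<lambda>A. D A * wt b A)
        - (\<Sum>p | r p < k. q p * Ex (\<lambda>A. D' p A * wt b A))"
    by (subst Ex_diff, (intro continuous_intros c)+, subst Ex_add, (intro continuous_intros c)+, subst Ex_sum)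
       (auto intro!: continuous_intros c simp: Ex_mult)
  also have "\<dots> = V * (P * Ex (\<lambda>A. A $ j $ j * minor S (\<lambda>p q. A $ p $ q) * wt b A)
       + (\<Sum>p | r p < k. Q p * (m S - m (insert j (S - {h p})))))"
  proof -
    have "(\<Sum>p | r p < k. q p * Ex (\<lambda>A. D' p A * wt b A)) = (\<Sum>p | r p < k. Q p * V * m (insert j (S - {h p})))"
      by (rule sum.cong) (auto simp: IH')
    then show ?thesis
      unfolding IHd[symmetric] IH[symmetric]
      by (simp add: sum_distrib_left sum_distrib_right sum_subtractf algebra_simps)
  qed
  also have "\<dots> = V * (P * m (insert j S))"
  proof -
    have "m (insert j S) = Ex (\<lambda>A. A $ j $ j * minor S (\<lambda>p q. A $ p $ q) * wt b A)
        + (\<Sum>i\<in>S. (m (insert j (S - {i})) - m S) / of_real (b i - b j))"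
      unfolding m_def by (rule Ex_minor_insert[OF jS inj])
    moreover have "(\<Sum>i\<in>S. (m (insert j (S - {i})) - m S) / of_real (b i - b j)) =
        (\<Sum>p | r p < k. (m (insert j (S - {h p})) - m S) / (a p - a j0))"
      unfolding S_def by (subst sum.reindex) (auto simp: inj_on_def hinj a_def j_def)
    moreover have "(\<Sum>p | r p < k. P * ((m (insert j (S - {h p})) - m S) / (a p - a j0))) =
        (\<Sum>p | r p < k. Q p * (m S - m (insert j (S - {h p}))))"
    proof (rule sum.cong[OF refl])
      fix p assume "p \<in> {p. r p < k}"
      then have p: "r p < k" by simp
      have "a p - a j0 \<noteq> 0" using a_ne[OF p] by auto
      then show "P * ((m (insert j (S - {h p})) - m S) / (a p - a j0)) = Q p * (m S - m (insert j (S - {h p})))"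
        unfolding PQ[OF p] by (simp add: field_simps)
    qed
    ultimately show ?thesis by (simp only: distrib_left sum_distrib_left)
  qed
  finally show ?case
    unfolding S' a_def[symmetric] m_def[symmetric] vand_Suc[OF r j0]
    by (simp add: P_def V_def)
qed

end

subsection \<open>Difference equations and the Harish-Chandra--Itzykson--Zuber formula\<close>

definition exp_row :: "('n \<Rightarrow> nat) \<Rightarrow> complex \<Rightarrow> real \<Rightarrow> 'n \<Rightarrow> complex" where
  "exp_row r y t q = of_real t ^ r q * exp (of_real t * y)"

definition exp_row' :: "('n \<Rightarrow> nat) \<Rightarrow> complex \<Rightarrow> real \<Rightarrow> 'n \<Rightarrow> complex" where
  "exp_row' r y t q = (y * of_real t ^ r q + of_nat (r q) * of_real t ^ (r q - 1)) * exp (of_real t * y)"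

lemma has_vector_derivative_exp_row:
  "((\<lambda>t. exp_row r y t q) has_vector_derivative exp_row' r y t q) (at t)"
proof -
  have "((\<lambda>t. of_real (t ^ r q) :: complex) has_vector_derivative of_real (real (r q) * t ^ (r q - 1))) (at t)"
    by (intro has_vector_derivative_of_real) (auto intro!: derivative_eq_intros)
  from has_vector_derivative_mult[OF this has_vector_derivative_exp_mult[of y t]]
  show ?thesis by (simp add: exp_row_def exp_row'_def algebra_simps)
qed

lemma continuous_on_exp_row:
  fixes f :: "'a::topological_space \<Rightarrow> complex"
  assumes "continuous_on S f" "continuous_on S g"
  shows "continuous_on S (\<lambda>x. exp_row r (f x) (g x) q)" "continuous_on S (\<lambda>x. exp_row' r (f x) (g x) q)"
  unfolding exp_row_def exp_row'_def by (intro continuous_intros assms)+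

lemma mdet_scale_rows: "mdet (\<lambda>p q. x p * f p q) = (\<Prod>p\<in>UNIV. x p) * mdet f"
  unfolding mdet_perm by (simp add: prod.distrib sum_distrib_left mult_ac)

lemma mdet_row_diff: "mdet (f(p := \<lambda>q. g q - h q)) = mdet (f(p := g)) - mdet (f(p := h))"
  using mdet_row_linear[of f p 1 g "-1" h] by simp

lemma mdet_diff_expand:
  "mdet (\<lambda>p q. v p q - u p q) = (\<Sum>T\<in>UNIV. (- 1) ^ card T * mdet (\<lambda>p. if p \<in> T then u p else v p))"
proof -
  have "(\<Prod>p\<in>UNIV. v p (\<sigma> p) - u p (\<sigma> p)) =
      (\<Sum>T\<in>UNIV. (- 1) ^ card T * (\<Prod>p\<in>UNIV. (if p \<in> T then u p else v p) (\<sigma> p)))" for \<sigma>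
  proof -
    have "(\<Prod>p\<in>UNIV. v p (\<sigma> p) - u p (\<sigma> p)) = (\<Prod>p\<in>UNIV. - u p (\<sigma> p) + v p (\<sigma> p))"
      by (simp add: algebra_simps)
    also have "\<dots> = (\<Sum>T\<in>Pow UNIV. (\<Prod>p\<in>T. - u p (\<sigma> p)) * (\<Prod>p\<in>UNIV - T. v p (\<sigma> p)))"
      by (rule prod_add) simp
    also have "\<dots> = (\<Sum>T\<in>UNIV. (- 1) ^ card T * (\<Prod>p\<in>UNIV. (if p \<in> T then u p else v p) (\<sigma> p)))"
    proof (rule sum.cong)
      fix T :: "'a set"
      have "(\<Prod>p\<in>UNIV. (if p \<in> T then u p else v p) (\<sigma> p)) =
          (\<Prod>p\<in>T. (if p \<in> T then u p else v p) (\<sigma> p)) * (\<Prod>p\<in>UNIV - T. (if p \<in> T then u p else v p) (\<sigma> p))"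
        by (subst prod.union_disjoint[symmetric]) auto
      also have "\<dots> = (\<Prod>p\<in>T. u p (\<sigma> p)) * (\<Prod>p\<in>UNIV - T. v p (\<sigma> p))"
        by (intro arg_cong2[where f="(*)"] prod.cong) auto
      finally show "(\<Prod>p\<in>T. - u p (\<sigma> p)) * (\<Prod>p\<in>UNIV - T. v p (\<sigma> p)) =
          (- 1) ^ card T * (\<Prod>p\<in>UNIV. (if p \<in> T then u p else v p) (\<sigma> p))"
        by (simp add: prod_uminus)
    qed simp
    finally show ?thesis .
  qed
  then show ?thesis
    unfolding mdet_perm sum_distrib_left by (subst sum.swap) (simp add: sum_distrib_left mult_ac)
qed

text \<open>The weight is a product over the diagonal entries, so its factors can be absorbed into
  the rows. Afterwards each coordinate of \<open>b\<close> occurs in one row only.\<close>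

lemma mdet_exp_row:
  fixes r :: "'n::finite \<Rightarrow> nat"
  assumes r: "bij_betw r UNIV {..<CARD('n)}"
  shows "mdet (\<lambda>p. exp_row r (A $ p $ p) (b p)) = vand r CARD('n) (\<lambda>p. of_real (b p)) * wt b A"
    and "mdet (\<lambda>p. exp_row' r (A $ p $ p) (b p)) =
      dvand r CARD('n) (\<lambda>p. of_real (b p)) (\<lambda>p. A $ p $ p) * wt b A"
proof -
  have r': "r p < CARD('n)" for p using r by (auto simp: bij_betw_def)
  show "mdet (\<lambda>p. exp_row r (A $ p $ p) (b p)) = vand r CARD('n) (\<lambda>p. of_real (b p)) * wt b A"
    unfolding wt_def exp_sum[OF finite] vand_def pdet_def mult.commute[of "mdet _"] mdet_scale_rows[symmetric]
    by (rule arg_cong[where f=mdet]) (auto simp: fun_eq_iff exp_row_def r')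
  show "mdet (\<lambda>p. exp_row' r (A $ p $ p) (b p)) =
      dvand r CARD('n) (\<lambda>p. of_real (b p)) (\<lambda>p. A $ p $ p) * wt b A"
    unfolding wt_def exp_sum[OF finite] dvand_def pdet_def mult.commute[of "mdet _"] mdet_scale_rows[symmetric]
    by (rule arg_cong[where f=mdet]) (auto simp: fun_eq_iff exp_row'_def r')
qed

context conj_invariant
begin

lemma Ex_tendsto_param:
  fixes f :: "'p::heine_borel \<Rightarrow> complex^'n^'n \<Rightarrow> complex"
  assumes f: "continuous_on UNIV (\<lambda>x. f (fst x) (snd x))" and X: "X \<longlonglongrightarrow> t"
  shows "(\<lambda>n. Ex (f (X n))) \<longlonglongrightarrow> Ex (f t)"
proof -
  obtain C where C: "compact C" "\<And>w. w \<in> space M \<Longrightarrow> Y w \<in> C"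
    using Y_compact by blast
  have "bounded (range X)" using X by (rule convergent_imp_bounded)
  then have K: "compact (closure (range X))" by (simp add: compact_closure)
  have "compact ((\<lambda>x. f (fst x) (snd x)) ` (closure (range X) \<times> C))"
    by (intro compact_continuous_image compact_Times C K continuous_on_subset[OF f]) auto
  then obtain B where B: "\<And>x. x \<in> closure (range X) \<times> C \<Longrightarrow> norm (f (fst x) (snd x)) \<le> B"
    by (force dest!: compact_imp_bounded simp: bounded_iff)
  have c: "continuous_on UNIV (f u)" for u
    using continuous_on_compose2[OF f, of UNIV "\<lambda>A. (u, A)"] by (simp add: continuous_on_Pair)
  show ?thesis
  proof (rule Ex_tendsto[where B=B])
    fix w n assume w: "w \<in> space M"
    have "continuous_on UNIV (\<lambda>u. f u (Y w))"
      using continuous_on_compose2[OF f, of UNIV "\<lambda>u. (u, Y w)"] by (simp add: continuous_on_Pair)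
    then show "(\<lambda>n. f (X n) (Y w)) \<longlonglongrightarrow> f t (Y w)"
      using X by (auto simp: continuous_on_eq_continuous_at intro: isCont_tendsto_compose)
    have "(X n, Y w) \<in> closure (range X) \<times> C"
      using C(2)[OF w] closure_subset[of "range X"] by auto
    from B[OF this] show "norm (f (X n) (Y w)) \<le> B" by simp
  qed (rule c)+
qed

text \<open>For \<open>vand_Ex_minor\<close> with the full index set, the minor is the determinant
  of \<open>Y\<close>, which is zero. That argument needs distinct coordinates of \<open>b\<close>;
  continuity covers the rest.\<close>

lemma Ex_exp_row'_eq_0:
  fixes r :: "'n \<Rightarrow> nat"
  assumes r: "bij_betw r UNIV {..<CARD('n)}" and det0: "\<And>w. w \<in> space M \<Longrightarrow> det (Y w) = 0"
  shows "Ex (\<lambda>A. mdet (\<lambda>p. exp_row' r (A $ p $ p) (b p))) = 0"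
proof -
  have inj: "Ex (\<lambda>A. mdet (\<lambda>p. exp_row' r (A $ p $ p) (b p))) = 0" if "inj b" for b
  proof -
    have "{p. r p < CARD('n)} = UNIV" using r by (auto simp: bij_betw_def)
    with that vand_Ex_minor[OF r order_refl bij_id, of b]
    have "vand r CARD('n) (\<lambda>p. of_real (b p)) * Ex (\<lambda>A. minor UNIV (\<lambda>p q. A $ p $ q) * wt b A) =
        Ex (\<lambda>A. mdet (\<lambda>p. exp_row' r (A $ p $ p) (b p)))"
      by (simp add: mdet_exp_row(2)[OF r])
    moreover have "Ex (\<lambda>A. minor UNIV (\<lambda>p q. A $ p $ q) * wt b A) = 0"
    proof -
      have "minor UNIV (\<lambda>p q. A $ p $ q) = det A" for A :: "complex^'n^'n"
        by (simp add: minor_def mdet_def)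
      then show ?thesis
        unfolding Ex_def by (intro integral_eq_zero_AE AE_I2) (simp add: det0)
    qed
    ultimately show ?thesis by simp
  qed
  \<comment> \<open>Adding \<open>X n\<close> times the rank separates equal coordinates of
    \<open>b\<close>, and for large \<open>n\<close> it does not merge distinct ones.\<close>
  define X where "X n = inverse (real (Suc n))" for n
  have X: "X \<longlonglongrightarrow> 0" unfolding X_def by (rule LIMSEQ_inverse_real_of_nat)
  have rinj: "r p = r q \<longleftrightarrow> p = q" for p q
    using r by (auto simp: bij_betw_def inj_on_def)
  have "\<forall>\<^sub>F n in sequentially. b p + X n * r p \<noteq> b q + X n * r q" if "p \<noteq> q" for p q
  proof (cases "b p = b q")
    case True
    then show ?thesis using that by (simp add: X_def rinj)
  next
    case False
    have "(\<lambda>n. (b p + X n * r p) - (b q + X n * r q)) \<longlonglongrightarrow> (b p + 0 * real (r p)) - (b q + 0 * real (r q))"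
      by (intro tendsto_intros X)
    then have "(\<lambda>n. (b p + X n * r p) - (b q + X n * r q)) \<longlonglongrightarrow> b p - b q" by simp
    from tendsto_imp_eventually_ne[OF this, of 0] False show ?thesis by auto
  qed
  then have "\<forall>\<^sub>F n in sequentially. \<forall>x\<in>{(p, q). p \<noteq> q}. b (fst x) + X n * r (fst x) \<noteq> b (snd x) + X n * r (snd x)"
    by (intro eventually_ball_finite) auto
  then have "\<forall>\<^sub>F n in sequentially. Ex (\<lambda>A. mdet (\<lambda>p. exp_row' r (A $ p $ p) (b p + X n * r p))) = 0"
    by eventually_elim (intro inj, auto simp: inj_def)
  then have "(\<lambda>n. Ex (\<lambda>A. mdet (\<lambda>p. exp_row' r (A $ p $ p) (b p + X n * r p)))) \<longlonglongrightarrow> 0"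
    by (rule tendsto_eventually)
  moreover have "(\<lambda>n. Ex (\<lambda>A. mdet (\<lambda>p. exp_row' r (A $ p $ p) (b p + X n * r p)))) \<longlonglongrightarrow>
      Ex (\<lambda>A. mdet (\<lambda>p. exp_row' r (A $ p $ p) (b p + 0 * real (r p))))"
    by (rule Ex_tendsto_param[where f="\<lambda>x A. mdet (\<lambda>p. exp_row' r (A $ p $ p) (b p + x * real (r p)))", OF _ X])
       (intro continuous_intros continuous_on_exp_row)
  ultimately have "Ex (\<lambda>A. mdet (\<lambda>p. exp_row' r (A $ p $ p) (b p + 0 * real (r p)))) = 0"
    by (rule LIMSEQ_unique[symmetric])
  then show ?thesis by simp
qed

text \<open>This is the integral of \<open>Ex_exp_row'_eq_0\<close> over a cube of side
  \<open>h\<close>, done one row at a time: once some rows are differences, the expectation as a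
  function of the argument of the next row has derivative zero by induction, so it takes equal
  values at \<open>b i\<close> and \<open>b i + h\<close>.\<close>

lemma Ex_exp_row_difference:
  fixes r :: "'n \<Rightarrow> nat"
  assumes r: "bij_betw r UNIV {..<CARD('n)}" and det0: "\<And>w. w \<in> space M \<Longrightarrow> det (Y w) = 0"
  shows "Ex (\<lambda>A. mdet (\<lambda>p q. exp_row r (A $ p $ p) (b p) q - exp_row r (A $ p $ p) (b p + h) q)) = 0"
proof -
  define G where "G T b A = (\<lambda>p q. if p \<in> T then exp_row r (A $ p $ p) (b p) q - exp_row r (A $ p $ p) (b p + h) q
      else exp_row' r (A $ p $ p) (b p) q)" for T b and A :: "complex^'n^'n"
  have cG: "continuous_on UNIV (\<lambda>A. G T b A p q)" for T b p q
    unfolding G_def by (cases "p \<in> T") (auto intro!: continuous_intros continuous_on_exp_row)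
  have "Ex (\<lambda>A. mdet (G T b A)) = 0" if "finite T" for T
    using that
  proof (induction T arbitrary: b)
    case empty
    show ?case using Ex_exp_row'_eq_0[OF r det0, of b] by (simp add: G_def)
  next
    case (insert i T)
    define F where "F t A = mdet ((G T b A)(i := exp_row r (A $ i $ i) t))" for t and A :: "complex^'n^'n"
    define F' where "F' t A = mdet ((G T b A)(i := exp_row' r (A $ i $ i) t))" for t and A :: "complex^'n^'n"
    have cF: "continuous_on UNIV (F t)" for t
      unfolding F_def by (intro continuous_intros continuous_on_fun_upd2 cG continuous_on_exp_row)
    have "((\<lambda>t. Ex (F t)) has_vector_derivative Ex (F' t)) (at t)" for t
    proof (rule Ex_has_vector_derivative[OF cF])
      show "continuous_on UNIV (\<lambda>x. F' (fst x) (snd x))"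
        unfolding F'_def
        by (intro continuous_intros continuous_on_fun_upd2 continuous_on_compose2[OF cG] continuous_on_exp_row) auto
      fix t and A :: "complex^'n^'n"
      have exp: "mdet ((G T b A)(i := u)) = (\<Sum>q\<in>UNIV. u q * mdet ((G T b A)(i := unit_row q)))" for u
        using mdet_row_sum[of UNIV "G T b A" i u unit_row] by (simp add: sum_unit_row)
      show "((\<lambda>t. F t A) has_vector_derivative F' t A) (at t)"
        unfolding F_def F'_def exp[of "exp_row r (A $ i $ i) _"] exp[of "exp_row' r (A $ i $ i) _"]
        by (intro has_vector_derivative_sum has_vector_derivative_mult_left has_vector_derivative_exp_row)
    qed
    moreover have "F' t = (\<lambda>A. mdet (G T (b(i := t)) A))" for t
      unfolding F'_def using insert.hyps
      by (intro ext arg_cong[where f=mdet]) (auto simp: G_def fun_eq_iff)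
    ultimately have "((\<lambda>t. Ex (F t)) has_vector_derivative 0) (at t within UNIV)" for t
      using insert.IH by simp
    from has_vector_derivative_zero_constant[OF convex_UNIV this]
    have "Ex (F (b i)) = Ex (F (b i + h))" by (metis UNIV_I)
    moreover have "mdet (G (insert i T) b A) = F (b i) A - F (b i + h) A" for A
      unfolding F_def mdet_row_diff[symmetric]
      by (rule arg_cong[where f=mdet]) (auto simp: G_def fun_eq_iff)
    ultimately show ?case by (simp add: Ex_diff[OF cF cF])
  qed
  from this[of UNIV] show ?thesis by (simp add: G_def)
qed

text \<open>Subtracting an eigenvalue makes the matrix singular, as
  \<open>Ex_exp_row_difference\<close> requires, without leaving the class of conjugation invariant
  laws.\<close>

lemma conj_invariant_shift: "conj_invariant M (\<lambda>w. Y w - z *\<^sub>R mat 1)"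
proof
  show "(\<lambda>w. Y w - z *\<^sub>R mat 1) \<in> borel_measurable M" by measurable
  obtain R where R: "\<forall>w\<in>space M. norm (Y w) \<le> R" using Y_bounded ..
  have "norm (Y w - z *\<^sub>R mat 1) \<le> R + norm (z *\<^sub>R mat 1 :: complex^'n^'n)" if "w \<in> space M" for w
    using norm_triangle_ineq4[of "Y w" "z *\<^sub>R mat 1"] R that by force
  then show "\<exists>R. \<forall>w\<in>space M. norm (Y w - z *\<^sub>R mat 1) \<le> R" by blast
  fix W :: "complex^'n^'n" and f :: "complex^'n^'n \<Rightarrow> complex"
  assume W: "W \<in> unitary_group" and f: "continuous_on UNIV f"
  have *: "W ** (A - z *\<^sub>R mat 1) ** W\<^sup>\<dagger> = W ** A ** W\<^sup>\<dagger> - z *\<^sub>R mat 1" for A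
    using W by (simp add: unitary_group_def diff_conv_add_uminus matrix_add_ldistrib matrix_add_rdistrib
        matrix_minus_left matrix_minus_right matrix_scaleR_left matrix_scaleR_right del: add_uminus_conv_diff)
  have "continuous_on UNIV (\<lambda>A. f (A - z *\<^sub>R mat 1))"
    by (intro continuous_on_compose2[OF f] continuous_intros) auto
  from Y_conj[OF W this]
  show "(LINT w|M. f (W ** (Y w - z *\<^sub>R mat 1) ** W\<^sup>\<dagger>)) = (LINT w|M. f (Y w - z *\<^sub>R mat 1))"
    by (simp add: *)
qed

end

text \<open>Evaluation on the box \<open>{0..<N}\<^sup>N\<close> suffices by the recurrence, and antisymmetry leaves a single value there.\<close>

lemma antisym_recurrence_zero:
  fixes d :: "('n::finite \<Rightarrow> nat) \<Rightarrow> complex"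
  assumes r: "bij_betw r UNIV {..<CARD('n)}"
    and antisym: "\<And>\<kappa> \<pi>. \<pi> permutes UNIV \<Longrightarrow> d (\<kappa> \<circ> \<pi>) = of_int (sign \<pi>) * d \<kappa>"
    and rec: "\<And>\<kappa> i. (\<Sum>m\<le>CARD('n). c m * d (\<kappa>(i := \<kappa> i + m))) = 0"
    and c: "c CARD('n) \<noteq> 0" and dr: "d r = 0"
  shows "d \<kappa> = 0"
proof (induction "\<Sum>i\<in>UNIV. \<kappa> i" arbitrary: \<kappa> rule: less_induct)
  case less
  show ?case
  proof (cases "\<exists>i. \<kappa> i \<ge> CARD('n)")
    case True
    then obtain i where i: "\<kappa> i \<ge> CARD('n)" ..
    \<comment> \<open>The recurrence is started \<open>CARD('n)\<close> steps lower in coordinate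
      \<open>i\<close>: its top term is at \<open>\<kappa>\<close>, and every other term has a
      smaller coordinate sum.\<close>
    let ?k = "\<lambda>m. (\<kappa>(i := \<kappa> i - CARD('n)))(i := \<kappa> i - CARD('n) + m)"
    have "d (?k m) = 0" if "m < CARD('n)" for m
    proof (rule less.hyps, rule sum_strict_mono_ex1)
      show "\<exists>a\<in>UNIV. ?k m a < \<kappa> a" using that i by (intro bexI[of _ i]) auto
    qed (use that i in auto)
    moreover have "?k CARD('n) = \<kappa>" using i by auto
    ultimately have "c CARD('n) * d \<kappa> = (\<Sum>m\<le>CARD('n). c m * d (?k m))"
      by (subst lessThan_Suc_atMost[symmetric]) simp
    also have "\<dots> = 0" using rec[of "\<kappa>(i := \<kappa> i - CARD('n))" i] by simp
    finally show ?thesis using c by simp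
  next
    case False
    then have lt: "\<kappa> i < CARD('n)" for i by (auto simp: not_le)
    show ?thesis
    proof (cases "inj \<kappa>")
      case True
      \<comment> \<open>An injective point of the box is a rearrangement of \<open>r\<close>, so
        antisymmetry reduces it to the known zero at \<open>r\<close>.\<close>
      define \<pi> where "\<pi> i = inv_into UNIV r (\<kappa> i)" for i
      have "\<kappa> i \<in> range r" for i using lt[of i] r by (auto simp: bij_betw_def)
      then have r\<pi>: "r (\<pi> i) = \<kappa> i" for i by (simp add: \<pi>_def f_inv_into_f)
      have "inj \<pi>"
      proof (rule injI)
        fix x y assume "\<pi> x = \<pi> y"
        then show "x = y" by (metis True injD r\<pi>)
      qed
      then have "\<pi> permutes UNIV"
        by (intro bij_imp_permutes) (auto simp: bij_def finite_UNIV_inj_surj)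
      from antisym[OF this, of r] dr show ?thesis
        by (simp add: comp_def r\<pi>)
    next
      case False
      then obtain i j where ij: "i \<noteq> j" "\<kappa> i = \<kappa> j" by (auto simp: inj_def)
      have "\<kappa> \<circ> Transposition.transpose i j = \<kappa>"
        using ij by (auto simp: fun_eq_iff Transposition.transpose_def)
      with antisym[of "Transposition.transpose i j" \<kappa>] ij
      have "d \<kappa> = - d \<kappa>" by (simp add: permutes_swap_id sign_swap_id)
      then show ?thesis by simp
    qed
  qed
qed

section \<open>Permutation symmetry and the determinant of exponentials\<close>

definition perm_mat :: "('n \<Rightarrow> 'n) \<Rightarrow> complex^'n^'n" where
  "perm_mat \<tau> = (\<chi> a c. if c = \<tau> a then 1 else 0)"

lemma perm_mat_unitary:
  fixes \<tau> :: "'n::finite \<Rightarrow> 'n"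
  assumes "bij \<tau>"
  shows "perm_mat \<tau> \<in> unitary_group"
proof -
  have inj: "\<tau> a = \<tau> b \<longleftrightarrow> a = b" for a b using assms by (auto simp: bij_def inj_def)
  have "(perm_mat \<tau>) ** (perm_mat \<tau>)\<^sup>\<dagger> = mat 1"
    by (auto simp: vec_eq_iff matrix_matrix_mult_def perm_mat_def hconj_def mat_def inj
        if_distrib[of cnj] if_distrib[of "\<lambda>x. x * _"] cong: if_cong)
  moreover from this have "(perm_mat \<tau>)\<^sup>\<dagger> ** (perm_mat \<tau>) = mat 1"
    using matrix_left_right_inverse by blast
  ultimately show ?thesis by (simp add: unitary_group_def)
qed

lemma perm_mat_conj_diag: "(perm_mat \<tau> ** A ** (perm_mat \<tau>)\<^sup>\<dagger>) $ p $ p = A $ \<tau> p $ \<tau> p"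
  unfolding rot_conj_entry sum_distrib_right[symmetric]
  by (simp add: perm_mat_def if_distrib[of cnj] if_distrib[of "\<lambda>x. x * _"] if_distrib[of "\<lambda>x. _ * x"] cong: if_cong)

lemma vand_permute:
  fixes r :: "'n::finite \<Rightarrow> nat"
  assumes r: "bij_betw r UNIV {..<CARD('n)}" and "\<pi> permutes UNIV"
  shows "vand r CARD('n) (a \<circ> \<pi>) = of_int (sign \<pi>) * vand r CARD('n) a"
proof -
  have r': "r p < CARD('n)" for p using r by (auto simp: bij_betw_def)
  show ?thesis
    using mdet_permute_rows[OF assms(2), of "\<lambda>p q. a p ^ r q"] by (simp add: vand_def pdet_def r')
qed

lemma tendsto_mdet [tendsto_intros]:
  assumes "\<And>p q. ((\<lambda>x. f x p q) \<longlongrightarrow> g p q) F"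
  shows "((\<lambda>x. mdet (f x)) \<longlongrightarrow> mdet g) F"
  unfolding mdet_perm by (intro tendsto_intros assms)

definition exp_det :: "('n::finite \<Rightarrow> real) \<Rightarrow> ('n \<Rightarrow> real) \<Rightarrow> complex" where
  "exp_det s b = mdet (\<lambda>p q. of_real (exp (s q * b p)))"

text \<open>Along a progression the entries are, up to a factor depending on \<open>q\<close> only,
  powers of \<open>exp (h * s q)\<close>.\<close>

lemma exp_det_progression:
  fixes r :: "'n::finite \<Rightarrow> nat" and c h :: real
  assumes r: "bij_betw r UNIV {..<CARD('n)}"
  shows "exp_det s (\<lambda>p. c + h * real (r p)) =
    of_real (exp (c * (\<Sum>q\<in>UNIV. s q))) * vand r CARD('n) (\<lambda>q. of_real (exp (h * s q)))"
proof -
  have r': "r p < CARD('n)" for p using r by (auto simp: bij_betw_def)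
  have "exp_det s (\<lambda>p. c + h * real (r p)) = mdet (\<lambda>q p. of_real (exp (c * s q)) * of_real (exp (h * s q)) ^ r p)"
    unfolding exp_det_def
    by (subst mdet_transpose[symmetric], rule arg_cong[where f=mdet])
       (simp add: fun_eq_iff exp_add[symmetric] exp_of_nat_mult[symmetric] algebra_simps flip: of_real_power of_real_mult)
  also have "\<dots> = (\<Prod>q\<in>UNIV. of_real (exp (c * s q))) * vand r CARD('n) (\<lambda>q. of_real (exp (h * s q)))"
    by (simp add: mdet_scale_rows vand_def pdet_def r')
  also have "(\<Prod>q\<in>UNIV. of_real (exp (c * s q))) = (of_real (exp (c * (\<Sum>q\<in>UNIV. s q))) :: complex)"
    by (simp add: exp_sum sum_distrib_left)
  finally show ?thesis .
qed

text \<open>A shift of \<open>b i\<close> by \<open>h\<close> multiplies the entry in column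
  \<open>q\<close> of row \<open>i\<close> by \<open>exp (s q * h)\<close>. The combination with the
  coefficients of \<open>p\<close> therefore turns that row into zero.\<close>

lemma exp_det_recurrence:
  assumes p: "\<And>q. poly p (of_real (exp (s q * h)) :: complex) = 0" "degree p \<le> k"
  shows "(\<Sum>m\<le>k. coeff p m * exp_det s (b(i := b i + real m * h))) = 0"
proof -
  let ?f = "\<lambda>p q. of_real (exp (s q * b p)) :: complex"
  have "exp_det s (b(i := t)) = mdet (?f(i := \<lambda>q. of_real (exp (s q * t))))" for t
    unfolding exp_det_def by (rule arg_cong[where f=mdet]) (auto simp: fun_eq_iff)
  then have "(\<Sum>m\<le>k. coeff p m * exp_det s (b(i := b i + real m * h))) =
      mdet (?f(i := \<lambda>q. \<Sum>m\<le>k. coeff p m * of_real (exp (s q * (b i + real m * h)))))"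
    by (simp add: mdet_row_sum del: fun_upd_apply)
  also have "(\<lambda>q. \<Sum>m\<le>k. coeff p m * of_real (exp (s q * (b i + real m * h)))) = (\<lambda>q. 0)"
  proof
    fix q
    have "(\<Sum>m\<le>k. coeff p m * (of_real (exp (s q * (b i + real m * h))) :: complex)) =
        (\<Sum>m\<le>k. of_real (exp (s q * b i)) * (coeff p m * of_real (exp (s q * h)) ^ m))"
      by (rule sum.cong)
         (simp_all add: exp_add[symmetric] exp_of_nat_mult[symmetric] algebra_simps flip: of_real_power of_real_mult)
    also have "\<dots> = of_real (exp (s q * b i)) * poly p (of_real (exp (s q * h)))"
      by (simp only: sum_distrib_left[symmetric] poly_sum_le[OF p(2)])
    finally show "(\<Sum>m\<le>k. coeff p m * (of_real (exp (s q * (b i + real m * h))) :: complex)) = 0"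
      by (simp add: p(1))
  qed
  finally show ?thesis by (simp only: mdet_zero_row)
qed

text \<open>The determinant condition, imposed for one eigenvalue at a time, yields the recurrence.
  The trace fixes the expectation at constant \<open>b\<close>, hence the normalization.\<close>

locale conj_invariant_spectrum = conj_invariant M Y for M :: "'w measure" and Y :: "'w \<Rightarrow> complex^'n::finite^'n" +
  fixes s :: "'n \<Rightarrow> real"
  assumes s_inj: "inj s"
    and det_0: "\<And>w j. w \<in> space M \<Longrightarrow> det (Y w - s j *\<^sub>R mat 1) = 0"
    and trace_Y: "\<And>w. w \<in> space M \<Longrightarrow> trace (Y w) = of_real (\<Sum>j\<in>UNIV. s j)"
begin

section \<open>The difference equation for the Vandermonde determinant times the expectation\<close>

definition vand_Ex :: "('n \<Rightarrow> nat) \<Rightarrow> ('n \<Rightarrow> real) \<Rightarrow> complex" where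
  "vand_Ex r b = vand r CARD('n) (\<lambda>p. of_real (b p)) * Ex (wt b)"

text \<open>\<open>Ex_exp_row_difference\<close> is applied to \<open>Y\<close> minus
  \<open>s j\<close> and expanded by multilinearity in the rows. The shift multiplies the weight at
  \<open>?b T\<close> by an exponential in the sum of its coordinates; up to a common factor this is
  the power of \<open>exp (s j * h)\<close> in the statement.\<close>

lemma vand_Ex_mixed_difference:
  fixes r :: "'n \<Rightarrow> nat"
  assumes r: "bij_betw r UNIV {..<CARD('n)}"
  shows "(\<Sum>T\<in>UNIV. (- 1) ^ card T * vand_Ex r (\<lambda>p. if p \<in> T then b p + h else b p) * of_real (exp (s j * h)) ^ card (- T)) = 0"
proof -
  interpret S: conj_invariant M "\<lambda>w. Y w - s j *\<^sub>R mat 1"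
    by (rule conj_invariant_shift)
  have SEx: "S.Ex f = Ex (\<lambda>A. f (A - s j *\<^sub>R mat 1))" for f
    by (simp add: Ex_def S.Ex_def)
  let ?b = "\<lambda>T p. if p \<in> T then b p + h else b p"
  have if_row: "(\<lambda>p. if p \<in> T then exp_row r (A $ p $ p) (b p + h) else exp_row r (A $ p $ p) (b p)) =
      (\<lambda>p. exp_row r (A $ p $ p) (?b T p))" for T and A :: "complex^'n^'n"
    by auto
  have wt_shift: "wt b (A - s j *\<^sub>R mat 1) = wt b A * of_real (exp (- (s j * (\<Sum>p\<in>UNIV. b p))))" for b A
  proof -
    have "(A - s j *\<^sub>R mat 1) $ p $ p = A $ p $ p - of_real (s j)" for p
      by (simp add: mat_def scaleR_conv_of_real[where 'a=complex])
    then have "(\<Sum>p\<in>UNIV. of_real (b p) * (A - s j *\<^sub>R mat 1) $ p $ p) =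
        (\<Sum>p\<in>UNIV. of_real (b p) * A $ p $ p) + of_real (- (s j * (\<Sum>p\<in>UNIV. b p)))"
      by (simp add: algebra_simps sum_subtractf sum_distrib_left)
    then show ?thesis unfolding wt_def by (simp only: exp_add exp_of_real)
  qed
  have sum_b: "(\<Sum>p\<in>UNIV. ?b T p) = (\<Sum>p\<in>UNIV. b p) + real (card T) * h" for T
  proof -
    have "(\<Sum>p\<in>UNIV. ?b T p) = (\<Sum>p\<in>UNIV. b p + (if p \<in> T then h else 0))"
      by (rule sum.cong) auto
    then show ?thesis by (simp add: sum.distrib sum.If_cases)
  qed
  have exp_T: "of_real (exp (- (s j * (\<Sum>p\<in>UNIV. ?b T p)))) =
      of_real (exp (- (s j * ((\<Sum>p\<in>UNIV. b p) + real CARD('n) * h)))) * (of_real (exp (s j * h)) :: complex) ^ card (- T)" for T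
  proof -
    have cN: "real CARD('n) = real (card T) + real (card (- T))"
      by (simp add: Compl_eq_Diff_UNIV card_Diff_subset of_nat_diff card_mono)
    then have "exp (- (s j * (\<Sum>p\<in>UNIV. ?b T p))) =
        exp (- (s j * ((\<Sum>p\<in>UNIV. b p) + real CARD('n) * h))) * exp (s j * h) ^ card (- T)"
      unfolding sum_b cN exp_of_nat_mult[symmetric] exp_add[symmetric] by (simp add: algebra_simps)
    then show ?thesis by (simp only: of_real_mult of_real_power)
  qed
  have "0 = S.Ex (\<lambda>A. mdet (\<lambda>p q. exp_row r (A $ p $ p) (b p) q - exp_row r (A $ p $ p) (b p + h) q))"
    by (rule S.Ex_exp_row_difference[OF r det_0, symmetric])
  also have "\<dots> = S.Ex (\<lambda>A. \<Sum>T\<in>UNIV. (- 1) ^ card T * (vand r CARD('n) (\<lambda>p. of_real (?b T p)) * wt (?b T) A))"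
    unfolding mdet_diff_expand if_row mdet_exp_row(1)[OF r] ..
  also have "\<dots> = (\<Sum>T\<in>UNIV. (- 1) ^ card T * (vand r CARD('n) (\<lambda>p. of_real (?b T p)) * S.Ex (wt (?b T))))"
    by (subst S.Ex_sum) (auto intro!: continuous_intros sum.cong simp: S.Ex_mult)
  also have "\<dots> = (\<Sum>T\<in>UNIV. of_real (exp (- (s j * ((\<Sum>p\<in>UNIV. b p) + real CARD('n) * h)))) *
      ((- 1) ^ card T * vand_Ex r (?b T) * of_real (exp (s j * h)) ^ card (- T)))"
  proof (rule sum.cong[OF refl])
    fix T
    have "S.Ex (wt (?b T)) = Ex (\<lambda>A. of_real (exp (- (s j * (\<Sum>p\<in>UNIV. ?b T p)))) * wt (?b T) A)"
      unfolding SEx wt_shift by (simp only: mult.commute)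
    also have "\<dots> = of_real (exp (- (s j * (\<Sum>p\<in>UNIV. ?b T p)))) * Ex (wt (?b T))"
      by (rule Ex_mult)
    finally show "(- 1) ^ card T * (vand r CARD('n) (\<lambda>p. of_real (?b T p)) * S.Ex (wt (?b T))) =
       of_real (exp (- (s j * ((\<Sum>p\<in>UNIV. b p) + real CARD('n) * h)))) *
      ((- 1) ^ card T * vand_Ex r (?b T) * of_real (exp (s j * h)) ^ card (- T))"
      unfolding exp_T vand_Ex_def by (simp only: mult_ac)
  qed
  finally show ?thesis
    unfolding sum_distrib_left[symmetric] by simp
qed

text \<open>The polynomial \<open>Q b\<close> is the product of the factors \<open>z\<close> minus
  the shift of coordinate \<open>i\<close>, over all \<open>i\<close>, applied to
  \<open>vand_Ex r\<close> at \<open>b\<close>. Its leading coefficient is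
  \<open>vand_Ex r b\<close>, and by the mixed differences it vanishes at every
  \<open>\<sigma> j\<close>. These are \<open>N\<close> distinct numbers because
  \<open>h > 0\<close>, so \<open>Q b\<close> is a multiple of \<open>p\<close>. Replacing
  \<open>z\<close> by one of the shifts then gives zero, as in the Cayley-Hamilton theorem.\<close>

lemma vand_Ex_recurrence:
  fixes r :: "'n \<Rightarrow> nat"
  assumes r: "bij_betw r UNIV {..<CARD('n)}" and h: "h > 0"
  shows "(\<Sum>m\<le>CARD('n). coeff (\<Prod>j\<in>UNIV. [:- of_real (exp (s j * h)), 1:]) m * vand_Ex r (b(i := b i + real m * h))) = 0"
proof -
  define \<sigma> :: "'n \<Rightarrow> complex" where "\<sigma> j = of_real (exp (s j * h))" for j
  define p where "p = (\<Prod>j\<in>UNIV. [:- \<sigma> j, 1:])"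
  define N where "N = CARD('n)"
  have p: "degree p = N" "coeff p N = 1" "poly p (\<sigma> j) = 0" for j
    using prod_linear_poly(1,2)[of "UNIV :: 'n set" \<sigma>] by (auto simp: p_def N_def poly_prod)
  have \<sigma>_inj: "inj \<sigma>"
    using s_inj h by (auto simp: \<sigma>_def inj_def)
  let ?b = "\<lambda>b T p. if p \<in> T then b p + h else b p"
  define Q where "Q b = (\<Sum>T\<in>UNIV. monom ((- 1) ^ card T * vand_Ex r (?b b T)) (card (- T)))" for b
  have cT: "card (- T) \<le> N" for T :: "'n set" unfolding N_def by (rule card_mono) auto
  have Q: "coeff (Q b) m = vand_Ex r b * coeff p m" for b m
  proof -
    have "degree (Q b) \<le> N"
      unfolding Q_def by (intro degree_sum_le) (auto intro: order.trans[OF degree_monom_le] cT)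
    moreover have "coeff (Q b) N = vand_Ex r b"
    proof -
      have "card (- T) = N \<longleftrightarrow> T = {}" for T :: "'n set"
        unfolding N_def using card_eq_UNIV_imp_eq_UNIV[of "- T"] by auto
      then show ?thesis by (simp add: Q_def coeff_sum coeff_monom)
    qed
    ultimately have deg: "Q b - smult (vand_Ex r b) p \<noteq> 0 \<Longrightarrow> degree (Q b - smult (vand_Ex r b) p) < N"
    proof -
      assume ne: "Q b - smult (vand_Ex r b) p \<noteq> 0" 
      assume "degree (Q b) \<le> N" "coeff (Q b) N = vand_Ex r b"
      then have "degree (Q b - smult (vand_Ex r b) p) \<le> N" "coeff (Q b - smult (vand_Ex r b) p) N = 0"
        using p by (auto intro!: degree_diff_le order.trans[OF degree_smult_le])
      with ne show ?thesis by (metis le_neq_implies_less leading_coeff_0_iff)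
    qed
    have root: "poly (Q b - smult (vand_Ex r b) p) (\<sigma> j) = 0" for j
      using vand_Ex_mixed_difference[OF r, of b h j]
      by (simp add: p(3) Q_def poly_sum poly_monom flip: \<sigma>_def)
    have "Q b - smult (vand_Ex r b) p = 0"
    proof (rule ccontr)
      assume ne: "Q b - smult (vand_Ex r b) p \<noteq> 0"
      have "N = card (range \<sigma>)" using card_image[OF \<sigma>_inj] by (simp add: N_def)
      also have "\<dots> \<le> card {x. poly (Q b - smult (vand_Ex r b) p) x = 0}"
        using root by (intro card_mono poly_roots_finite ne) auto
      also have "\<dots> \<le> degree (Q b - smult (vand_Ex r b) p)"
        by (rule card_poly_roots_bound[OF ne])
      finally show False using deg[OF ne] by simp
    qed
    then show ?thesis by (metis coeff_smult eq_iff_diff_eq_0)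
  qed
  define B where "B m = b(i := b i + real m * h)" for m
  \<comment> \<open>This is the substitution of the shift of coordinate \<open>i\<close> for
    \<open>z\<close>: the coefficient of degree \<open>m\<close> is taken at \<open>b\<close> moved
    \<open>m\<close> steps in that coordinate.\<close>
  have "(\<Sum>m\<le>N. coeff p m * vand_Ex r (B m)) = (\<Sum>m\<le>N. coeff (Q (B m)) m)"
    by (simp add: Q mult.commute)
  also have "\<dots> = (\<Sum>T\<in>UNIV. \<Sum>m\<le>N. if m = card (- T) then (- 1) ^ card T * vand_Ex r (?b (B m) T) else 0)"
    unfolding Q_def coeff_sum coeff_monom by (subst sum.swap) (auto intro!: sum.cong)
  also have "\<dots> = (\<Sum>T\<in>UNIV. (- 1) ^ card T * vand_Ex r (?b (B (card (- T))) T))"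
    by (rule sum.cong) (auto simp: cT)
  also have "\<dots> = (\<Sum>T\<in>{T. i \<notin> T}. (- 1) ^ card T * vand_Ex r (?b (B (card (- T))) T))
       + (\<Sum>T\<in>{T. i \<in> T}. (- 1) ^ card T * vand_Ex r (?b (B (card (- T))) T))"
    by (subst sum.union_disjoint[symmetric]) (auto intro!: sum.cong)
  \<comment> \<open>Sets with and without \<open>i\<close> are paired; their cancellation is the
    vanishing of the factor \<open>z\<close> minus the shift of coordinate \<open>i\<close>.\<close>
  also have "(\<Sum>T\<in>{T. i \<in> T}. (- 1) ^ card T * vand_Ex r (?b (B (card (- T))) T)) =
     (\<Sum>T\<in>{T. i \<notin> T}. (- 1) ^ card (insert i T) * vand_Ex r (?b (B (card (- insert i T))) (insert i T)))"
    by (rule sum.reindex_bij_witness[of _ "insert i" "\<lambda>T. T - {i}"]) (auto simp: insert_absorb cong del: if_weak_cong)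
  also have "\<dots> = (\<Sum>T\<in>{T. i \<notin> T}. - ((- 1) ^ card T * vand_Ex r (?b (B (card (- T))) T)))"
  proof (rule sum.cong[OF refl])
    fix T assume "T \<in> {T. i \<notin> T}"
    then have T: "i \<notin> T" by simp
    have "card (- T) = Suc (card (- insert i T))"
    proof -
      have "- T = insert i (- insert i T)" using T by auto
      then show ?thesis by (metis ComplD card_insert_disjoint finite insertI1)
    qed
    \<comment> \<open>Adjoining \<open>i\<close> to the set adds one step in coordinate
      \<open>i\<close> but lowers the degree by one, so both points lie \<open>card (- T)\<close>
      steps away.\<close>
    then have "?b (B (card (- insert i T))) (insert i T) = ?b (B (card (- T))) T"
      using T by (auto simp: fun_eq_iff B_def algebra_simps)
    then show "(- 1) ^ card (insert i T) * vand_Ex r (?b (B (card (- insert i T))) (insert i T)) =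
      - ((- 1) ^ card T * vand_Ex r (?b (B (card (- T))) T))"
      using T by simp
  qed
  finally have "(\<Sum>m\<le>N. coeff p m * vand_Ex r (B m)) = 0"
    by (simp add: sum_negf)
  then show ?thesis by (simp only: p_def \<sigma>_def N_def B_def)
qed

lemma vand_Ex_permute:
  fixes r :: "'n \<Rightarrow> nat"
  assumes r: "bij_betw r UNIV {..<CARD('n)}" and \<pi>: "\<pi> permutes UNIV"
  shows "vand_Ex r (b \<circ> \<pi>) = of_int (sign \<pi>) * vand_Ex r b"
proof -
  define \<tau> where "\<tau> = inv \<pi>"
  have bij: "bij \<pi>" using \<pi> by (rule permutes_bij)
  then have \<tau>: "bij \<tau>" "\<pi> (\<tau> p) = p" "\<tau> (\<pi> p) = p" for p
    by (auto simp: \<tau>_def bij_imp_bij_inv bij_is_surj surj_f_inv_f bij_is_inj)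
  have "wt b (perm_mat \<tau> ** A ** (perm_mat \<tau>)\<^sup>\<dagger>) = wt (b \<circ> \<pi>) A" for A
    unfolding wt_def perm_mat_conj_diag
    by (rule arg_cong[where f=exp])
       (rule sum.reindex_bij_witness[of _ \<pi> \<tau>], auto simp: \<tau>)
  then have "Ex (wt (b \<circ> \<pi>)) = Ex (\<lambda>A. wt b (perm_mat \<tau> ** A ** (perm_mat \<tau>)\<^sup>\<dagger>))"
    by simp
  also have "\<dots> = Ex (wt b)"
    by (rule Ex_conj[OF perm_mat_unitary[OF \<tau>(1)]]) (intro continuous_intros)
  finally show ?thesis
    using vand_permute[OF r \<pi>, of "\<lambda>p. of_real (b p)"] by (simp add: vand_Ex_def o_def)
qed

text \<open>The cross difference \<open>d\<close> is antisymmetric, satisfies the common recurrence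
  and vanishes at \<open>r\<close> by construction. Cross multiplication avoids division by a value
  at \<open>r\<close>.\<close>

lemma vand_Ex_lattice:
  fixes r :: "'n \<Rightarrow> nat"
  assumes r: "bij_betw r UNIV {..<CARD('n)}" and h: "h > 0"
  shows "vand_Ex r (\<lambda>p. c + h * real (\<kappa> p)) * exp_det s (\<lambda>p. c + h * real (r p)) =
         vand_Ex r (\<lambda>p. c + h * real (r p)) * exp_det s (\<lambda>p. c + h * real (\<kappa> p))"
proof -
  let ?P = "\<Prod>j\<in>UNIV. [:- of_real (exp (s j * h)), 1:] :: complex poly"
  have P: "degree ?P = CARD('n)" "coeff ?P CARD('n) = 1" "poly ?P (of_real (exp (s j * h))) = 0" for j
    using prod_linear_poly(1,2)[of "UNIV :: 'n set" "\<lambda>j. of_real (exp (s j * h))"]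
    by (auto simp: poly_prod)
  define L where "L \<kappa> p = c + h * real (\<kappa> p)" for \<kappa> :: "'n \<Rightarrow> nat" and p
  define d where "d \<kappa> = vand_Ex r (L \<kappa>) * exp_det s (L r) - vand_Ex r (L r) * exp_det s (L \<kappa>)" for \<kappa>
  have L_upd: "L (\<kappa>(i := \<kappa> i + m)) = (L \<kappa>)(i := L \<kappa> i + real m * h)" for \<kappa> i m
    by (auto simp: L_def fun_eq_iff algebra_simps)
  have "d \<kappa> = 0"
  proof (rule antisym_recurrence_zero[where d=d, OF r])
    fix \<kappa> :: "'n \<Rightarrow> nat" and \<pi> :: "'n \<Rightarrow> 'n" assume \<pi>: "\<pi> permutes UNIV"
    have "exp_det s (L \<kappa> \<circ> \<pi>) = of_int (sign \<pi>) * exp_det s (L \<kappa>)"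
      using mdet_permute_rows[OF \<pi>, of "\<lambda>p q. of_real (exp (s q * L \<kappa> p))"] by (simp add: exp_det_def)
    moreover have "L (\<kappa> \<circ> \<pi>) = L \<kappa> \<circ> \<pi>" by (auto simp: L_def)
    ultimately show "d (\<kappa> \<circ> \<pi>) = of_int (sign \<pi>) * d \<kappa>"
      using vand_Ex_permute[OF r \<pi>, of "L \<kappa>"] by (simp add: d_def algebra_simps)
  next
    fix \<kappa> :: "'n \<Rightarrow> nat" and i
    have "(\<Sum>m\<le>CARD('n). coeff ?P m * d (\<kappa>(i := \<kappa> i + m))) =
       (\<Sum>m\<le>CARD('n). coeff ?P m * vand_Ex r ((L \<kappa>)(i := L \<kappa> i + real m * h))) * exp_det s (L r)
       - vand_Ex r (L r) * (\<Sum>m\<le>CARD('n). coeff ?P m * exp_det s ((L \<kappa>)(i := L \<kappa> i + real m * h)))"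
      unfolding d_def L_upd
      by (simp add: sum_subtractf sum_distrib_left sum_distrib_right algebra_simps)
    also have "\<dots> = 0"
      using vand_Ex_recurrence[OF r h, of "L \<kappa>" i] exp_det_recurrence[of ?P s h "CARD('n)" "L \<kappa>" i] P
      by simp
    finally show "(\<Sum>m\<le>CARD('n). coeff ?P m * d (\<kappa>(i := \<kappa> i + m))) = 0" .
  qed (use P in \<open>auto simp: d_def\<close>)
  then show ?thesis unfolding d_def L_def[abs_def] by simp
qed

end

section \<open>From lattice points to arbitrary arguments\<close>

lemma continuous_wt_param:
  "continuous_on UNIV (\<lambda>x :: (real^'n) \<times> (complex^'n::finite^'n). wt (\<lambda>p. fst x $ p) (snd x))"
  unfolding wt_def by (intro continuous_intros)

lemma (in conj_invariant) Ex_wt_tendsto: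
  assumes "\<And>p. (\<lambda>n. X n p) \<longlonglongrightarrow> b p"
  shows "(\<lambda>n. Ex (wt (X n))) \<longlonglongrightarrow> Ex (wt b)"
proof -
  have "(\<lambda>n. \<chi> p. X n p) \<longlonglongrightarrow> (\<chi> p. b p)"
    by (intro vec_tendstoI) (simp add: assms)
  from Ex_tendsto_param[where f="\<lambda>x. wt (\<lambda>p. x $ p)", OF continuous_wt_param this]
  show ?thesis by simp
qed

lemma tendsto_vand:
  fixes r :: "'n::finite \<Rightarrow> nat"
  assumes r: "bij_betw r UNIV {..<CARD('n)}" and "\<And>p. ((\<lambda>x. f x p) \<longlongrightarrow> a p) F"
  shows "((\<lambda>x. vand r CARD('n) (f x)) \<longlongrightarrow> vand r CARD('n) a) F"
  unfolding vand_prod[OF r order_refl] by (intro tendsto_intros assms)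

text \<open>The exponent \<open>e\<close> counts the pairs of indices; only its independence of
  \<open>c\<close>, \<open>h\<close> and \<open>a\<close> is used, to cancel equal powers of
  \<open>h\<close>.\<close>

lemma vand_affine:
  fixes r :: "'n::finite \<Rightarrow> nat"
  assumes r: "bij_betw r UNIV {..<CARD('n)}"
  shows "\<exists>e. \<forall>c h a. vand r CARD('n) (\<lambda>p. c + h * a p) = h ^ e * vand r CARD('n) a"
proof (intro exI allI)
  fix c h :: complex and a :: "'n \<Rightarrow> complex"
  show "vand r CARD('n) (\<lambda>p. c + h * a p) = h ^ (\<Sum>q | r q < CARD('n). card {p. r p < r q}) * vand r CARD('n) a"
    unfolding vand_prod[OF r order_refl] power_sum prod.distrib[symmetric]
    by (rule prod.cong) (simp_all add: prod.distrib flip: right_diff_distrib)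
qed

lemma vand_nonzero:
  fixes r :: "'n::finite \<Rightarrow> nat"
  assumes r: "bij_betw r UNIV {..<CARD('n)}" and "inj a"
  shows "vand r CARD('n) a \<noteq> 0"
  unfolding vand_prod[OF r order_refl] using assms(2) by (auto dest: injD)

theorem (in conj_invariant_spectrum) harish_chandra_itzykson_zuber:
  fixes r :: "'n \<Rightarrow> nat" and b :: "'n \<Rightarrow> real"
  assumes r: "bij_betw r UNIV {..<CARD('n)}"
  shows "vand r CARD('n) (\<lambda>p. of_real (b p)) * vand r CARD('n) (\<lambda>p. of_real (s p)) * Ex (wt b) =
         vand r CARD('n) (\<lambda>p. of_nat (r p)) * exp_det s b"
proof -
  obtain e where e: "\<And>c h a. vand r CARD('n) (\<lambda>p. c + h * a p) = h ^ e * vand r CARD('n) a"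
    using vand_affine[OF r] by blast
  \<comment> \<open>Any lower bound for all coordinates of \<open>b\<close> would do: it makes the
    lattice coordinates \<open>\<kappa> n p\<close> natural numbers.\<close>
  define c where "c = - (\<Sum>p\<in>UNIV. \<bar>b p\<bar>)"
  have c: "c \<le> b p" for p
    using member_le_sum[of p UNIV "\<lambda>p. \<bar>b p\<bar>"] by (simp add: c_def)
  define h where "h n = inverse (real (Suc n))" for n
  have h0: "h n > 0" for n by (simp add: h_def)
  have h: "h \<longlonglongrightarrow> 0" unfolding h_def by (rule LIMSEQ_inverse_real_of_nat)
  define \<kappa> where "\<kappa> n p = nat \<lfloor>(b p - c) / h n\<rfloor>" for n p
  define X where "X n p = c + h n * real (\<kappa> n p)" for n p
  have X: "(\<lambda>n. X n p) \<longlonglongrightarrow> b p" for p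
  proof (rule tendsto_sandwich[of "\<lambda>n. b p - h n" _ _ "\<lambda>n. b p"])
    have k: "(b p - c) / h n - 1 \<le> real (\<kappa> n p)" "real (\<kappa> n p) \<le> (b p - c) / h n" for n
    proof -
      have "(b p - c) / h n \<ge> 0" using c[of p] h0[of n] by simp
      then have "real (\<kappa> n p) = of_int \<lfloor>(b p - c) / h n\<rfloor>" by (simp add: \<kappa>_def)
      then show "(b p - c) / h n - 1 \<le> real (\<kappa> n p)" "real (\<kappa> n p) \<le> (b p - c) / h n" by linarith+
    qed
    show "\<forall>\<^sub>F n in sequentially. b p - h n \<le> X n p"
      using k(1) h0 by (intro always_eventually allI) (simp add: X_def field_simps)
    show "\<forall>\<^sub>F n in sequentially. X n p \<le> b p"
      using k(2) h0 by (intro always_eventually allI) (simp add: X_def field_simps)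
    show "(\<lambda>n. b p - h n) \<longlonglongrightarrow> b p" using tendsto_diff[OF tendsto_const h, of "b p"] by simp
  qed simp
  define S where "S = (\<Sum>q\<in>UNIV. s q)"
  let ?V = "vand r CARD('n)"
  have lattice: "?V (\<lambda>p. of_real (X n p)) * Ex (wt (X n)) * of_real (exp (c * S)) *
       ?V (\<lambda>q. of_real ((exp (h n * s q) - 1) / h n)) =
     ?V (\<lambda>p. of_nat (r p)) * Ex (wt (\<lambda>p. c + h n * real (r p))) * exp_det s (X n)" for n
  proof -
    have 1: "?V (\<lambda>p. of_real (c + h n * real (r p))) = of_real (h n) ^ e * ?V (\<lambda>p. of_nat (r p))"
      using e[of "of_real c" "of_real (h n)" "\<lambda>p. of_nat (r p)"] by simp
    \<comment> \<open>Written this way, the Vandermonde determinant of the exponentials releases the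
      same power of \<open>h n\<close> as that of the progression, and what remains tends to the one
      of \<open>s\<close>.\<close>
    have "of_real (exp (h n * s q)) = 1 + of_real (h n) * (of_real ((exp (h n * s q) - 1) / h n) :: complex)" for q
      using h0[of n] by (simp add: field_simps)
    then have 2: "?V (\<lambda>q. of_real (exp (h n * s q))) = of_real (h n) ^ e * ?V (\<lambda>q. of_real ((exp (h n * s q) - 1) / h n))"
      using e[of 1 "of_real (h n)" "\<lambda>q. of_real ((exp (h n * s q) - 1) / h n)"] by presburger
    have "of_real (h n) ^ e * (?V (\<lambda>p. of_real (X n p)) * Ex (wt (X n)) * of_real (exp (c * S)) *
       ?V (\<lambda>q. of_real ((exp (h n * s q) - 1) / h n))) =
      of_real (h n) ^ e * (?V (\<lambda>p. of_nat (r p)) * Ex (wt (\<lambda>p. c + h n * real (r p))) * exp_det s (X n))"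
      using vand_Ex_lattice[OF r h0[of n], of c "\<kappa> n"]
      unfolding exp_det_progression[OF r] vand_Ex_def 1 2 S_def[symmetric] X_def[symmetric]
      by (simp only: mult_ac)
    then show ?thesis using h0[of n] by simp
  qed
  have "(\<lambda>n. (exp (h n * s q) - 1) / h n) \<longlonglongrightarrow> s q" for q
  proof -
    have "((\<lambda>t. exp (t * s q)) has_real_derivative s q) (at 0)"
      by (auto intro!: derivative_eq_intros)
    then have "((\<lambda>t. (exp (t * s q) - 1) / t) \<longlongrightarrow> s q) (at 0)"
      by (simp add: has_field_derivative_iff)
    then show ?thesis
      using h h0 by (auto simp: tendsto_at_iff_sequentially comp_def less_imp_neq[symmetric])
  qed
  then have "(\<lambda>n. ?V (\<lambda>p. of_real (X n p)) * Ex (wt (X n)) * of_real (exp (c * S)) *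
       ?V (\<lambda>q. of_real ((exp (h n * s q) - 1) / h n)))
     \<longlonglongrightarrow> ?V (\<lambda>p. of_real (b p)) * Ex (wt b) * of_real (exp (c * S)) * ?V (\<lambda>q. of_real (s q))"
    by (intro tendsto_intros tendsto_vand[OF r] Ex_wt_tendsto X) auto
  moreover have "(\<lambda>n. ?V (\<lambda>p. of_nat (r p)) * Ex (wt (\<lambda>p. c + h n * real (r p))) * exp_det s (X n))
     \<longlonglongrightarrow> ?V (\<lambda>p. of_nat (r p)) * Ex (wt (\<lambda>p. c + 0 * real (r p))) * exp_det s b"
    unfolding exp_det_def by (intro tendsto_intros Ex_wt_tendsto h X)
  ultimately have "?V (\<lambda>p. of_real (b p)) * Ex (wt b) * of_real (exp (c * S)) * ?V (\<lambda>q. of_real (s q)) =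
      ?V (\<lambda>p. of_nat (r p)) * Ex (wt (\<lambda>p. c + 0 * real (r p))) * exp_det s b"
    unfolding lattice by (rule LIMSEQ_unique)
  \<comment> \<open>In the limit the progression is constant, so the weight depends on
    \<open>Y\<close> through its trace only. The result cancels the factor
    \<open>exp (c * S)\<close> from \<open>exp_det_progression\<close>.\<close>
  moreover have "Ex (wt (\<lambda>p. c + 0 * real (r p))) = of_real (exp (c * S))"
  proof -
    have "wt (\<lambda>p. c + 0 * real (r p)) (Y w) = of_real (exp (c * S))" if "w \<in> space M" for w
    proof -
      have "wt (\<lambda>p. c + 0 * real (r p)) (Y w) = exp (of_real c * trace (Y w))"
        by (simp add: wt_def trace_def sum_distrib_left)
      also have "\<dots> = of_real (exp (c * S))"
        unfolding trace_Y[OF that] S_def[symmetric] by (simp flip: exp_of_real)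
      finally show ?thesis .
    qed
    then have "Ex (wt (\<lambda>p. c + 0 * real (r p))) = (LINT w|M. of_real (exp (c * S)))"
      unfolding Ex_def by (intro Bochner_Integration.integral_cong) auto
    then show ?thesis by (simp add: prob_space)
  qed
  ultimately show ?thesis by (simp add: mult_ac)
qed

subsection \<open>Unitarily invariant measures\<close>

lemma nn_integral_lborel_translate:
  fixes f :: "'a::euclidean_space \<Rightarrow> ennreal"
  assumes [measurable]: "f \<in> borel_measurable borel"
  shows "(\<integral>\<^sup>+x. f (c + x) \<partial>lborel) = (\<integral>\<^sup>+x. f x \<partial>lborel)"
proof -
  have "(\<integral>\<^sup>+x. f x \<partial>lborel) = (\<integral>\<^sup>+x. f x \<partial>distr lborel borel ((+) c))"
    by (simp only: lborel_distr_plus)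
  also have "\<dots> = (\<integral>\<^sup>+x. f (c + x) \<partial>lborel)"
    by (rule nn_integral_distr) auto
  finally show ?thesis ..
qed

text \<open>The uniqueness argument for Haar measure, applied to the image of Lebesgue measure under \<open>T\<close>;
  the unit ball is invariant under \<open>T\<close>, which fixes the constant.\<close>

lemma lborel_distr_isometry:
  fixes T :: "'a::euclidean_space \<Rightarrow> 'a"
  assumes T: "linear T" "\<And>x. norm (T x) = norm x"
  shows "distr lborel borel T = lborel"
proof (rule measure_eqI)
  fix A assume "A \<in> sets (distr lborel borel T)"
  then have [measurable]: "A \<in> sets borel" by simp
  have [measurable]: "T \<in> borel_measurable borel"
    using T(1) by (intro borel_measurable_continuous_onI linear_continuous_on linear_conv_bounded_linear[THEN iffD1])
  have [measurable]: "ball (0::'a) 1 \<in> sets borel" by simp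
  have "inj T" unfolding linear_inj_iff_eq_0[OF T(1)] using T(2) by (metis norm_eq_zero)
  then have surj: "surj T" using T(1) by (simp add: linear_injective_imp_surjective)
  let ?f = "indicator (ball 0 1) :: 'a \<Rightarrow> ennreal" and ?g = "indicator A :: 'a \<Rightarrow> ennreal"
  have fT: "?f (T x) = ?f x" for x by (simp add: indicator_def T(2))
  have ball: "(\<integral>\<^sup>+y. ?f (z - y) \<partial>lborel) = emeasure lborel (ball (0::'a) 1)" for z
  proof -
    have "(\<integral>\<^sup>+y. ?f (z - y) \<partial>lborel) = (\<integral>\<^sup>+y. ?f (z - (z + y)) \<partial>lborel)"
      by (rule nn_integral_lborel_translate[symmetric]) measurable
    also have "\<dots> = (\<integral>\<^sup>+y. ?f y \<partial>lborel)" by (rule nn_integral_cong) (simp add: indicator_def)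
    finally show ?thesis by simp
  qed
  have "emeasure lborel (ball (0::'a) 1) * emeasure lborel A = (\<integral>\<^sup>+x. ?f (T x) \<partial>lborel) * (\<integral>\<^sup>+y. ?g y \<partial>lborel)"
    by (simp add: fT)
  also have "\<dots> = (\<integral>\<^sup>+x. ?f (T x) * (\<integral>\<^sup>+y. ?g (T x + y) \<partial>lborel) \<partial>lborel)"
    by (subst nn_integral_lborel_translate) (simp_all add: nn_integral_multc)
  also have "\<dots> = (\<integral>\<^sup>+x. (\<integral>\<^sup>+y. ?f (T x) * ?g (T x + y) \<partial>lborel) \<partial>lborel)"
    by (intro nn_integral_cong nn_integral_cmult[symmetric]) measurable
  also have "\<dots> = (\<integral>\<^sup>+y. (\<integral>\<^sup>+x. ?f (T x) * ?g (T x + y) \<partial>lborel) \<partial>lborel)"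
    by (rule lborel_pair.Fubini') measurable
  also have "\<dots> = (\<integral>\<^sup>+y. (\<integral>\<^sup>+x. ?f (T x - y) * ?g (T x) \<partial>lborel) \<partial>lborel)"
  proof (rule nn_integral_cong)
    fix y
    \<comment> \<open>Translating \<open>x\<close> by \<open>- z\<close> moves \<open>y\<close> from
      the indicator of \<open>A\<close> to that of the ball. The integral over \<open>y\<close> is
      then the volume of the ball, whatever \<open>x\<close> is.\<close>
    obtain z where z: "y = T z" using surj by auto
    have "(\<integral>\<^sup>+x. ?f (T x) * ?g (T x + y) \<partial>lborel) = (\<integral>\<^sup>+x. ?f (T (- z + x)) * ?g (T (- z + x) + y) \<partial>lborel)"
      by (rule nn_integral_lborel_translate[symmetric, of "\<lambda>x. ?f (T x) * ?g (T x + y)"]) measurable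
    then show "(\<integral>\<^sup>+x. ?f (T x) * ?g (T x + y) \<partial>lborel) = (\<integral>\<^sup>+x. ?f (T x - y) * ?g (T x) \<partial>lborel)"
      by (simp add: linear_add[OF T(1)] linear_neg[OF T(1)] z linear_diff[OF T(1)])
  qed
  also have "\<dots> = (\<integral>\<^sup>+x. (\<integral>\<^sup>+y. ?f (T x - y) * ?g (T x) \<partial>lborel) \<partial>lborel)"
    by (rule lborel_pair.Fubini') measurable
  also have "\<dots> = (\<integral>\<^sup>+x. emeasure lborel (ball (0::'a) 1) * ?g (T x) \<partial>lborel)"
    by (simp add: nn_integral_multc ball)
  also have "\<dots> = emeasure lborel (ball (0::'a) 1) * (\<integral>\<^sup>+x. ?g (T x) \<partial>lborel)"
    by (rule nn_integral_cmult) measurable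
  also have "(\<integral>\<^sup>+x. ?g (T x) \<partial>lborel) = (\<integral>\<^sup>+x. ?g x \<partial>distr lborel borel T)"
    by (rule nn_integral_distr[symmetric]) measurable
  also have "\<dots> = emeasure (distr lborel borel T) A" by simp
  finally have "emeasure lborel (ball (0::'a) 1) * emeasure (distr lborel borel T) A =
      emeasure lborel (ball (0::'a) 1) * emeasure lborel A" ..
  moreover have "emeasure lborel (ball (0::'a) 1) \<noteq> \<infinity>"
    using emeasure_bounded_finite[OF bounded_ball, of "0::'a" 1] by simp
  moreover have "emeasure lborel (ball (0::'a) 1) \<noteq> 0"
    using content_ball_pos[of 1 "0::'a"] by (auto simp: measure_def)
  ultimately show "emeasure (distr lborel borel T) A = emeasure lborel A"
    by (simp add: ennreal_mult_cancel_left)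
qed simp

lemma sgn_measurable: "(sgn :: 'a::euclidean_space \<Rightarrow> 'a) \<in> borel_measurable borel"
  unfolding sgn_div_norm[abs_def] by measurable

lemma sphere_measure_basics:
  "sets (sphere_measure :: 'a::euclidean_space measure) = sets (restrict_space borel (sphere 0 1))"
  "space (sphere_measure :: 'a measure) = sphere 0 1"
  by (simp_all add: sphere_measure_def space_restrict_space sets_restrict_space)

lemma cball_emeasure:
  "emeasure lborel (cball (0::'a::euclidean_space) 1) \<noteq> 0"
  "emeasure lborel (cball (0::'a::euclidean_space) 1) \<noteq> \<infinity>"
proof -
  show "emeasure lborel (cball (0::'a) 1) \<noteq> \<infinity>"
    using emeasure_bounded_finite[OF bounded_cball, of "0::'a" 1] by simp
  show "emeasure lborel (cball (0::'a) 1) \<noteq> 0"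
    using content_cball_pos[of 1 "0::'a"] by (auto simp: measure_def)
qed

lemma emeasure_sphere_measure:
  fixes A :: "'a::euclidean_space set"
  assumes "A \<in> sets sphere_measure"
  shows "emeasure sphere_measure A = emeasure lborel (cball 0 1 \<inter> sgn -` A) / emeasure lborel (cball (0::'a) 1)"
proof -
  have A: "A \<in> sets borel" "A \<subseteq> sphere 0 1"
    using assms by (auto simp: sphere_measure_basics sets_restrict_space)
  note [measurable] = sgn_measurable A(1)
  have "sgn -` A \<in> sets borel"
    using measurable_sets[OF sgn_measurable A(1)] by simp
  then show ?thesis
    unfolding sphere_measure_def using A
    by (simp add: emeasure_restrict_space emeasure_distr measurable_distr_eq1)
qed

lemma sphere_measure_prob: "prob_space (sphere_measure :: 'a::euclidean_space measure)"
proof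
  have "sphere (0::'a) 1 \<in> sets sphere_measure"
    by (simp add: sphere_measure_basics sets_restrict_space) (metis borel_closed closed_sphere Int_absorb image_eqI)
  then have "emeasure (sphere_measure :: 'a measure) (sphere 0 1) =
      emeasure lborel (cball 0 1 \<inter> sgn -` (sphere (0::'a) 1)) / emeasure lborel (cball (0::'a) 1)"
    by (rule emeasure_sphere_measure)
  \<comment> \<open>Only the origin fails to project to the sphere, as \<open>sgn 0 = 0\<close>; it
    is a null set.\<close>
  also have "cball 0 1 \<inter> sgn -` (sphere (0::'a) 1) = cball 0 1 - {0}"
    by (auto simp: norm_sgn)
  also have "emeasure lborel (cball (0::'a) 1 - {0}) = emeasure lborel (cball (0::'a) 1)"
    by (intro emeasure_Diff_null_set) auto
  finally show "emeasure (sphere_measure :: 'a measure) (space sphere_measure) = 1"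
    using cball_emeasure[where 'a='a] by (simp add: sphere_measure_basics ennreal_divide_self less_top)
qed

text \<open>A linear isometry commutes with \<open>sgn\<close> and preserves the ball and Lebesgue
  measure, hence also the projected measure.\<close>

lemma sphere_measure_distr_isometry:
  fixes T :: "'a::euclidean_space \<Rightarrow> 'a"
  assumes T: "linear T" "\<And>x. norm (T x) = norm x"
  shows "T \<in> measurable sphere_measure sphere_measure" "distr sphere_measure sphere_measure T = sphere_measure"
proof -
  have Tb: "T \<in> borel_measurable borel"
    using T(1) by (intro borel_measurable_continuous_onI linear_continuous_on linear_conv_bounded_linear[THEN iffD1])
  have "T \<in> measurable (restrict_space borel (sphere 0 1)) (restrict_space borel (sphere 0 1))"
    by (rule measurable_restrict_space3[OF Tb]) (auto simp: T(2))
  then show Tm: "T \<in> measurable sphere_measure sphere_measure"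
    unfolding measurable_cong_sets[OF sphere_measure_basics(1) sphere_measure_basics(1)] .
  show "distr sphere_measure sphere_measure T = sphere_measure"
  proof (rule measure_eqI)
    fix A assume "A \<in> sets (distr sphere_measure sphere_measure T)"
    then have A: "A \<in> sets sphere_measure" by simp
    then have A': "A \<in> sets borel" "A \<subseteq> sphere 0 1"
      by (auto simp: sphere_measure_basics sets_restrict_space)
    let ?B = "cball 0 1 \<inter> sgn -` A"
    have B: "?B \<in> sets borel"
      using measurable_sets[OF sgn_measurable A'(1)] by auto
    have sgnT: "sgn (T u) = T (sgn u)" for u
      by (simp add: sgn_div_norm T(2) linear_scale[OF T(1)])
    have eq: "cball 0 1 \<inter> sgn -` (T -` A \<inter> sphere 0 1) = T -` ?B"
    proof -
      have "sgn u \<in> sphere 0 1" if "T (sgn u) \<in> A" for u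
        using that A'(2) T(2)[of "sgn u"] by auto
      then show ?thesis by (auto simp: sgnT T(2))
    qed
    have "emeasure (distr sphere_measure sphere_measure T) A = emeasure sphere_measure (T -` A \<inter> space sphere_measure)"
      by (rule emeasure_distr[OF Tm A])
    also have "\<dots> = emeasure lborel (T -` ?B) / emeasure lborel (cball (0::'a) 1)"
      using emeasure_sphere_measure[OF measurable_sets[OF Tm A]]
      by (simp only: sphere_measure_basics eq)
    also have "emeasure lborel (T -` ?B) = emeasure (distr lborel borel T) ?B"
      using Tb B by (subst emeasure_distr) auto
    also have "\<dots> = emeasure lborel ?B"
      by (simp only: lborel_distr_isometry[OF T])
    finally show "emeasure (distr sphere_measure sphere_measure T) A = emeasure sphere_measure A"
      by (simp add: emeasure_sphere_measure[OF A])
  qed simp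
qed

section \<open>Unitary matrices, isometries and adjoined columns\<close>

lemma unitary_groupI_isometry:
  fixes Q :: "complex^'n::finite^'n"
  assumes "Q\<^sup>\<dagger> ** Q = mat 1"
  shows "Q \<in> unitary_group"
  using assms matrix_left_right_inverse[of "Q\<^sup>\<dagger>" Q] by (simp add: unitary_group_def)

lemma unitary_mult: "V \<in> unitary_group \<Longrightarrow> W \<in> unitary_group \<Longrightarrow> V ** W \<in> unitary_group"
  unfolding unitary_group_def
  by (simp add: hconj_mult) (metis matrix_mul_assoc matrix_mul_lid)

lemma hprod_self: "hprod v v = of_real ((norm v)\<^sup>2)"
proof -
  have "(norm v)\<^sup>2 = (\<Sum>i\<in>UNIV. (cmod (v $ i))\<^sup>2)"
    by (simp add: norm_vec_def L2_set_def sum_nonneg)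
  then show ?thesis
    by (simp add: hprod_def complex_norm_square[symmetric] mult.commute flip: of_real_power of_real_sum)
qed

lemma hprod_mult_right: "hprod v (A *v w) = hprod (A\<^sup>\<dagger> *v v) w"
  unfolding hprod_def matrix_vector_mult_def hconj_def
  by (simp add: sum_distrib_left sum_distrib_right, subst sum.swap) (simp add: mult_ac)

lemma hprod_mult_left: "hprod (A *v v) w = hprod v (A\<^sup>\<dagger> *v w)"
  by (simp add: hprod_mult_right hconj_hconj)

lemma matrix_vector_axis: "(A *v axis q 1) $ p = (A :: complex^'n^'m) $ p $ q"
  by (simp add: matrix_vector_mult_def axis_def if_distrib[of "\<lambda>x. _ * x"] cong: if_cong)

lemma matrix_eqI_hprod:
  assumes "\<And>v w. hprod v (A *v w) = hprod v (B *v w)"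
  shows "A = B"
proof -
  have "(A *v axis q 1) $ p = (B *v axis q 1) $ p" for p q
  proof -
    have "hprod (axis p 1) z = z $ p" for z :: "complex^'a"
      by (simp add: hprod_def axis_def if_distrib[of cnj] if_distrib[of "\<lambda>x. x * _"] cong: if_cong)
    then show ?thesis using assms[of "axis p 1" "axis q 1"] by simp
  qed
  then show ?thesis by (simp add: vec_eq_iff matrix_vector_axis)
qed

lemma hprod_add_right: "hprod v (w + z) = hprod v w + hprod v z"
  and hprod_add_left: "hprod (w + z) v = hprod w v + hprod z v"
  and hprod_scale_right: "hprod v (c *s w) = c * hprod v w"
  and hprod_scale_left: "hprod (c *s w) v = cnj c * hprod w v"
  by (simp_all add: hprod_def algebra_simps sum.distrib sum_distrib_left)

text \<open>Polarization: the norms of \<open>v + w\<close> and of \<open>v + \<i> *s w\<close>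
  determine the Hermitian product.\<close>

lemma isometry_hconj_mult:
  fixes A :: "complex^'n^'m"
  assumes "\<And>u. norm (A *v u) = norm u"
  shows "A\<^sup>\<dagger> ** A = mat 1"
proof (rule matrix_eqI_hprod)
  fix v w :: "complex^'n"
  let ?h = "\<lambda>v w. hprod (A *v v) (A *v w)"
  have sq: "?h u u = hprod u u" for u by (simp add: hprod_self assms)
  have 1: "?h v w + ?h w v = hprod v w + hprod w v"
    using sq[of "v + w"] sq[of v] sq[of w]
    by (simp add: matrix_vector_right_distrib hprod_add_right hprod_add_left add_ac)
  have 2: "\<i> * ?h v w - \<i> * ?h w v = \<i> * hprod v w - \<i> * hprod w v"
    using sq[of "v + \<i> *s w"] sq[of v] sq[of w]
    by (simp add: matrix_vector_right_distrib hprod_add_right hprod_add_left hprod_scale_right hprod_scale_left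
        vector_scalar_commute algebra_simps)
  from 2 have "?h v w - ?h w v = hprod v w - hprod w v"
    by (simp flip: right_diff_distrib)
  with 1 have "?h v w = hprod v w" by algebra
  then show "hprod v ((A\<^sup>\<dagger> ** A) *v w) = hprod v (mat 1 *v w)"
    by (simp add: hprod_mult_left flip: matrix_vector_mul_assoc)
qed

lemma unitary_norm:
  assumes "W \<in> unitary_group"
  shows "norm (W *v u) = norm u"
proof -
  have "hprod (W *v u) (W *v u) = hprod u u"
    using assms by (simp add: hprod_mult_left matrix_vector_mul_assoc unitary_group_def)
  then have "(norm (W *v u))\<^sup>2 = (norm u)\<^sup>2" unfolding hprod_self by (simp only: of_real_eq_iff)
  then show ?thesis by (simp add: power2_eq_iff_nonneg)
qed

text \<open>Both \<open>W ** P\<close> and \<open>P'\<close> map isometrically onto the complement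
  of \<open>W *v v\<close>, so they differ by a unitary change of coordinates on the source. This is
  how left multiplication by \<open>W\<close> acts on a frame built from \<open>v\<close> and
  \<open>P v\<close>.\<close>

lemma isometry_onto_perp_transport:
  fixes P P' :: "complex^'n::finite^'m"
  assumes P: "isometry_onto_perp v P" and P': "isometry_onto_perp (W *v v) P'" and W: "W \<in> unitary_group"
  shows "\<exists>Q\<in>unitary_group. W ** P = P' ** Q"
proof -
  define Q where "Q = P'\<^sup>\<dagger> ** W ** P"
  have iso': "P'\<^sup>\<dagger> ** P' = mat 1"
    using P' by (intro isometry_hconj_mult) (simp add: isometry_onto_perp_def)
  have PQ: "P' *v (Q *v u) = W *v (P *v u)" for u
  proof -
    have "hprod v (P *v u) = 0" using P by (auto simp: isometry_onto_perp_def)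
    then have "hprod (W *v v) (W *v (P *v u)) = 0"
      using W by (simp add: hprod_mult_left matrix_vector_mul_assoc matrix_mul_assoc unitary_group_def)
    then have "W *v (P *v u) \<in> range (\<lambda>u. P' *v u)"
      using P' by (simp add: isometry_onto_perp_def)
    then obtain z where z: "W *v (P *v u) = P' *v z" by auto
    have "Q *v u = P'\<^sup>\<dagger> *v (W *v (P *v u))"
      by (simp add: Q_def matrix_vector_mul_assoc matrix_mul_assoc)
    also have "\<dots> = z" unfolding z by (simp add: matrix_vector_mul_assoc iso')
    finally show ?thesis by (simp add: z)
  qed
  have "norm (Q *v u) = norm u" for u
  proof -
    have "norm (Q *v u) = norm (P' *v (Q *v u))" using P' by (simp add: isometry_onto_perp_def)
    also have "\<dots> = norm u" using P unitary_norm[OF W] by (simp add: PQ isometry_onto_perp_def)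
    finally show ?thesis .
  qed
  then have "Q \<in> unitary_group" by (intro unitary_groupI_isometry isometry_hconj_mult)
  moreover have "W ** P = P' ** Q"
    by (rule matrix_eq[THEN iffD2]) (simp add: PQ flip: matrix_vector_mul_assoc)
  ultimately show ?thesis by blast
qed

definition adjoin_col :: "complex^'n option \<Rightarrow> complex^'n^'n option \<Rightarrow> complex^'n option^'n option" where
  "adjoin_col v A = (\<chi> p q. case q of None \<Rightarrow> v $ p | Some k \<Rightarrow> A $ p $ k)"

lemma sum_option: "(\<Sum>q\<in>UNIV. f (q :: 'n::finite option)) = f None + (\<Sum>k\<in>UNIV. f (Some k))"
  by (simp add: UNIV_option_conv sum.reindex)

lemma prod_option: "(\<Prod>q\<in>UNIV. f (q :: 'n::finite option)) = f None * (\<Prod>k\<in>UNIV. f (Some k))"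
  by (simp add: UNIV_option_conv prod.reindex)

lemma mult_adjoin_col: "W ** adjoin_col v A = adjoin_col (W *v v) (W ** A)"
  by (auto simp: adjoin_col_def vec_eq_iff matrix_matrix_mult_def matrix_vector_mult_def split: option.split)

lemma adjoin_col_unitary:
  fixes P :: "complex^'n::finite^'n option"
  assumes P: "isometry_onto_perp v P" and v: "norm v = 1" and U: "U \<in> unitary_group"
  shows "adjoin_col v (P ** U) \<in> unitary_group"
proof (rule unitary_groupI_isometry)
  define B where "B = P ** U"
  have "P\<^sup>\<dagger> ** P = mat 1"
    using P by (intro isometry_hconj_mult) (simp add: isometry_onto_perp_def)
  then have BB: "B\<^sup>\<dagger> ** B = mat 1"
    using U by (simp add: B_def hconj_mult unitary_group_def) (metis matrix_mul_assoc matrix_mul_lid)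
  have vB: "hprod v (B *v u) = 0" for u
    using P by (auto simp: B_def isometry_onto_perp_def simp flip: matrix_vector_mul_assoc)
  have vB': "(\<Sum>p\<in>UNIV. cnj (v $ p) * B $ p $ k) = 0" for k
    using vB[of "axis k 1"] by (simp add: hprod_def matrix_vector_axis)
  then have Bv: "(\<Sum>p\<in>UNIV. cnj (B $ p $ k) * v $ p) = 0" for k
  proof -
    have "(\<Sum>p\<in>UNIV. cnj (B $ p $ k) * v $ p) = cnj (\<Sum>p\<in>UNIV. cnj (v $ p) * B $ p $ k)"
      by (simp add: mult.commute)
    then show ?thesis by (simp only: vB' complex_cnj_zero)
  qed
  have vv: "(\<Sum>p\<in>UNIV. cnj (v $ p) * v $ p) = 1"
    using hprod_self[of v] v by (simp add: hprod_def)
  have BB': "(\<Sum>p\<in>UNIV. cnj (B $ p $ k) * B $ p $ l) = (if k = l then 1 else 0)" for k l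
    using arg_cong[OF BB, of "\<lambda>A. A $ k $ l"] by (simp add: matrix_matrix_mult_def hconj_def mat_def)
  show "(adjoin_col v (P ** U))\<^sup>\<dagger> ** adjoin_col v (P ** U) = mat 1"
  proof -
    have "((adjoin_col v B)\<^sup>\<dagger> ** adjoin_col v B) $ k $ l = mat 1 $ k $ l" for k l
      by (cases k; cases l) (simp_all add: matrix_matrix_mult_def hconj_def adjoin_col_def mat_def vv Bv vB' BB')
    then show ?thesis by (simp add: B_def vec_eq_iff)
  qed
qed

lemma unitary_diag_entry:
  fixes V :: "complex^'n::finite^'n"
  shows "(V ** diag_mat d ** V\<^sup>\<dagger>) $ p $ q = (\<Sum>k\<in>UNIV. of_real (d k) * V $ p $ k * cnj (V $ q $ k))"
  unfolding rot_conj_entry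
  by (rule sum.cong[OF refl])
     (simp add: diag_mat_def if_distrib[of "\<lambda>x. _ * x"] if_distrib[of "\<lambda>x. x * _"] cong: if_cong)

lemma unitary_entry_le:
  fixes V :: "complex^'n::finite^'n"
  assumes "V \<in> unitary_group"
  shows "cmod (V $ p $ q) \<le> 1"
proof -
  have "cmod (V $ p $ q) = cmod ((V *v axis q 1) $ p)"
    by (simp only: matrix_vector_axis)
  also have "\<dots> \<le> norm (V *v axis q 1)" by (rule Finite_Cartesian_Product.norm_nth_le)
  also have "\<dots> = 1"
  proof -
    have "of_real ((norm (axis q 1 :: complex^'n))\<^sup>2) = (1 :: complex)"
      unfolding hprod_self[symmetric]
      by (simp add: hprod_def axis_def if_distrib[of cnj] if_distrib[of "\<lambda>x. x * _"] cong: if_cong)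
    then have "(norm (axis q 1 :: complex^'n))\<^sup>2 = 1" by (simp only: of_real_eq_1_iff)
    then show ?thesis by (simp add: unitary_norm[OF assms] power2_eq_1_iff)
  qed
  finally show ?thesis .
qed

lemma norm_matrix_le:
  fixes A :: "complex^'n::finite^'m::finite"
  assumes "\<And>p q. cmod (A $ p $ q) \<le> c"
  shows "norm A \<le> real CARD('m) * (real CARD('n) * c)"
proof -
  have "norm A \<le> (\<Sum>p\<in>UNIV. norm (A $ p))"
    unfolding norm_vec_def by (rule L2_set_le_sum) simp
  also have "\<dots> \<le> (\<Sum>p\<in>(UNIV::'m set). real CARD('n) * c)"
  proof (rule sum_mono)
    fix p
    have "norm (A $ p) \<le> (\<Sum>q\<in>UNIV. norm (A $ p $ q))"
      unfolding norm_vec_def[of "A $ p"] by (rule L2_set_le_sum) simp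
    also have "\<dots> \<le> (\<Sum>q\<in>(UNIV::'n set). c)" by (rule sum_mono) (rule assms)
    finally show "norm (A $ p) \<le> real CARD('n) * c" by simp
  qed
  finally show ?thesis by simp
qed

text \<open>Left multiplication of \<open>V\<close> by \<open>W\<close> is conjugation of the
  Hermitian matrix by \<open>W\<close>. The lemma serves both for Haar measure on
  \<open>U(n)\<close> and for the frames on \<open>U(n + 1)\<close>.\<close>

lemma conj_invariant_spectrum_unitary:
  fixes M :: "'w measure" and V :: "'w \<Rightarrow> complex^'n::finite^'n"
  assumes M: "prob_space M" and Vm: "V \<in> borel_measurable M"
    and V: "\<And>w. w \<in> space M \<Longrightarrow> V w \<in> unitary_group" and d: "inj d"
    and inv: "\<And>W f. W \<in> unitary_group \<Longrightarrow> continuous_on UNIV f \<Longrightarrow>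
       (LINT w|M. f (W ** V w) :: complex) = (LINT w|M. f (V w))"
  shows "conj_invariant_spectrum M (\<lambda>w. V w ** diag_mat d ** (V w)\<^sup>\<dagger>) d"
proof -
  interpret prob_space M by (rule M)
  have c: "continuous_on UNIV (\<lambda>A :: complex^'n^'n. A ** diag_mat d ** A\<^sup>\<dagger>)"
    by (rule continuous_on_matrixI) (unfold unitary_diag_entry, intro continuous_intros)
  have det_diag: "det (V w ** diag_mat d ** (V w)\<^sup>\<dagger> - d j *\<^sub>R mat 1) = 0" if w: "w \<in> space M" for w j
  proof -
    have "V w ** (diag_mat d - d j *\<^sub>R mat 1) ** (V w)\<^sup>\<dagger> = V w ** diag_mat d ** (V w)\<^sup>\<dagger> - d j *\<^sub>R mat 1"
      using V[OF w] by (simp add: unitary_group_def diff_conv_add_uminus matrix_add_ldistrib matrix_add_rdistrib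
        matrix_minus_left matrix_minus_right matrix_scaleR_left matrix_scaleR_right del: add_uminus_conv_diff)
    moreover have "det (diag_mat d - d j *\<^sub>R mat 1 :: complex^'n^'n) = 0"
      by (rule det_zero_row[of j]) (auto simp: row_def vec_eq_iff diag_mat_def mat_def scaleR_conv_of_real[where 'a=complex])
    ultimately show ?thesis by (metis det_mul mult_zero_left mult_zero_right)
  qed
  show ?thesis
  proof
    show "(\<lambda>w. V w ** diag_mat d ** (V w)\<^sup>\<dagger>) \<in> borel_measurable M"
      using measurable_compose[OF Vm borel_measurable_continuous_onI[OF c]] by simp
    have "cmod ((V w ** diag_mat d ** (V w)\<^sup>\<dagger>) $ p $ q) \<le> (\<Sum>k\<in>UNIV. \<bar>d k\<bar>)" if w: "w \<in> space M" for w p q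
    proof -
      have "cmod (of_real (d k) * V w $ p $ k * cnj (V w $ q $ k)) \<le> \<bar>d k\<bar>" for k
        using mult_le_one[OF unitary_entry_le[OF V[OF w], of p k] norm_ge_zero unitary_entry_le[OF V[OF w], of q k]]
        by (simp add: norm_mult mult_left_le mult.assoc)
      then show ?thesis unfolding unitary_diag_entry by (intro sum_norm_le)
    qed
    then show "\<exists>R. \<forall>w\<in>space M. norm (V w ** diag_mat d ** (V w)\<^sup>\<dagger>) \<le> R"
      by (intro exI[of _ "real CARD('n) * (real CARD('n) * (\<Sum>k\<in>UNIV. \<bar>d k\<bar>))"] ballI norm_matrix_le)
    fix W :: "complex^'n^'n" and f :: "complex^'n^'n \<Rightarrow> complex"
    assume W: "W \<in> unitary_group" and f: "continuous_on UNIV f"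
    have "continuous_on UNIV (\<lambda>A. f (A ** diag_mat d ** A\<^sup>\<dagger>))"
      by (rule continuous_on_compose2[OF f c]) simp
    from inv[OF W this]
    show "(LINT w|M. f (W ** (V w ** diag_mat d ** (V w)\<^sup>\<dagger>) ** W\<^sup>\<dagger>)) = (LINT w|M. f (V w ** diag_mat d ** (V w)\<^sup>\<dagger>))"
      by (simp add: hconj_mult matrix_mul_assoc)
  next
    fix w assume w: "w \<in> space M"
    have "trace (V w ** diag_mat d ** (V w)\<^sup>\<dagger>) = trace ((V w)\<^sup>\<dagger> ** (V w ** diag_mat d))"
      by (rule trace_mul_sym)
    also have "\<dots> = trace (diag_mat d :: complex^'n^'n)"
      using V[OF w] by (simp add: matrix_mul_assoc unitary_group_def)
    also have "\<dots> = of_real (\<Sum>j\<in>UNIV. d j)" by (simp add: trace_def diag_mat_def)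
    finally show "trace (V w ** diag_mat d ** (V w)\<^sup>\<dagger>) = of_real (\<Sum>j\<in>UNIV. d j)" .
  qed (use d det_diag in auto)
qed

section \<open>Haar measure and the associated random Hermitian matrix\<close>

lemma continuous_on_mult_left: "continuous_on S (\<lambda>U :: complex^'n^'m. V ** U)"
  by (intro continuous_on_matrix_mult continuous_intros)

context
  fixes haar :: "(complex^'n::finite^'n) measure"
  assumes haar: "is_unitary_haar haar"
begin

lemma haar_prob: "prob_space haar"
  and haar_sets: "sets haar = sets (restrict_space borel unitary_group)"
  and haar_distr: "\<And>V. V \<in> unitary_group \<Longrightarrow> distr haar haar (\<lambda>U. V ** U) = haar"
  using haar unfolding is_unitary_haar_def by blast+

lemma haar_space: "space haar = unitary_group"
  using sets_eq_imp_space_eq[OF haar_sets] by (simp add: space_restrict_space)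

lemma haar_measurable: "f \<in> borel_measurable borel \<Longrightarrow> f \<in> borel_measurable haar"
  unfolding measurable_cong_sets[OF haar_sets refl] by (rule measurable_restrict_space1)

lemma haar_mult_measurable:
  assumes "V \<in> unitary_group"
  shows "(\<lambda>U. V ** U) \<in> measurable haar haar"
proof -
  have "(\<lambda>U. V ** U) \<in> measurable (restrict_space borel unitary_group) (restrict_space borel unitary_group)"
    by (rule measurable_restrict_space3)
       (auto intro!: borel_measurable_continuous_onI continuous_on_mult_left unitary_mult assms)
  then show ?thesis unfolding measurable_cong_sets[OF haar_sets haar_sets] .
qed

lemma haar_integral_mult:
  fixes f :: "complex^'n^'n \<Rightarrow> complex"
  assumes "V \<in> unitary_group" "f \<in> borel_measurable borel"
  shows "(LINT U|haar. f (V ** U)) = (LINT U|haar. f U)"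
proof -
  have "(LINT U|haar. f U) = (LINT U|distr haar haar (\<lambda>U. V ** U). f U)"
    by (simp only: haar_distr[OF assms(1)])
  also have "\<dots> = (LINT U|haar. f (V ** U))"
    by (rule integral_distr[OF haar_mult_measurable[OF assms(1)] haar_measurable[OF assms(2)]])
  finally show ?thesis ..
qed

lemma haar_spectrum:
  assumes "inj x"
  shows "conj_invariant_spectrum haar (\<lambda>U. U ** diag_mat x ** U\<^sup>\<dagger>) x"
proof (rule conj_invariant_spectrum_unitary[OF haar_prob, where V="\<lambda>U. U"])
  show "(\<lambda>U. U) \<in> borel_measurable haar" by (rule haar_measurable) simp
  fix W :: "complex^'n^'n" and f :: "complex^'n^'n \<Rightarrow> complex"
  assume "W \<in> unitary_group" "continuous_on UNIV f"
  then show "(LINT w|haar. f (W ** w)) = (LINT w|haar. f w)"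
    by (intro haar_integral_mult borel_measurable_continuous_onI)
qed (use assms in \<open>auto simp: haar_space\<close>)

end

lemma linear_matrix_vector: "linear (\<lambda>v :: complex^'n. W *v v)"
  by (rule linearI) (simp_all add: matrix_vector_right_distrib matrix_vector_mult_def vec_eq_iff scaleR_sum_right
      distrib_left sum.distrib)

lemma sphere_integral_unitary:
  fixes f :: "complex^'n::finite \<Rightarrow> complex"
  assumes "W \<in> unitary_group" "f \<in> borel_measurable sphere_measure"
  shows "(LINT v|sphere_measure. f (W *v v)) = (LINT v|sphere_measure. f v)"
proof -
  note T = sphere_measure_distr_isometry[OF linear_matrix_vector unitary_norm[OF assms(1)]]
  have "(LINT v|sphere_measure. f v) = (LINT v|distr sphere_measure sphere_measure (\<lambda>v. W *v v). f v)"
    by (simp only: T(2))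
  also have "\<dots> = (LINT v|sphere_measure. f (W *v v))"
    by (rule integral_distr[OF T(1) assms(2)])
  finally show ?thesis ..
qed

lemma unitary_compact: "compact (unitary_group :: (complex^'m::finite^'m) set)"
proof -
  have "(unitary_group :: (complex^'m^'m) set) = {U. U\<^sup>\<dagger> ** U = mat 1} \<inter> {U. U ** U\<^sup>\<dagger> = mat 1}"
    by (auto simp: unitary_group_def)
  moreover have "continuous_on UNIV (hconj :: complex^'m^'m \<Rightarrow> _)"
    by (rule continuous_on_matrixI) (simp add: hconj_def, intro continuous_intros)
  then have "closed {U :: complex^'m^'m. U\<^sup>\<dagger> ** U = mat 1}" "closed {U :: complex^'m^'m. U ** U\<^sup>\<dagger> = mat 1}"
    by (auto intro!: closed_Collect_eq continuous_on_matrix_mult continuous_intros)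
  moreover have "bounded (unitary_group :: (complex^'m^'m) set)"
    unfolding bounded_iff using norm_matrix_le[OF unitary_entry_le] by blast
  ultimately show ?thesis by (metis (no_types, lifting) closed_Int compact_eq_bounded_closed)
qed

section \<open>The invariant law on \<open>U(n + 1)\<close> built from the sphere and
  \<open>U(n)\<close>\<close>

definition col_frame ::
  "(complex^'n option \<Rightarrow> complex^'n^'n option) \<Rightarrow> (complex^'n option) \<times> (complex^'n^'n::finite) \<Rightarrow> complex^'n option^'n option" where
  "col_frame P w = adjoin_col (fst w) (P (fst w) ** snd w)"

context
  fixes haar :: "(complex^'n::finite^'n) measure"
    and P :: "complex^'n option \<Rightarrow> complex^'n^'n option"
  assumes haar: "is_unitary_haar haar"
    and P: "\<And>v. norm v = 1 \<Longrightarrow> isometry_onto_perp v (P v)"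
    and P_measurable: "P \<in> borel_measurable (restrict_space borel (sphere 0 1))"
begin

interpretation H: prob_space haar by (rule haar_prob[OF haar])
interpretation S: prob_space "sphere_measure :: (complex^'n option) measure" by (rule sphere_measure_prob)
interpretation SH: pair_prob_space "sphere_measure :: (complex^'n option) measure" haar ..

lemma sphere_haar_prob: "prob_space ((sphere_measure :: (complex^'n option) measure) \<Otimes>\<^sub>M haar)"
  by (rule SH.P.prob_space_axioms)

lemma P_measurable': "P \<in> borel_measurable sphere_measure"
  using P_measurable unfolding measurable_cong_sets[OF sphere_measure_basics(1) refl] .

lemma col_frame_measurable: "col_frame P \<in> borel_measurable (sphere_measure \<Otimes>\<^sub>M haar)"
proof -
  let ?h = "\<lambda>z. adjoin_col (fst z) (fst (snd z) ** snd (snd z)) :: complex^'n option^'n option"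
  have "continuous_on UNIV ?h"
  proof (rule continuous_on_matrixI)
    fix p q
    show "continuous_on UNIV (\<lambda>z. ?h z $ p $ q)"
      by (cases q) (auto simp: adjoin_col_def intro!: continuous_intros continuous_on_matrix_mult)
  qed
  then have h: "?h \<in> borel_measurable borel" by (rule borel_measurable_continuous_onI)
  have "(\<lambda>v. v) \<in> borel_measurable (sphere_measure :: (complex^'n option) measure)"
    unfolding measurable_cong_sets[OF sphere_measure_basics(1) refl] by (rule measurable_restrict_space1) simp
  then have "(\<lambda>w. (fst w, P (fst w), snd w)) \<in> borel_measurable (sphere_measure \<Otimes>\<^sub>M haar)"
    by (intro borel_measurable_Pair measurable_compose[OF measurable_fst] measurable_compose[OF measurable_snd]
        P_measurable' haar_measurable[OF haar]) auto
  from measurable_compose[OF this h] show ?thesis by (simp add: col_frame_def[abs_def])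
qed

lemma col_frame_unitary: "norm v = 1 \<Longrightarrow> U \<in> unitary_group \<Longrightarrow> col_frame P (v, U) \<in> unitary_group"
  unfolding col_frame_def by (simp add: adjoin_col_unitary P)

lemma col_frame_integrable:
  assumes f: "continuous_on UNIV (f :: complex^'n option^'n option \<Rightarrow> complex)"
  shows "integrable (sphere_measure \<Otimes>\<^sub>M haar) (\<lambda>w. f (col_frame P w))"
proof -
  have "compact (f ` unitary_group)"
    by (intro compact_continuous_image unitary_compact continuous_on_subset[OF f]) auto
  then obtain B where B: "\<And>A. A \<in> unitary_group \<Longrightarrow> norm (f A) \<le> B"
    by (force dest!: compact_imp_bounded simp: bounded_iff)
  show ?thesis
  proof (rule SH.P.integrable_const_bound[of _ B])
    show "AE w in sphere_measure \<Otimes>\<^sub>M haar. norm (f (col_frame P w)) \<le> B"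
      by (intro AE_I2 B) (auto simp: space_pair_measure sphere_measure_basics haar_space[OF haar] col_frame_unitary)
    show "(\<lambda>w. f (col_frame P w)) \<in> borel_measurable (sphere_measure \<Otimes>\<^sub>M haar)"
      by (rule measurable_compose[OF col_frame_measurable borel_measurable_continuous_onI[OF f]])
  qed
qed

lemma col_frame_fubini:
  assumes f: "continuous_on UNIV (f :: complex^'n option^'n option \<Rightarrow> complex)"
  shows "(LINT w|(sphere_measure \<Otimes>\<^sub>M haar). f (col_frame P w)) = (LINT v|sphere_measure. LINT U|haar. f (col_frame P (v, U)))"
    "(\<lambda>v. LINT U|haar. f (col_frame P (v, U))) \<in> borel_measurable sphere_measure"
    "integrable sphere_measure (\<lambda>v. LINT U|haar. f (col_frame P (v, U)))"
proof -
  note i = col_frame_integrable[OF f]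
  show "(LINT w|(sphere_measure \<Otimes>\<^sub>M haar). f (col_frame P w)) = (LINT v|sphere_measure. LINT U|haar. f (col_frame P (v, U)))"
    by (rule SH.integral_fst'[OF i, symmetric])
  show "integrable sphere_measure (\<lambda>v. LINT U|haar. f (col_frame P (v, U)))"
    by (rule SH.integrable_fst'[OF i])
  then show "(\<lambda>v. LINT U|haar. f (col_frame P (v, U))) \<in> borel_measurable sphere_measure"
    by (rule borel_measurable_integrable)
qed

text \<open>Left multiplication by \<open>W\<close> sends the frame of \<open>(v, U)\<close> to that
  of \<open>(W *v v, Q ** U)\<close> with a unitary \<open>Q\<close>. Haar invariance absorbs
  \<open>Q\<close>, and invariance of the sphere measure absorbs \<open>W\<close>.\<close>

lemma sphere_haar_spectrum:
  assumes d: "inj d"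
  shows "conj_invariant_spectrum (sphere_measure \<Otimes>\<^sub>M haar)
    (\<lambda>w. col_frame P w ** diag_mat d ** (col_frame P w)\<^sup>\<dagger>) d"
proof (rule conj_invariant_spectrum_unitary[OF sphere_haar_prob col_frame_measurable _ d])
  show "w \<in> space (sphere_measure \<Otimes>\<^sub>M haar) \<Longrightarrow> col_frame P w \<in> unitary_group" for w
    by (cases w) (auto simp: space_pair_measure sphere_measure_basics haar_space[OF haar] col_frame_unitary)
  fix W :: "complex^'n option^'n option" and f :: "complex^'n option^'n option \<Rightarrow> complex"
  assume W: "W \<in> unitary_group" and f: "continuous_on UNIV f"
  define F where "F v = (LINT U|haar. f (col_frame P (v, U)))" for v
  have fW: "continuous_on UNIV (\<lambda>A. f (W ** A))"
    by (rule continuous_on_compose2[OF f continuous_on_mult_left]) simp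
  have "(LINT U|haar. f (W ** col_frame P (v, U))) = F (W *v v)" if v: "norm v = 1" for v
  proof -
    \<comment> \<open>\<open>Q\<close> depends on \<open>v\<close>, but no measurable choice has to
      be made: it disappears in the inner integral, at fixed \<open>v\<close>.\<close>
    obtain Q where Q: "Q \<in> unitary_group" "W ** P v = P (W *v v) ** Q"
      using isometry_onto_perp_transport[OF P[OF v] P W] unitary_norm[OF W] v by auto
    have "W ** col_frame P (v, U) = col_frame P (W *v v, Q ** U)" for U
      by (simp add: col_frame_def mult_adjoin_col matrix_mul_assoc Q(2))
    moreover have "(\<lambda>U. f (col_frame P (W *v v, U))) \<in> borel_measurable borel"
    proof -
      have "continuous_on UNIV (\<lambda>U. col_frame P (W *v v, U))"
      proof (rule continuous_on_matrixI)
        fix p q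
        show "continuous_on UNIV (\<lambda>U. col_frame P (W *v v, U) $ p $ q)"
          by (cases q) (auto simp: col_frame_def adjoin_col_def intro!: continuous_intros continuous_on_matrix_mult)
      qed
      then show ?thesis
        by (intro borel_measurable_continuous_onI continuous_on_compose2[OF f]) auto
    qed
    ultimately show ?thesis
      using haar_integral_mult[OF haar Q(1), of "\<lambda>U. f (col_frame P (W *v v, U))"] by (simp add: F_def)
  qed
  then have "(LINT v|sphere_measure. LINT U|haar. f (W ** col_frame P (v, U))) = (LINT v|sphere_measure. F (W *v v))"
    by (intro Bochner_Integration.integral_cong) (auto simp: sphere_measure_basics)
  also have "\<dots> = (LINT v|sphere_measure. F v)"
    unfolding F_def by (rule sphere_integral_unitary[OF W col_frame_fubini(2)[OF f]])
  finally show "(LINT w|(sphere_measure \<Otimes>\<^sub>M haar). f (W ** col_frame P w)) = (LINT w|(sphere_measure \<Otimes>\<^sub>M haar). f (col_frame P w))"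
    by (simp only: col_frame_fubini(1)[OF f] col_frame_fubini(1)[OF fW] F_def)
qed

end

subsection \<open>Passing from dimension \<open>n\<close> to \<open>n + 1\<close>\<close>

text \<open>The unit row leaves only permutations that fix \<open>None\<close>; these correspond to
  permutations of \<open>'n\<close> with the same sign.\<close>

lemma mdet_option:
  fixes g :: "'n::finite option \<Rightarrow> 'n option \<Rightarrow> complex"
  assumes "g None = unit_row None"
  shows "mdet g = mdet (\<lambda>p q. g (Some p) (Some q))"
proof -
  let ?S = "range (Some :: 'n \<Rightarrow> _)"
  let ?t = "\<lambda>\<sigma>. of_int (sign \<sigma>) * (\<Prod>p\<in>UNIV. g p (\<sigma> p))"
  have S: "?S = UNIV - {None}" by (auto simp: image_iff)
  have bS: "bij_betw Some (UNIV :: 'n set) ?S" by (simp add: bij_betw_def)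
  have bT: "bij_betw the ?S (UNIV :: 'n set)" by (rule bij_betwI[where g=Some]) auto
  have "mdet g = (\<Sum>\<sigma> | \<sigma> permutes ?S. ?t \<sigma>)"
    unfolding mdet_perm
  proof (rule sum.mono_neutral_right)
    show "{\<sigma>. \<sigma> permutes ?S} \<subseteq> {\<sigma>. \<sigma> permutes UNIV}"
      by (auto intro: permutes_subset)
    show "\<forall>\<sigma>\<in>{\<sigma>. \<sigma> permutes UNIV} - {\<sigma>. \<sigma> permutes ?S}. ?t \<sigma> = 0"
    proof
      fix \<sigma> :: "'n option \<Rightarrow> 'n option" assume \<sigma>: "\<sigma> \<in> {\<sigma>. \<sigma> permutes UNIV} - {\<sigma>. \<sigma> permutes ?S}"
      have "\<sigma> None \<noteq> None"
      proof
        assume "\<sigma> None = None"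
        then have "\<sigma> permutes ?S"
          using \<sigma> permutes_superset[of \<sigma> UNIV ?S] by (auto simp: S)
        with \<sigma> show False by simp
      qed
      then have "g None (\<sigma> None) = 0" by (metis assms unit_row_def)
      then show "?t \<sigma> = 0" by (metis (no_types, lifting) UNIV_I finite mult_zero_right prod_zero)
    qed
  qed simp
  also have "\<dots> = (\<Sum>\<sigma> | \<sigma> permutes UNIV. of_int (sign \<sigma>) * (\<Prod>p\<in>UNIV. g (Some p) (Some (\<sigma> p))))"
  proof (rule sum.reindex_bij_witness[of _ "map_permutation UNIV Some" "map_permutation ?S the"])
    fix \<sigma> assume "\<sigma> \<in> {\<sigma>. \<sigma> permutes ?S}"
    then have \<sigma>: "\<sigma> permutes ?S" by simp
    show 1: "map_permutation UNIV Some (map_permutation ?S the \<sigma>) = \<sigma>"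
      by (rule map_permutation_compose_inv[OF bT \<sigma>]) auto
    show "map_permutation ?S the \<sigma> \<in> {\<sigma>. \<sigma> permutes UNIV}"
      using map_permutation_permutes[OF bT \<sigma>] by simp
    have "sign (map_permutation ?S the \<sigma>) = sign \<sigma>"
      by (rule sign_map_permutation) (use \<sigma> bT in \<open>auto simp: bij_betw_def\<close>)
    moreover have "Some (map_permutation ?S the \<sigma> p) = \<sigma> (Some p)" for p
    proof -
      have "\<sigma> (Some p) \<in> ?S" using permutes_in_image[OF \<sigma>, of "Some p"] by simp
      moreover have "map_permutation ?S the \<sigma> (the (Some p)) = the (\<sigma> (Some p))"
        by (rule map_permutation_apply) (use bT in \<open>auto simp: bij_betw_def\<close>)
      ultimately show ?thesis by auto
    qed
    moreover have "\<sigma> None = None" using \<sigma> by (rule permutes_not_in) (auto simp: S)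
    ultimately show "of_int (sign (map_permutation ?S the \<sigma>)) *
        (\<Prod>p\<in>UNIV. g (Some p) (Some (map_permutation ?S the \<sigma> p))) = ?t \<sigma>"
      by (simp add: prod_option assms unit_row_def)
  next
    fix \<sigma> assume "\<sigma> \<in> {\<sigma>. \<sigma> permutes (UNIV :: 'n set)}"
    then have \<sigma>: "\<sigma> permutes UNIV" by simp
    show "map_permutation ?S the (map_permutation UNIV Some \<sigma>) = \<sigma>"
      by (rule map_permutation_compose_inv[OF bS \<sigma>]) auto
    show "map_permutation UNIV Some \<sigma> \<in> {\<sigma>. \<sigma> permutes ?S}"
      using map_permutation_permutes[OF bS \<sigma>] by simp
  qed
  finally show ?thesis by (simp add: mdet_perm)
qed

text \<open>Subtracting from row \<open>None\<close> the combination of the other rows with weights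
  \<open>l\<close> clears it except for the entry in column \<open>None\<close>, because
  \<open>l\<close> reproduces the exponentials with exponents \<open>x k\<close>. The surviving
  entry is the interpolation error of the exponential with exponent \<open>s\<close>.\<close>

lemma exp_det_adjoin:
  fixes x :: "'n::finite \<Rightarrow> real"
  assumes l: "\<And>k. exp (x k * x0) = (\<Sum>m\<in>UNIV. l m * exp (x k * x m))"
  shows "exp_det (case_option s x) (case_option x0 x) =
    of_real (exp (s * x0) - (\<Sum>m\<in>UNIV. l m * exp (s * x m))) * exp_det x x"
proof -
  let ?s = "case_option s x" and ?b = "case_option x0 x"
  define f :: "'n option \<Rightarrow> 'n option \<Rightarrow> complex" where "f p q = of_real (exp (?s q * ?b p))" for p q
  define E where "E = exp (s * x0) - (\<Sum>m\<in>UNIV. l m * exp (s * x m))"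
  have row: "(\<lambda>q. 1 * f None q + (- 1) * (\<Sum>m\<in>UNIV. of_real (l m) * f (Some m) q)) = (\<lambda>q. of_real E * unit_row None q)"
  proof
    fix q
    show "1 * f None q + (- 1) * (\<Sum>m\<in>UNIV. of_real (l m) * f (Some m) q) = of_real E * unit_row None q"
      by (cases q) (simp_all add: f_def E_def unit_row_def l)
  qed
  have "mdet (f(None := f (Some m))) = 0" for m
    by (rule mdet_eq_rows[of None "Some m"]) auto
  then have "mdet (f(None := \<lambda>q. 1 * f None q + (- 1) * (\<Sum>m\<in>UNIV. of_real (l m) * f (Some m) q))) = mdet f"
    unfolding mdet_row_linear by (simp add: mdet_row_sum)
  then have "mdet f = mdet (f(None := \<lambda>q. of_real E * unit_row None q + 0 * unit_row None q))"
    by (simp only: row mult_zero_left add_0_right)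
  also have "\<dots> = of_real E * mdet (f(None := unit_row None))"
    by (subst mdet_row_linear) simp
  also have "mdet (f(None := unit_row None)) = mdet (\<lambda>p q. f (Some p) (Some q))"
    by (subst mdet_option) auto
  finally show ?thesis by (simp add: exp_det_def f_def E_def)
qed

section \<open>Vandermonde determinants and weights with one extra index\<close>

definition option_enum :: "('n \<Rightarrow> nat) \<Rightarrow> 'n option \<Rightarrow> nat" where
  "option_enum r p = (case p of None \<Rightarrow> 0 | Some k \<Rightarrow> Suc (r k))"

lemma option_enum_bij:
  fixes r :: "'n::finite \<Rightarrow> nat"
  assumes "bij_betw r UNIV {..<CARD('n)}"
  shows "bij_betw (option_enum r) UNIV {..<CARD('n option)}"
proof (rule bij_betwI')
  fix p q :: "'n option"
  show "(option_enum r p = option_enum r q) = (p = q)"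
    using assms by (auto simp: option_enum_def bij_betw_def inj_on_def split: option.splits)
  show "option_enum r p \<in> {..<CARD('n option)}"
    using assms by (auto simp: option_enum_def bij_betw_def split: option.splits)
next
  fix m assume "m \<in> {..<CARD('n option)}"
  then have m: "m < Suc CARD('n)" by simp
  show "\<exists>p\<in>UNIV. m = option_enum r p"
  proof (cases m)
    case 0
    then show ?thesis by (auto intro!: exI[of _ None] simp: option_enum_def)
  next
    case (Suc l)
    then have "l \<in> range r" using assms m by (auto simp: bij_betw_def)
    then obtain k where "l = r k" by auto
    then show ?thesis using Suc by (auto intro!: exI[of _ "Some k"] simp: option_enum_def)
  qed
qed

lemma vand_option:
  fixes r :: "'n::finite \<Rightarrow> nat"
  assumes r: "bij_betw r UNIV {..<CARD('n)}"
  shows "vand (option_enum r) CARD('n option) a = (\<Prod>k\<in>UNIV. a (Some k) - a None) * vand r CARD('n) (\<lambda>k. a (Some k))"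
proof -
  note r' = option_enum_bij[OF r]
  have lt: "{q. r q < CARD('n)} = UNIV" "{q. option_enum r q < CARD('n option)} = UNIV"
    using r r' by (auto simp: bij_betw_def simp del: card_option)
  have S: "{p. option_enum r p < option_enum r (Some k)} = insert None (Some ` {p. r p < r k})" for k
  proof (rule set_eqI)
    fix p show "p \<in> {p. option_enum r p < option_enum r (Some k)} \<longleftrightarrow> p \<in> insert None (Some ` {p. r p < r k})"
      by (cases p) (auto simp: option_enum_def)
  qed
  have N: "{p. option_enum r p < option_enum r None} = {}"
    by (auto simp: option_enum_def)
  show ?thesis
    unfolding vand_prod[OF r order_refl] vand_prod[OF r' order_refl] lt prod_option S N
    by (simp add: prod.reindex prod.distrib)
qed

text \<open>The new point \<open>0\<close> contributes its differences to \<open>1, ..., n\<close>;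
  this is the source of \<open>n!\<close> in the error formula.\<close>

lemma vand_option_enum:
  fixes r :: "'n::finite \<Rightarrow> nat"
  assumes r: "bij_betw r UNIV {..<CARD('n)}"
  shows "vand (option_enum r) CARD('n option) (\<lambda>p. of_nat (option_enum r p)) =
    fact CARD('n) * vand r CARD('n) (\<lambda>p. of_nat (r p))"
proof -
  have "(\<Prod>k\<in>UNIV. of_nat (Suc (r k))) = (\<Prod>m<CARD('n). of_nat (Suc m) :: complex)"
    by (rule prod.reindex_bij_betw[OF r])
  also have "\<dots> = fact CARD('n)"
    by (simp add: fact_prod_Suc atLeast0LessThan)
  finally have "(\<Prod>k\<in>UNIV. of_nat (Suc (r k))) = (fact CARD('n) :: complex)" .
  then show ?thesis
    unfolding vand_option[OF r] by (simp add: option_enum_def vand_prod[OF r order_refl] del: of_nat_Suc) (simp add: of_nat_Suc)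
qed

lemma trace_diag_mult: "trace (diag_mat d ** A) = (\<Sum>p\<in>UNIV. of_real (d p) * (A :: complex^'n::finite^'n) $ p $ p)"
  by (simp add: trace_def matrix_matrix_mult_def diag_mat_def if_distrib[of "\<lambda>x. x * _"] cong: if_cong)

lemma diag_mat_vec: "(diag_mat d *v v) $ p = of_real (d p) * (v :: complex^'n::finite) $ p"
  by (simp add: matrix_vector_mult_def diag_mat_def if_distrib[of "\<lambda>x. x * _"] cong: if_cong)

lemma wt_unitary:
  "wt b (U ** diag_mat x ** U\<^sup>\<dagger>) = exp (trace (diag_mat x ** U\<^sup>\<dagger> ** diag_mat b ** U))"
proof -
  have "trace (diag_mat x ** U\<^sup>\<dagger> ** diag_mat b ** U) = trace (U ** (diag_mat x ** (U\<^sup>\<dagger> ** diag_mat b)))"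
    by (subst trace_mul_sym) (simp add: matrix_mul_assoc)
  also have "\<dots> = trace (diag_mat b ** (U ** diag_mat x ** U\<^sup>\<dagger>))"
    by (subst trace_mul_sym[of "diag_mat b"]) (simp add: matrix_mul_assoc)
  finally show ?thesis by (simp add: trace_diag_mult wt_def)
qed

text \<open>The diagonal of the conjugated real diagonal matrix is real, so the weight is a positive
  number. This is what later keeps \<open>unitary_Z\<close> away from zero.\<close>

lemma wt_real: 
  fixes U :: "complex^'n::finite^'n"
  shows "\<exists>c. wt b (U ** diag_mat x ** U\<^sup>\<dagger>) = of_real (exp c)"
proof -
  have "of_real (b p) * (U ** diag_mat x ** U\<^sup>\<dagger>) $ p $ p =
      of_real (b p * (\<Sum>k\<in>UNIV. x k * (cmod (U $ p $ k))\<^sup>2))" for p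
    unfolding unitary_diag_entry by (simp only: of_real_mult of_real_sum complex_norm_square mult.assoc)
  then have "wt b (U ** diag_mat x ** U\<^sup>\<dagger>) = of_real (exp (\<Sum>p\<in>UNIV. b p * (\<Sum>k\<in>UNIV. x k * (cmod (U $ p $ k))\<^sup>2)))"
    unfolding wt_def by (simp only: exp_of_real of_real_sum[symmetric])
  then show ?thesis ..
qed

text \<open>The conjugated diagonal matrix is a sum over columns. The adjoined column contributes
  the Rayleigh quotient of \<open>v\<close>, the others the trace of a compression.\<close>

lemma wt_adjoin_col:
  fixes A :: "complex^'n::finite^'n option"
  shows "wt b (adjoin_col v A ** diag_mat (case_option s x) ** (adjoin_col v A)\<^sup>\<dagger>) =
    exp (trace (diag_mat x ** A\<^sup>\<dagger> ** diag_mat b ** A)) * exp (of_real s * hprod v (diag_mat b *v v))"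
proof -
  have 1: "hprod v (diag_mat b *v v) = (\<Sum>p\<in>UNIV. of_real (b p) * (v $ p * cnj (v $ p)))"
    by (simp add: hprod_def diag_mat_vec mult_ac)
  have "trace (diag_mat x ** A\<^sup>\<dagger> ** diag_mat b ** A) = trace (diag_mat x ** (A\<^sup>\<dagger> ** diag_mat b ** A))"
    by (simp add: matrix_mul_assoc)
  also have "\<dots> = (\<Sum>k\<in>UNIV. of_real (x k) * (A\<^sup>\<dagger> ** diag_mat b ** A) $ k $ k)"
    by (rule trace_diag_mult)
  also have "(\<lambda>k. (A\<^sup>\<dagger> ** diag_mat b ** A) $ k $ k) = (\<lambda>k. \<Sum>p\<in>UNIV. of_real (b p) * (A $ p $ k * cnj (A $ p $ k)))"
    by (simp add: fun_eq_iff matrix_matrix_mult_def diag_mat_def hconj_def if_distrib[of "\<lambda>x. _ * x"] mult_ac cong: if_cong)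
  also have "(\<Sum>k\<in>UNIV. of_real (x k) * (\<Sum>p\<in>UNIV. of_real (b p) * (A $ p $ k * cnj (A $ p $ k)))) =
      (\<Sum>p\<in>UNIV. of_real (b p) * (\<Sum>k\<in>UNIV. of_real (x k) * A $ p $ k * cnj (A $ p $ k)))"
    by (simp add: sum_distrib_left, subst sum.swap) (simp add: mult_ac)
  finally have 2: "trace (diag_mat x ** A\<^sup>\<dagger> ** diag_mat b ** A) =
      (\<Sum>p\<in>UNIV. of_real (b p) * (\<Sum>k\<in>UNIV. of_real (x k) * A $ p $ k * cnj (A $ p $ k)))" .
  show ?thesis
    unfolding wt_def unitary_diag_entry exp_add[symmetric] 1 2 sum_option[where f="\<lambda>k. of_real (case_option s x k) * _ k * _ k"]
    by (rule arg_cong[where f=exp])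
       (simp add: adjoin_col_def sum_option[where f="\<lambda>k. of_real (case_option s x k) * (case k of None \<Rightarrow> _ | Some k \<Rightarrow> _ k) * _ k"]
         sum.distrib[symmetric] sum_distrib_left algebra_simps)
qed

subsection \<open>The differential operator on an interval\<close>

lemma Cn_on_0: "Cn_on 0 K f \<longleftrightarrow> continuous_on K f"
  by (simp add: Cn_on_def)

lemma Cn_on_Suc: "Cn_on (Suc n) K f \<longleftrightarrow> f differentiable_on K \<and> Cn_on n K (deriv_within K f)"
  unfolding Cn_on_def funpow_Suc_right o_def All_less_Suc2 by (auto simp: funpow_swap1 simp del: funpow.simps(2))

context
  fixes \<alpha> \<beta> :: real and K
  assumes ab: "\<alpha> < \<beta>" and K: "K = {\<alpha>..\<beta>}"
begin

text \<open>Derivatives within \<open>K\<close> are unique only on a nondegenerate interval, whence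
  the assumption \<open>\<alpha> < \<beta>\<close> of this context.\<close>

lemma deriv_within_eqI:
  assumes "q \<in> K" "(g has_vector_derivative D) (at q within K)"
  shows "deriv_within K g q = D"
  using vector_derivative_within_closed_interval[OF ab, of q g D] assms by (simp add: deriv_within_def K)

lemma has_deriv_within:
  assumes "f differentiable_on K" "q \<in> K"
  shows "(f has_vector_derivative deriv_within K f q) (at q within K)"
  using assms by (auto simp: differentiable_on_def deriv_within_def vector_derivative_works)

lemma deriv_within_cong:
  assumes "\<And>q. q \<in> K \<Longrightarrow> f q = g q" "q \<in> K"
  shows "deriv_within K f q = deriv_within K g q"
proof -
  have "(f has_vector_derivative D) (at q within K) \<longleftrightarrow> (g has_vector_derivative D) (at q within K)" for D
    using assms by (auto intro: has_vector_derivative_transform[rotated 2])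
  then show ?thesis by (simp add: deriv_within_def vector_derivative_def)
qed

lemma Cn_on_cong:
  assumes "\<And>q. q \<in> K \<Longrightarrow> f q = g q"
  shows "Cn_on n K f \<longleftrightarrow> Cn_on n K g"
  using assms
proof (induction n arbitrary: f g)
  case 0
  then show ?case by (auto simp: Cn_on_0 cong: continuous_on_cong)
next
  case (Suc n)
  have "f differentiable_on K \<longleftrightarrow> g differentiable_on K"
    using Suc.prems unfolding differentiable_on_def
    by (metis (no_types, lifting) differentiable_transform_within zero_less_one)
  moreover have "Cn_on n K (deriv_within K f) \<longleftrightarrow> Cn_on n K (deriv_within K g)"
    by (rule Suc.IH) (rule deriv_within_cong[OF Suc.prems])
  ultimately show ?case by (simp add: Cn_on_Suc)
qed

lemma Cn_on_SucI:
  assumes "\<And>q. q \<in> K \<Longrightarrow> (f has_vector_derivative f' q) (at q within K)" "Cn_on n K f'"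
  shows "Cn_on (Suc n) K f"
proof -
  have "f differentiable_on K"
    using assms(1) by (auto simp: differentiable_on_def intro: differentiableI_vector)
  moreover have "Cn_on n K (deriv_within K f)"
    using assms by (subst Cn_on_cong[where g=f']) (auto intro: deriv_within_eqI)
  ultimately show ?thesis by (simp add: Cn_on_Suc)
qed

lemma Cn_on_SucD: "Cn_on (Suc n) K f \<Longrightarrow> Cn_on n K f"
proof (induction n arbitrary: f)
  case 0
  then show ?case by (auto simp: Cn_on_Suc Cn_on_0 differentiable_imp_continuous_on)
next
  case (Suc n)
  then show ?case using Cn_on_Suc by blast
qed

lemma Cn_on_add: "Cn_on n K f \<Longrightarrow> Cn_on n K g \<Longrightarrow> Cn_on n K (\<lambda>q. f q + g q)"
proof (induction n arbitrary: f g)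
  case 0
  then show ?case by (auto simp: Cn_on_0 intro: continuous_intros)
next
  case (Suc n)
  show ?case
    by (rule Cn_on_SucI[where f'="\<lambda>q. deriv_within K f q + deriv_within K g q"])
       (use Suc in \<open>auto simp: Cn_on_Suc intro!: has_vector_derivative_add has_deriv_within\<close>)
qed

lemma Cn_on_const: "Cn_on n K (\<lambda>q. c)"
proof (induction n arbitrary: c)
  case (Suc n)
  show ?case by (rule Cn_on_SucI[where f'="\<lambda>q. 0"]) (auto intro: Suc)
qed (simp add: Cn_on_0)

lemma Cn_on_mult: "Cn_on n K f \<Longrightarrow> Cn_on n K g \<Longrightarrow> Cn_on n K (\<lambda>q. f q * g q)"
proof (induction n arbitrary: f g)
  case 0
  then show ?case by (auto simp: Cn_on_0 intro: continuous_intros)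
next
  case (Suc n)
  show ?case
  proof (rule Cn_on_SucI[where f'="\<lambda>q. f q * deriv_within K g q + deriv_within K f q * g q"])
    show "Cn_on n K (\<lambda>q. f q * deriv_within K g q + deriv_within K f q * g q)"
      using Suc by (intro Cn_on_add Suc.IH) (auto simp: Cn_on_Suc intro: Cn_on_SucD)
  qed (use Suc in \<open>auto simp: Cn_on_Suc intro!: has_vector_derivative_mult has_deriv_within\<close>)
qed

lemma Cn_on_ident: "Cn_on n K (\<lambda>q. q)"
proof (cases n)
  case (Suc m)
  then show ?thesis by (auto intro!: Cn_on_SucI[where f'="\<lambda>q. 1"] Cn_on_const)
qed (simp add: Cn_on_0)

lemma Cn_on_exp: "Cn_on n K h' \<Longrightarrow> (\<And>q. (h has_real_derivative h' q) (at q)) \<Longrightarrow> Cn_on n K (\<lambda>q. exp (h q))"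
proof (induction n)
  case 0
  have "continuous_on K h"
    using 0(2) by (auto intro!: continuous_at_imp_continuous_on DERIV_isCont)
  then show ?case by (auto simp: Cn_on_0 intro!: continuous_intros)
next
  case (Suc n)
  show ?case
  proof (rule Cn_on_SucI[where f'="\<lambda>q. h' q * exp (h q)"])
    fix q
    have "((\<lambda>q. exp (h q)) has_real_derivative h' q * exp (h q)) (at q)"
      using Suc.prems(2)[of q] by (auto intro!: derivative_eq_intros)
    then show "((\<lambda>q. exp (h q)) has_vector_derivative h' q * exp (h q)) (at q within K)"
      by (auto simp: has_real_derivative_iff_has_vector_derivative intro: has_vector_derivative_at_within)
  qed (use Suc in \<open>auto intro!: Cn_on_mult intro: Cn_on_SucD\<close>)
qed

lemma Cn_on_exp_linear: "Cn_on n K (\<lambda>q. exp (s * q))"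
  by (rule Cn_on_exp[where h'="\<lambda>q. s"]) (auto intro!: Cn_on_const derivative_eq_intros)

lemma diff_op_prod_Cons: "diff_op_prod K (a # as) G q = deriv_within K (diff_op_prod K as G) q - a * diff_op_prod K as G q"
  by (simp add: diff_op_prod_def)

lemma diff_op_prod_Nil: "diff_op_prod K [] G = G"
  by (simp add: diff_op_prod_def)

lemma Cn_on_diff_op_prod: "Cn_on (length as + m) K G \<Longrightarrow> Cn_on m K (diff_op_prod K as G)"
proof (induction as arbitrary: m)
  case Nil
  then show ?case by (simp add: diff_op_prod_Nil)
next
  case (Cons a as)
  then have 1: "Cn_on (Suc m) K (diff_op_prod K as G)" by simp
  have "Cn_on m K (\<lambda>q. deriv_within K (diff_op_prod K as G) q + (- a) * diff_op_prod K as G q)"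
    using 1 Cn_on_SucD[OF 1] by (intro Cn_on_add Cn_on_mult Cn_on_const) (auto simp: Cn_on_Suc)
  then show ?case by (simp add: diff_op_prod_Cons[abs_def])
qed

lemma diff_op_prod_linear:
  assumes "Cn_on (length as) K G" "Cn_on (length as) K H" "q \<in> K"
  shows "diff_op_prod K as (\<lambda>q. G q + c * H q) q = diff_op_prod K as G q + c * diff_op_prod K as H q"
  using assms
proof (induction as arbitrary: q)
  case Nil
  then show ?case by (simp add: diff_op_prod_Nil)
next
  case (Cons a as)
  let ?L = "diff_op_prod K as"
  have GH: "Cn_on (length as + 1) K G" "Cn_on (length as + 1) K H" "Cn_on (length as) K G" "Cn_on (length as) K H"
    using Cons.prems(1,2) by (auto dest: Cn_on_SucD)
  have d: "?L G differentiable_on K" "?L H differentiable_on K"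
    using Cn_on_diff_op_prod[OF GH(1)] Cn_on_diff_op_prod[OF GH(2)] by (auto simp: Cn_on_Suc)
  have IH: "?L (\<lambda>q. G q + c * H q) q = ?L G q + c * ?L H q" if "q \<in> K" for q
    using Cons.IH[OF GH(3,4) that] .
  have "deriv_within K (?L (\<lambda>q. G q + c * H q)) q = deriv_within K (\<lambda>q. ?L G q + c * ?L H q) q"
    by (rule deriv_within_cong[OF IH Cons.prems(3)])
  also have "\<dots> = deriv_within K (?L G) q + c * deriv_within K (?L H) q"
    using d Cons.prems(3)
    by (intro deriv_within_eqI has_vector_derivative_add has_vector_derivative_mult_right has_deriv_within) auto
  finally show ?case
    using IH[OF Cons.prems(3)] by (simp add: diff_op_prod_Cons algebra_simps)
qed

lemma diff_op_prod_exp: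
  assumes "q \<in> K"
  shows "diff_op_prod K as (\<lambda>q. exp (s * q)) q = (\<Prod>a\<leftarrow>as. s - a) * exp (s * q)"
  using assms
proof (induction as arbitrary: q)
  case Nil
  then show ?case by (simp add: diff_op_prod_Nil)
next
  case (Cons a as)
  have d: "((\<lambda>q. exp (s * q)) has_vector_derivative s * exp (s * q)) (at q within K)"
    by (auto intro!: derivative_eq_intros has_vector_derivative_at_within simp flip: has_real_derivative_iff_has_vector_derivative)
  have "deriv_within K (diff_op_prod K as (\<lambda>q. exp (s * q))) q = deriv_within K (\<lambda>q. (\<Prod>a\<leftarrow>as. s - a) * exp (s * q)) q"
    by (rule deriv_within_cong[OF Cons.IH Cons.prems])
  also have "\<dots> = (\<Prod>a\<leftarrow>as. s - a) * (s * exp (s * q))"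
    by (intro deriv_within_eqI Cons.prems has_vector_derivative_mult_right d)
  finally show ?case
    using Cons.IH[OF Cons.prems] by (simp add: diff_op_prod_Cons algebra_simps)
qed

text \<open>Solve one first order equation at a time.\<close>

lemma diff_op_prod_stable:
  assumes "distinct as"
  shows "\<exists>C\<ge>0. \<forall>G \<delta>. Cn_on (length as) K G \<longrightarrow> (\<forall>q\<in>K. \<bar>diff_op_prod K as G q\<bar> \<le> \<delta>) \<longrightarrow>
    (\<exists>c. \<forall>q\<in>K. \<bar>G q - (\<Sum>a\<in>set as. c a * exp (a * q))\<bar> \<le> C * \<delta>)"
  using assms
proof (induction as)
  case Nil
  then show ?case by (auto intro!: exI[of _ 1] simp: diff_op_prod_Nil)
next
  case (Cons a as)
  let ?L = "diff_op_prod K as"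
  obtain C where C: "C \<ge> 0" "\<And>G \<delta>. Cn_on (length as) K G \<Longrightarrow> (\<And>q. q \<in> K \<Longrightarrow> \<bar>?L G q\<bar> \<le> \<delta>) \<Longrightarrow>
      \<exists>c. \<forall>q\<in>K. \<bar>G q - (\<Sum>a\<in>set as. c a * exp (a * q))\<bar> \<le> C * \<delta>"
    using Cons by auto
  define B where "B = exp (\<bar>a\<bar> * (\<bar>\<alpha>\<bar> + \<bar>\<beta>\<bar>))"
  have B: "exp (a * q) \<le> B" "exp (- (a * q)) \<le> B" if "q \<in> K" for q
  proof -
    have "\<bar>q\<bar> \<le> \<bar>\<alpha>\<bar> + \<bar>\<beta>\<bar>" using that by (auto simp: K)
    then have "\<bar>a * q\<bar> \<le> \<bar>a\<bar> * (\<bar>\<alpha>\<bar> + \<bar>\<beta>\<bar>)" by (simp add: abs_mult mult_left_mono)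
    then show "exp (a * q) \<le> B" "exp (- (a * q)) \<le> B" unfolding B_def by auto
  qed
  have B0: "B > 0" by (simp add: B_def)
  define C1 where "C1 = B * B * (\<beta> - \<alpha>)"
  have C1: "C1 \<ge> 0" using ab B0 by (simp add: C1_def)
  show ?case
  proof (intro exI[of _ "C * C1"] conjI allI impI)
    fix G \<delta> assume G: "Cn_on (length (a # as)) K G" and \<delta>: "\<forall>q\<in>K. \<bar>diff_op_prod K (a # as) G q\<bar> \<le> \<delta>"
    have \<delta>0: "\<delta> \<ge> 0" using \<delta> ab by (force simp: K dest: bspec[of _ _ \<alpha>])
    define h where "h = ?L G"
    have "Cn_on (length as + 1) K G" using G by simp
    then have dh: "h differentiable_on K"
      using Cn_on_diff_op_prod[of as 1 G] by (simp add: h_def Cn_on_Suc)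
    \<comment> \<open>Integrating factor: the derivative of \<open>u\<close> is
      \<open>exp (- (a * q))\<close> times the full operator applied to \<open>G\<close>, which is
      small, so \<open>u\<close> is nearly constant.\<close>
    define u where "u q = exp (- (a * q)) * h q" for q
    have du: "(u has_vector_derivative exp (- (a * q)) * (diff_op_prod K (a # as) G q)) (at q within K)" if "q \<in> K" for q
    proof -
      have "((\<lambda>q. exp (- (a * q))) has_vector_derivative - a * exp (- (a * q))) (at q within K)"
        by (auto intro!: derivative_eq_intros has_vector_derivative_at_within simp flip: has_real_derivative_iff_has_vector_derivative)
      from has_vector_derivative_mult[OF this has_deriv_within[OF dh that]]
      show ?thesis by (simp add: u_def[abs_def] diff_op_prod_Cons h_def algebra_simps)
    qed
    have u: "\<bar>u q - u \<alpha>\<bar> \<le> B * \<delta> * (\<beta> - \<alpha>)" if q: "q \<in> K" for q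
    proof -
      have "norm (u q - u \<alpha>) \<le> (B * \<delta>) * norm (q - \<alpha>)"
      proof (rule differentiable_bound[of K u "\<lambda>q y. y *\<^sub>R (exp (- (a * q)) * (diff_op_prod K (a # as) G q))"])
        fix p assume p: "p \<in> K"
        show "(u has_derivative (\<lambda>y. y *\<^sub>R (exp (- (a * p)) * (diff_op_prod K (a # as) G p)))) (at p within K)"
          using du[OF p] by (simp add: has_vector_derivative_def)
        have "exp (- (a * p)) * \<bar>diff_op_prod K (a # as) G p\<bar> \<le> B * \<delta>"
          using B[OF p] \<delta> p by (intro mult_mono) (auto simp: less_imp_le[OF B0])
        then show "onorm (\<lambda>y. y *\<^sub>R (exp (- (a * p)) * (diff_op_prod K (a # as) G p))) \<le> B * \<delta>"
          by (intro onorm_le) (simp add: abs_mult mult_left_mono mult.commute[of "B * \<delta>"])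
      qed (use q ab in \<open>auto simp: K\<close>)
      also have "\<dots> \<le> (B * \<delta>) * (\<beta> - \<alpha>)"
        using q B0 \<delta>0 by (intro mult_left_mono) (auto simp: K)
      finally show ?thesis by simp
    qed
    have h: "\<bar>h q - u \<alpha> * exp (a * q)\<bar> \<le> C1 * \<delta>" if q: "q \<in> K" for q
    proof -
      have "h q - u \<alpha> * exp (a * q) = exp (a * q) * (u q - u \<alpha>)"
        by (simp add: u_def algebra_simps exp_minus)
      then have "\<bar>h q - u \<alpha> * exp (a * q)\<bar> = exp (a * q) * \<bar>u q - u \<alpha>\<bar>" by (simp add: abs_mult)
      also have "\<dots> \<le> B * (B * \<delta> * (\<beta> - \<alpha>))"
        using B(1)[OF q] u[OF q] B0 by (intro mult_mono) auto
      finally show ?thesis by (simp add: C1_def mult_ac)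
    qed
    \<comment> \<open>On the exponential with exponent \<open>a\<close> the remaining operator acts
      as multiplication by \<open>\<pi>\<close>, nonzero because the exponents are distinct. Hence
      \<open>c0\<close> is the multiple of this exponential that the remaining operator sends to the
      main part of \<open>h\<close>.\<close>
    define \<pi> where "\<pi> = (\<Prod>b\<leftarrow>as. a - b)"
    have \<pi>: "\<pi> \<noteq> 0" using Cons.prems by (auto simp: \<pi>_def prod_list_zero_iff)
    define c0 where "c0 = u \<alpha> / \<pi>"
    have GC: "Cn_on (length as) K G" using G by (auto dest: Cn_on_SucD)
    have "Cn_on (length as) K (\<lambda>q. G q + (- c0) * exp (a * q))"
      by (intro Cn_on_add Cn_on_mult Cn_on_const Cn_on_exp_linear GC)
    moreover have "\<bar>?L (\<lambda>q. G q + (- c0) * exp (a * q)) q\<bar> \<le> C1 * \<delta>" if "q \<in> K" for q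
      using h[OF that] \<pi> unfolding diff_op_prod_linear[OF GC Cn_on_exp_linear that] diff_op_prod_exp[OF that]
      by (simp add: c0_def \<pi>_def[symmetric] h_def)
    ultimately obtain c where c: "\<forall>q\<in>K. \<bar>G q + (- c0) * exp (a * q) - (\<Sum>a\<in>set as. c a * exp (a * q))\<bar> \<le> C * (C1 * \<delta>)"
      using C(2)[of "\<lambda>q. G q + (- c0) * exp (a * q)" "C1 * \<delta>"] by blast
    have "(\<Sum>b\<in>set (a # as). (c(a := c0)) b * exp (b * q)) = c0 * exp (a * q) + (\<Sum>b\<in>set as. c b * exp (b * q))" for q
      using Cons.prems by (auto intro!: sum.cong)
    then show "\<exists>c. \<forall>q\<in>K. \<bar>G q - (\<Sum>a\<in>set (a # as). c a * exp (a * q))\<bar> \<le> C * C1 * \<delta>"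
      using c by (intro exI[of _ "c(a := c0)"]) (auto simp: algebra_simps)
  qed (use C(1) C1 in simp)
qed

end

subsection \<open>The interpolation error\<close>

lemma haar_unitary_Z:
  fixes x :: "'n::finite \<Rightarrow> real"
  assumes haar: "is_unitary_haar haar" and x: "inj x" and r: "bij_betw r UNIV {..<CARD('n)}"
  shows "unitary_Z haar (diag_mat x) \<noteq> 0"
    and "vand r CARD('n) (\<lambda>p. of_real (x p)) * vand r CARD('n) (\<lambda>p. of_real (x p)) * unitary_Z haar (diag_mat x) =
         vand r CARD('n) (\<lambda>p. of_nat (r p)) * exp_det x x"
proof -
  interpret H: conj_invariant_spectrum haar "\<lambda>U. U ** diag_mat x ** U\<^sup>\<dagger>" x
    by (rule haar_spectrum[OF haar x])
  have Z: "H.Ex (wt x) = unitary_Z haar (diag_mat x)"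
    unfolding H.Ex_def unitary_Z_def wt_unitary ..
  show "vand r CARD('n) (\<lambda>p. of_real (x p)) * vand r CARD('n) (\<lambda>p. of_real (x p)) * unitary_Z haar (diag_mat x) =
         vand r CARD('n) (\<lambda>p. of_nat (r p)) * exp_det x x"
    using H.harish_chandra_itzykson_zuber[OF r, of x] by (simp only: Z)
  obtain c where c: "\<And>U. wt x (U ** diag_mat x ** U\<^sup>\<dagger>) = of_real (exp (c U))"
  proof -
    have "\<forall>U :: complex^'n^'n. \<exists>c. wt x (U ** diag_mat x ** U\<^sup>\<dagger>) = of_real (exp c)"
      by (intro allI wt_real)
    from choice[OF this] show ?thesis using that by blast
  qed
  have i: "integrable haar (\<lambda>U. complex_of_real (exp (c U)))"
    using H.Y_integrable[OF continuous_on_wt[OF continuous_on_id, where b=x]] by (simp add: c)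
  then have i': "integrable haar (\<lambda>U. exp (c U))" by (simp only: complex_of_real_integrable_eq)
  have "H.Ex (wt x) = of_real (LINT U|haar. exp (c U))"
    unfolding H.Ex_def c by (rule integral_complex_of_real)
  moreover have "(LINT U|haar. exp (c U)) \<noteq> 0"
    using integral_nonneg_eq_0_iff_AE[OF i'] by simp
  ultimately show "unitary_Z haar (diag_mat x) \<noteq> 0" by (simp flip: Z)
qed

text \<open>The Harish-Chandra--Itzykson--Zuber formula at \<open>b = s = x\<close> has a nonzero
  left-hand side, so the determinant on its right cannot vanish.\<close>

lemma exp_matrix_invertible:
  fixes x :: "'n::finite \<Rightarrow> real"
  assumes "is_unitary_haar (haar :: (complex^'n^'n) measure)" and x: "inj x"
  shows "invertible (\<chi> p q. exp (x q * x p) :: real^'n^'n)"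
proof -
  obtain r :: "'n \<Rightarrow> nat" where r: "bij_betw r UNIV {..<CARD('n)}"
    using ex_bij_betw_finite_nat[of "UNIV :: 'n set"] by (auto simp: atLeast0LessThan)
  have "vand r CARD('n) (\<lambda>p. of_real (x p)) \<noteq> 0"
    by (rule vand_nonzero[OF r]) (use x in \<open>auto simp: inj_def\<close>)
  then have "exp_det x x \<noteq> 0"
    using haar_unitary_Z[OF assms r] by auto
  moreover have "exp_det x x = of_real (det (\<chi> p q. exp (x q * x p)))"
    by (simp add: exp_det_def mdet_perm det_def)
  ultimately show ?thesis by (auto simp: invertible_det_nz)
qed

text \<open>Completing the square writes a Gaussian centred at \<open>x k\<close> as
  \<open>exp (- y\<^sup>2 / 2)\<close> times a constant times the exponential with exponent
  \<open>x k\<close>. Gaussian interpolation of \<open>f\<close> is thus interpolation of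
  \<open>F\<close> by exponentials, and invertibility makes the \<open>THE\<close> well
  defined.\<close>

lemma gauss_interpolant_eq:
  fixes x :: "'n::finite \<Rightarrow> real" and f :: "real \<Rightarrow> real"
  assumes inv: "invertible (\<chi> p q. exp (x q * x p) :: real^'n^'n)"
  defines "F \<equiv> \<lambda>q. exp (q\<^sup>2 / 2) * f q"
  shows "\<exists>a. (\<forall>m. (\<Sum>k\<in>UNIV. a k * exp (x k * x m)) = F (x m)) \<and>
    gauss_interpolant x f = (\<lambda>y. exp (- y\<^sup>2 / 2) * (\<Sum>k\<in>UNIV. a k * exp (x k * y)))"
proof -
  let ?A = "\<chi> p q. exp (x q * x p) :: real^'n^'n"
  have Am: "(?A *v v) $ m = (\<Sum>k\<in>UNIV. v $ k * exp (x k * x m))" for v m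
    by (simp add: matrix_vector_mult_def mult.commute)
  obtain B where B: "?A ** B = mat 1" "B ** ?A = mat 1" using inv by (auto simp: invertible_def)
  define a where "a k = (B *v (\<chi> m. F (x m))) $ k" for k
  have a: "(\<Sum>k\<in>UNIV. a k * exp (x k * x m)) = F (x m)" for m
  proof -
    have "?A *v (B *v (\<chi> m. F (x m))) = (\<chi> m. F (x m))" by (simp add: matrix_vector_mul_assoc B)
    then show ?thesis using Am[of "B *v (\<chi> m. F (x m))" m] by (simp add: a_def)
  qed
  have gauss: "c * exp (- (y - z)\<^sup>2 / 2) = exp (- y\<^sup>2 / 2) * (c * exp (- z\<^sup>2 / 2) * exp (z * y))" for c y z :: real
  proof -
    have "- (y - z)\<^sup>2 / 2 = - y\<^sup>2 / 2 + - z\<^sup>2 / 2 + z * y" by (simp add: power2_eq_square field_simps)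
    then show ?thesis by (simp only: exp_add mult_ac)
  qed
  have form: "(\<Sum>k\<in>UNIV. c k * exp (- (y - x k)\<^sup>2 / 2)) =
      exp (- y\<^sup>2 / 2) * (\<Sum>k\<in>UNIV. c k * exp (- (x k)\<^sup>2 / 2) * exp (x k * y))" for c y
    unfolding sum_distrib_left by (rule sum.cong) (simp_all only: gauss)
  have E: "exp (- z\<^sup>2 / 2) * exp (z\<^sup>2 / 2) = (1::real)" for z by (simp flip: exp_add)
  define g where "g y = exp (- y\<^sup>2 / 2) * (\<Sum>k\<in>UNIV. a k * exp (x k * y))" for y
  have "gauss_interpolant x f = g"
    unfolding gauss_interpolant_def
  proof (rule the_equality)
    show "(\<exists>c. g = (\<lambda>y. \<Sum>k\<in>UNIV. c k * exp (- (y - x k)\<^sup>2 / 2))) \<and> (\<forall>k. g (x k) = f (x k))"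
    proof (intro conjI exI allI)
      show "g = (\<lambda>y. \<Sum>k\<in>UNIV. (a k * exp ((x k)\<^sup>2 / 2)) * exp (- (y - x k)\<^sup>2 / 2))"
        unfolding form g_def[abs_def] by (simp add: mult.assoc flip: exp_add)
      fix k show "g (x k) = f (x k)"
        unfolding g_def a F_def by (simp only: mult.assoc[symmetric] E mult_1)
    qed
    fix g' assume "(\<exists>c. g' = (\<lambda>y. \<Sum>k\<in>UNIV. c k * exp (- (y - x k)\<^sup>2 / 2))) \<and> (\<forall>k. g' (x k) = f (x k))"
    then obtain c where c: "g' = (\<lambda>y. exp (- y\<^sup>2 / 2) * (\<Sum>k\<in>UNIV. c k * exp (- (x k)\<^sup>2 / 2) * exp (x k * y)))"
      and g': "\<And>k. g' (x k) = f (x k)" by (auto simp only: form)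
    let ?a = "\<chi> k. c k * exp (- (x k)\<^sup>2 / 2)"
    have "(?A *v ?a) $ m = F (x m)" for m
    proof -
      have "F (x m) = exp ((x m)\<^sup>2 / 2) * g' (x m)" by (simp add: F_def g')
      also have "\<dots> = (\<Sum>k\<in>UNIV. c k * exp (- (x k)\<^sup>2 / 2) * exp (x k * x m))"
        unfolding c by (simp only: mult.assoc[symmetric] mult.commute[of "exp (_ / 2)" "exp (- _ / 2)"] E mult_1)
      finally show ?thesis by (simp add: Am)
    qed
    then have "?A *v ?a = (\<chi> m. F (x m))" by (simp add: vec_eq_iff)
    then have "B *v (\<chi> m. F (x m)) = B *v (?A *v ?a)" by simp
    also have "\<dots> = ?a" by (simp add: matrix_vector_mul_assoc B)
    finally have "a k = c k * exp (- (x k)\<^sup>2 / 2)" for k by (simp add: a_def)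
    then show "g' = g" by (simp add: c g_def[abs_def])
  qed
  with a show ?thesis unfolding g_def[abs_def] by blast
qed

lemma continuous_wt_diag:
  "continuous_on UNIV (\<lambda>A :: complex^'m::finite^'m. wt b (A ** diag_mat d ** A\<^sup>\<dagger>))"
proof -
  have "continuous_on UNIV (\<lambda>A :: complex^'m^'m. A ** diag_mat d ** A\<^sup>\<dagger>)"
    by (rule continuous_on_matrixI) (unfold unitary_diag_entry, intro continuous_intros)
  then show ?thesis by (rule continuous_on_wt)
qed

section \<open>The error formula for exponentials\<close>

locale interpolation_data =
  fixes haar :: "(complex^'n::finite^'n) measure"
    and P :: "complex^'n option \<Rightarrow> complex^'n^'n option"
    and x :: "'n \<Rightarrow> real" and x0 :: real
  assumes haar: "is_unitary_haar haar"
    and P: "\<And>v. norm v = 1 \<Longrightarrow> isometry_onto_perp v (P v)"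
    and P_measurable: "P \<in> borel_measurable (restrict_space borel (sphere 0 1))"
    and x: "inj x" and x0: "x0 \<notin> range x"
begin

definition compressed_integral :: "complex^'n option \<Rightarrow> complex" where
  "compressed_integral v = (LINT U|haar. exp (trace (diag_mat x ** U\<^sup>\<dagger> ** (P v)\<^sup>\<dagger> **
      diag_mat (case_option x0 x) ** P v ** U)))"

definition rayleigh :: "complex^'n option \<Rightarrow> real" where
  "rayleigh v = (\<Sum>p\<in>UNIV. case_option x0 x p * (cmod (v $ p))\<^sup>2)"

lemma hprod_rayleigh: "hprod v (diag_mat (case_option x0 x) *v v) = of_real (rayleigh v)"
  unfolding hprod_def diag_mat_vec rayleigh_def
  by (simp only: of_real_mult of_real_sum complex_norm_square mult_ac)

text \<open>The factor coming from the first column does not depend on \<open>U\<close> and leaves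
  the inner integral as \<open>exp (s * rayleigh v)\<close>, whose exponent is the only place where
  \<open>s\<close> enters.\<close>

lemma wt_col_frame:
  "(LINT U|haar. wt (case_option x0 x) (col_frame P (v, U) ** diag_mat (case_option s x) ** (col_frame P (v, U))\<^sup>\<dagger>)) =
     compressed_integral v * of_real (exp (s * rayleigh v))"
  unfolding col_frame_def fst_conv snd_conv wt_adjoin_col compressed_integral_def hprod_rayleigh
  by (simp add: hconj_mult matrix_mul_assoc flip: exp_of_real)

lemma compressed_integral_integrable: "integrable sphere_measure compressed_integral"
  using col_frame_fubini(3)[OF haar P P_measurable continuous_wt_diag[of "case_option x0 x" "case_option 0 x"]]
  unfolding wt_col_frame by simp

text \<open>The quotient of the Harish-Chandra--Itzykson--Zuber integrals over \<open>U(n + 1)\<close> and \<open>U(n)\<close>.\<close>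

lemma sphere_integral_exp:
  assumes s: "s \<notin> range x" and l: "\<And>k. exp (x k * x0) = (\<Sum>m\<in>UNIV. l m * exp (x k * x m))"
  shows "of_real ((\<Prod>k\<in>UNIV. x0 - x k) * (\<Prod>k\<in>UNIV. s - x k)) *
      (LINT v|sphere_measure. compressed_integral v * of_real (exp (s * rayleigh v))) =
    fact CARD('n) * unitary_Z haar (diag_mat x) * of_real (exp (s * x0) - (\<Sum>m\<in>UNIV. l m * exp (s * x m)))"
proof -
  let ?b = "case_option x0 x" and ?d = "case_option s x"
  obtain r :: "'n \<Rightarrow> nat" where r: "bij_betw r UNIV {..<CARD('n)}"
    using ex_bij_betw_finite_nat[of "UNIV :: 'n set"] by (auto simp: atLeast0LessThan)
  have d: "inj ?d" using x s by (auto simp: inj_def split: option.splits)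
  interpret S: conj_invariant_spectrum "sphere_measure \<Otimes>\<^sub>M haar" "\<lambda>w. col_frame P w ** diag_mat ?d ** (col_frame P w)\<^sup>\<dagger>" ?d
    by (rule sphere_haar_spectrum[OF haar P P_measurable d])
  define J where "J = (LINT v|sphere_measure. compressed_integral v * of_real (exp (s * rayleigh v)))"
  define V where "V = vand r CARD('n) (\<lambda>p. of_real (x p))"
  define R where "R = vand r CARD('n) (\<lambda>p. of_nat (r p))"
  define E where "E = complex_of_real (exp (s * x0) - (\<Sum>m\<in>UNIV. l m * exp (s * x m)))"
  let ?Z = "unitary_Z haar (diag_mat x)"
  have V: "V \<noteq> 0" unfolding V_def by (rule vand_nonzero[OF r]) (use x in \<open>auto simp: inj_def\<close>)
  have "S.Ex (wt ?b) = J"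
    unfolding S.Ex_def J_def wt_col_frame[symmetric]
    by (rule col_frame_fubini(1)[OF haar P P_measurable continuous_wt_diag])
  then have "(\<Prod>k\<in>UNIV. of_real (x k) - of_real x0) * V * ((\<Prod>k\<in>UNIV. of_real (x k) - of_real s) * V) * J =
      fact CARD('n) * R * (E * exp_det x x)"
    using S.harish_chandra_itzykson_zuber[OF option_enum_bij[OF r], of ?b]
    unfolding vand_option_enum[OF r] vand_option[OF r] exp_det_adjoin[OF l] V_def R_def E_def by simp
  also have "\<dots> = fact CARD('n) * E * (R * exp_det x x)" by (simp only: mult_ac)
  also have "R * exp_det x x = V * V * ?Z"
    using haar_unitary_Z(2)[OF haar x r] by (simp only: V_def R_def)
  finally have "(V * V) * ((\<Prod>k\<in>UNIV. of_real (x k) - of_real x0) * (\<Prod>k\<in>UNIV. of_real (x k) - of_real s) * J) =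
      (V * V) * (fact CARD('n) * ?Z * E)" by (simp only: mult_ac)
  then have "(\<Prod>k\<in>UNIV. of_real (x k) - of_real x0) * (\<Prod>k\<in>UNIV. of_real (x k) - of_real s) * J = fact CARD('n) * ?Z * E"
    using V by simp
  \<comment> \<open>Reversing the differences costs one sign for each \<open>k\<close> in each of
    the two products, so the signs cancel.\<close>
  moreover have "(\<Prod>k\<in>UNIV. of_real (x k) - of_real x0) * (\<Prod>k\<in>UNIV. of_real (x k) - of_real s) =
      (of_real ((\<Prod>k\<in>UNIV. x0 - x k) * (\<Prod>k\<in>UNIV. s - x k)) :: complex)"
    unfolding of_real_mult of_real_prod prod.distrib[symmetric]
    by (rule prod.cong) (simp_all add: algebra_simps)
  ultimately show ?thesis by (simp only: J_def E_def)
qed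

lemma rayleigh_in_hull:
  assumes "norm v = 1"
  shows "rayleigh v \<in> convex hull (insert x0 (range x))"
proof -
  have "(\<Sum>p\<in>UNIV. (cmod (v $ p))\<^sup>2) = 1"
    using assms by (simp add: norm_vec_def L2_set_def)
  moreover have "case_option x0 x p \<in> convex hull (insert x0 (range x))" for p
    by (rule hull_inc) (simp split: option.split)
  ultimately have "(\<Sum>p\<in>UNIV. (cmod (v $ p))\<^sup>2 *\<^sub>R case_option x0 x p) \<in> convex hull (insert x0 (range x))"
    by (intro convex_sum) auto
  then show ?thesis by (simp add: rayleigh_def mult.commute)
qed

end

lemma hull_interval:
  fixes x :: "'n::finite \<Rightarrow> real"
  assumes "x0 \<notin> range x"
  shows "\<exists>\<alpha> \<beta>. \<alpha> < \<beta> \<and> convex hull (insert x0 (range x)) = {\<alpha>..\<beta>}"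
proof -
  let ?K = "convex hull (insert x0 (range x))"
  have "compact ?K" by (intro finite_imp_compact_convex_hull) simp
  moreover have "connected ?K" by (rule convex_connected[OF convex_convex_hull])
  ultimately obtain \<alpha> \<beta> where K: "?K = {\<alpha>..\<beta>}"
    using connected_compact_interval_1[of ?K] by auto
  have "x0 \<in> ?K" "x undefined \<in> ?K" by (auto intro: hull_inc)
  then have "\<alpha> < \<beta>" using assms unfolding K by (metis atLeastAtMost_iff leD leI order.antisym order.trans rangeI)
  with K show ?thesis by blast
qed

section \<open>Extension from exponentials to all functions of class \<open>C^n\<close>\<close>

locale interpolation_error = interpolation_data haar P x x0
  for haar :: "(complex^'n::finite^'n) measure"
    and P :: "complex^'n option \<Rightarrow> complex^'n^'n option"
    and x :: "'n \<Rightarrow> real" and x0 :: real +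
  fixes ks :: "'n list" and l :: "'n \<Rightarrow> real" and K :: "real set"
  assumes ks: "distinct ks" "set ks = UNIV"
    and l: "\<And>k. exp (x k * x0) = (\<Sum>m\<in>UNIV. l m * exp (x k * x m))"
    and K_def: "K = convex hull (insert x0 (range x))"
begin

definition interp_error :: "(real \<Rightarrow> real) \<Rightarrow> real" where
  "interp_error G = G x0 - (\<Sum>m\<in>UNIV. l m * G (x m))"

abbreviation "L \<equiv> diff_op_prod K (map x ks)"

text \<open>The difference of the two sides of the error formula for \<open>G\<close>, with the
  denominator cleared and without the factor \<open>exp (- x0\<^sup>2 / 2)\<close>.\<close>

definition error_defect :: "(real \<Rightarrow> real) \<Rightarrow> complex" where
  "error_defect G = of_real (\<Prod>k\<in>UNIV. x0 - x k) * (LINT v|sphere_measure. compressed_integral v * of_real (L G (rayleigh v)))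
     - fact CARD('n) * unitary_Z haar (diag_mat x) * of_real (interp_error G)"

lemma K_points: "x0 \<in> K" "x m \<in> K"
  by (auto simp: K_def intro: hull_inc)

lemma K_interval: "\<exists>\<alpha> \<beta>. \<alpha> < \<beta> \<and> K = {\<alpha>..\<beta>}"
  unfolding K_def by (rule hull_interval[OF x0])

lemma length_ks: "length ks = CARD('n)"
  using ks distinct_card by fastforce

lemma prod_ks: "(\<Prod>a\<leftarrow>map x ks. s - a) = (\<Prod>k\<in>UNIV. s - x k)"
  using prod.distinct_set_conv_list[OF ks(1), of "\<lambda>k. s - x k"] by (simp add: ks(2) o_def)

lemma rayleigh_in_K: "v \<in> sphere 0 1 \<Longrightarrow> rayleigh v \<in> K"
  unfolding K_def by (rule rayleigh_in_hull) simp

lemma ci_weighted: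
  assumes \<phi>: "continuous_on K \<phi>"
  shows "integrable sphere_measure (\<lambda>v. compressed_integral v * of_real (\<phi> (rayleigh v)))"
    and "(\<And>q. q \<in> K \<Longrightarrow> \<bar>\<phi> q\<bar> \<le> \<delta>) \<Longrightarrow>
      norm (LINT v|sphere_measure. compressed_integral v * of_real (\<phi> (rayleigh v))) \<le> (LINT v|sphere_measure. norm (compressed_integral v)) * \<delta>"
proof -
  obtain \<alpha> \<beta> where ab: "\<alpha> < \<beta>" "K = {\<alpha>..\<beta>}" using K_interval by blast
  note i = compressed_integral_integrable
  have m: "(\<lambda>v. complex_of_real (\<phi> (rayleigh v))) \<in> borel_measurable sphere_measure"
  proof -
    \<comment> \<open>\<open>\<phi>\<close> is continuous on \<open>K\<close> only. Clamping its
      argument gives a function continuous everywhere, which agrees on the sphere because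
      \<open>rayleigh\<close> takes values in \<open>K\<close> there.\<close>
    let ?c = "\<lambda>q. max \<alpha> (min \<beta> q)"
    have "continuous_on UNIV (\<lambda>v. complex_of_real (\<phi> (?c (rayleigh v))))"
      unfolding rayleigh_def
      by (intro continuous_intros continuous_on_compose2[OF \<phi>]) (use ab in auto)
    then have "(\<lambda>v. complex_of_real (\<phi> (?c (rayleigh v)))) \<in> borel_measurable borel"
      by (rule borel_measurable_continuous_onI)
    then have "(\<lambda>v. complex_of_real (\<phi> (?c (rayleigh v)))) \<in> borel_measurable sphere_measure"
      unfolding measurable_cong_sets[OF sphere_measure_basics(1) refl] by (rule measurable_restrict_space1)
    moreover have "\<phi> (?c (rayleigh v)) = \<phi> (rayleigh v)" if "v \<in> space sphere_measure" for v
      using rayleigh_in_K[of v] that by (auto simp: sphere_measure_basics ab max_def min_def)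
    ultimately show ?thesis by (subst measurable_cong[symmetric]) auto
  qed
  have b: "integrable sphere_measure (\<lambda>v. compressed_integral v * of_real (\<phi> (rayleigh v))) \<and>
      norm (LINT v|sphere_measure. compressed_integral v * of_real (\<phi> (rayleigh v))) \<le> (LINT v|sphere_measure. norm (compressed_integral v)) * \<delta>"
    if \<delta>: "\<And>q. q \<in> K \<Longrightarrow> \<bar>\<phi> q\<bar> \<le> \<delta>" for \<delta>
  proof -
    have le: "norm (compressed_integral v * of_real (\<phi> (rayleigh v))) \<le> norm (compressed_integral v) * \<delta>" if "v \<in> space sphere_measure" for v
      using \<delta>[OF rayleigh_in_K[of v]] that by (simp add: norm_mult sphere_measure_basics mult_left_mono)
    have in1: "integrable sphere_measure (\<lambda>v. norm (compressed_integral v) * \<delta>)" using i by simp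
    have in2: "integrable sphere_measure (\<lambda>v. compressed_integral v * of_real (\<phi> (rayleigh v)))"
    proof (rule Bochner_Integration.integrable_bound[OF in1])
      show "(\<lambda>v. compressed_integral v * of_real (\<phi> (rayleigh v))) \<in> borel_measurable sphere_measure"
        by (intro borel_measurable_times borel_measurable_integrable[OF i] m)
      show "AE v in sphere_measure. norm (compressed_integral v * of_real (\<phi> (rayleigh v))) \<le> norm (norm (compressed_integral v) * \<delta>)"
        using le by (intro AE_I2) force
    qed
    have "norm (LINT v|sphere_measure. compressed_integral v * of_real (\<phi> (rayleigh v))) \<le> (LINT v|sphere_measure. norm (compressed_integral v * of_real (\<phi> (rayleigh v))))"
      by (rule integral_norm_bound)
    also have "\<dots> \<le> (LINT v|sphere_measure. norm (compressed_integral v) * \<delta>)"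
      by (intro integral_mono in1 integrable_norm in2 le)
    finally show ?thesis using in2 by simp
  qed
  have "compact (\<phi> ` K)" using \<phi> ab by (intro compact_continuous_image) auto
  then obtain B where "\<And>q. q \<in> K \<Longrightarrow> \<bar>\<phi> q\<bar> \<le> B"
    by (force dest!: compact_imp_bounded simp: bounded_iff)
  from b[OF this] show "integrable sphere_measure (\<lambda>v. compressed_integral v * of_real (\<phi> (rayleigh v)))" by blast
  assume "\<And>q. q \<in> K \<Longrightarrow> \<bar>\<phi> q\<bar> \<le> \<delta>"
  from b[OF this] show "norm (LINT v|sphere_measure. compressed_integral v * of_real (\<phi> (rayleigh v))) \<le> (LINT v|sphere_measure. norm (compressed_integral v)) * \<delta>"
    by blast
qed

lemma L_continuous: "Cn_on CARD('n) K G \<Longrightarrow> continuous_on K (L G)"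
proof -
  assume G: "Cn_on CARD('n) K G"
  obtain \<alpha> \<beta> where ab: "\<alpha> < \<beta>" "K = {\<alpha>..\<beta>}" using K_interval by blast
  have "Cn_on 0 K (L G)"
    by (rule Cn_on_diff_op_prod[OF ab]) (simp add: length_ks G)
  then show ?thesis by (simp add: Cn_on_0)
qed

lemma error_defect_linear:
  assumes G: "Cn_on CARD('n) K G" and H: "Cn_on CARD('n) K H"
  shows "error_defect (\<lambda>q. G q + c * H q) = error_defect G + of_real c * error_defect H"
proof -
  obtain \<alpha> \<beta> where ab: "\<alpha> < \<beta>" "K = {\<alpha>..\<beta>}" using K_interval by blast
  have "(LINT v|sphere_measure. compressed_integral v * of_real (L (\<lambda>q. G q + c * H q) (rayleigh v))) =
      (LINT v|sphere_measure. compressed_integral v * of_real (L G (rayleigh v)) + of_real c * (compressed_integral v * of_real (L H (rayleigh v))))"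
  proof (rule Bochner_Integration.integral_cong[OF refl])
    fix v :: "complex^'n option" assume "v \<in> space sphere_measure"
    then have "rayleigh v \<in> K" by (intro rayleigh_in_K) (simp add: sphere_measure_basics)
    then have "L (\<lambda>q. G q + c * H q) (rayleigh v) = L G (rayleigh v) + c * L H (rayleigh v)"
      by (intro diff_op_prod_linear[OF ab]) (simp_all add: length_ks G H)
    then show "compressed_integral v * of_real (L (\<lambda>q. G q + c * H q) (rayleigh v)) =
        compressed_integral v * of_real (L G (rayleigh v)) + of_real c * (compressed_integral v * of_real (L H (rayleigh v)))"
      by (simp add: algebra_simps)
  qed
  also have "\<dots> = (LINT v|sphere_measure. compressed_integral v * of_real (L G (rayleigh v))) + of_real c * (LINT v|sphere_measure. compressed_integral v * of_real (L H (rayleigh v)))"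
    using ci_weighted(1)[OF L_continuous[OF G]] ci_weighted(1)[OF L_continuous[OF H]]
    by (subst Bochner_Integration.integral_add) auto
  finally show ?thesis
    by (simp add: error_defect_def interp_error_def algebra_simps sum.distrib sum_distrib_left)
qed

text \<open>On this function \<open>L\<close> acts as multiplication by the product of the
  \<open>s - x k\<close>, which is the second product in \<open>sphere_integral_exp\<close>.\<close>

lemma error_defect_exp:
  assumes "s \<notin> range x"
  shows "error_defect (\<lambda>q. exp (s * q)) = 0"
proof -
  obtain \<alpha> \<beta> where ab: "\<alpha> < \<beta>" "K = {\<alpha>..\<beta>}" using K_interval by blast
  have "(LINT v|sphere_measure. compressed_integral v * of_real (L (\<lambda>q. exp (s * q)) (rayleigh v))) =
      (LINT v|sphere_measure. of_real (\<Prod>k\<in>UNIV. s - x k) * (compressed_integral v * of_real (exp (s * rayleigh v))))"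
  proof (rule Bochner_Integration.integral_cong[OF refl])
    fix v :: "complex^'n option" assume "v \<in> space sphere_measure"
    then have "rayleigh v \<in> K" by (intro rayleigh_in_K) (simp add: sphere_measure_basics)
    then have "L (\<lambda>q. exp (s * q)) (rayleigh v) = (\<Prod>k\<in>UNIV. s - x k) * exp (s * rayleigh v)"
      unfolding prod_ks[symmetric] by (rule diff_op_prod_exp[OF ab])
    then show "compressed_integral v * of_real (L (\<lambda>q. exp (s * q)) (rayleigh v)) = of_real (\<Prod>k\<in>UNIV. s - x k) * (compressed_integral v * of_real (exp (s * rayleigh v)))"
      by simp
  qed
  also have "\<dots> = of_real (\<Prod>k\<in>UNIV. s - x k) * (LINT v|sphere_measure. compressed_integral v * of_real (exp (s * rayleigh v)))"
    by (rule integral_mult_right_zero)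
  finally show ?thesis
    using sphere_integral_exp[OF assms l]
    by (simp add: error_defect_def interp_error_def mult.assoc)
qed

text \<open>The integral term is controlled by \<open>L G\<close> directly. For the other term,
  \<open>interp_error\<close> ignores any combination of the exponentials with exponents
  \<open>x k\<close>, and by \<open>diff_op_prod_stable\<close> such a combination is within a
  multiple of \<delta> of \<open>G\<close>.\<close>

lemma error_defect_bound:
  "\<exists>C. \<forall>G \<delta>. Cn_on CARD('n) K G \<longrightarrow> (\<forall>q\<in>K. \<bar>L G q\<bar> \<le> \<delta>) \<longrightarrow> norm (error_defect G) \<le> C * \<delta>"
proof -
  obtain \<alpha> \<beta> where ab: "\<alpha> < \<beta>" "K = {\<alpha>..\<beta>}" using K_interval by blast
  have dist: "distinct (map x ks)" using ks x by (simp add: distinct_map inj_on_subset[OF x])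
  obtain C where C: "\<And>G \<delta>. Cn_on CARD('n) K G \<Longrightarrow> (\<forall>q\<in>K. \<bar>L G q\<bar> \<le> \<delta>) \<Longrightarrow>
    \<exists>c. \<forall>q\<in>K. \<bar>G q - (\<Sum>a\<in>range x. c a * exp (a * q))\<bar> \<le> C * \<delta>"
    using diff_op_prod_stable[OF ab dist] unfolding length_map length_ks set_map ks(2) by blast
  define B where "B = (1 + (\<Sum>m\<in>UNIV. \<bar>l m\<bar>)) * C"
  have ie: "\<bar>interp_error G\<bar> \<le> B * \<delta>" if G: "Cn_on CARD('n) K G" "\<forall>q\<in>K. \<bar>L G q\<bar> \<le> \<delta>" for G \<delta>
  proof -
    obtain c where c: "\<And>q. q \<in> K \<Longrightarrow> \<bar>G q - (\<Sum>a\<in>range x. c a * exp (a * q))\<bar> \<le> C * \<delta>"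
      using C[OF G] by blast
    define e where "e q = (\<Sum>a\<in>range x. c a * exp (a * q))" for q
    have e: "e q = (\<Sum>k\<in>UNIV. c (x k) * exp (x k * q))" for q
      unfolding e_def by (subst sum.reindex[OF x]) simp
    have "interp_error e = 0"
    proof -
      have "(\<Sum>m\<in>UNIV. l m * e (x m)) = (\<Sum>k\<in>UNIV. c (x k) * (\<Sum>m\<in>UNIV. l m * exp (x k * x m)))"
        unfolding e sum_distrib_left by (subst sum.swap) (simp add: mult_ac)
      then show ?thesis by (simp add: interp_error_def e l)
    qed
    then have "interp_error G = (G x0 - e x0) - (\<Sum>m\<in>UNIV. l m * (G (x m) - e (x m)))"
      by (simp add: interp_error_def algebra_simps sum_subtractf)
    also have "\<bar>\<dots>\<bar> \<le> \<bar>G x0 - e x0\<bar> + (\<Sum>m\<in>UNIV. \<bar>l m\<bar> * \<bar>G (x m) - e (x m)\<bar>)"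
      using sum_abs[of "\<lambda>m. l m * (G (x m) - e (x m))" UNIV] unfolding abs_mult by linarith
    also have "\<dots> \<le> C * \<delta> + (\<Sum>m\<in>UNIV. \<bar>l m\<bar> * (C * \<delta>))"
      using c[OF K_points(1)] c[OF K_points(2)] by (intro add_mono sum_mono mult_left_mono) (auto simp: e_def)
    finally show ?thesis by (simp add: B_def algebra_simps sum_distrib_left sum_distrib_right)
  qed
  let ?p = "complex_of_real (\<Prod>k\<in>UNIV. x0 - x k)" and ?z = "fact CARD('n) * unitary_Z haar (diag_mat x)"
  show ?thesis
  proof (intro exI[of _ "norm ?p * (LINT v|sphere_measure. norm (compressed_integral v)) + norm ?z * B"] allI impI)
    fix G \<delta> assume G: "Cn_on CARD('n) K G" and \<delta>: "\<forall>q\<in>K. \<bar>L G q\<bar> \<le> \<delta>"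
    have "norm (error_defect G) \<le> norm ?p * norm (LINT v|sphere_measure. compressed_integral v * of_real (L G (rayleigh v))) + norm ?z * \<bar>interp_error G\<bar>"
      unfolding error_defect_def by (rule order.trans[OF norm_triangle_ineq4]) (simp add: norm_mult)
    also have "\<dots> \<le> norm ?p * ((LINT v|sphere_measure. norm (compressed_integral v)) * \<delta>) + norm ?z * (B * \<delta>)"
      by (intro add_mono mult_left_mono ie[OF G \<delta>] ci_weighted(2) L_continuous[OF G]) (use \<delta> in auto)
    finally show "norm (error_defect G) \<le> (norm ?p * (LINT v|sphere_measure. norm (compressed_integral v)) + norm ?z * B) * \<delta>"
      by (simp add: algebra_simps)
  qed
qed

text \<open>By the Weierstrass theorem in the variable \<open>e\<^sup>q\<close>, the exponentials \<open>e\<^sup>s\<^sup>q\<close> with \<open>s \<ge> M\<close> span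
  a uniformly dense subspace.\<close>

lemma error_defect_zero:
  assumes F: "Cn_on CARD('n) K F"
  shows "error_defect F = 0"
proof -
  obtain \<alpha> \<beta> where ab: "\<alpha> < \<beta>" "K = {\<alpha>..\<beta>}" using K_interval by blast
  obtain C0 where C0: "\<And>G \<delta>. Cn_on CARD('n) K G \<Longrightarrow> (\<forall>q\<in>K. \<bar>L G q\<bar> \<le> \<delta>) \<Longrightarrow> norm (error_defect G) \<le> C0 * \<delta>"
    using error_defect_bound by blast
  \<comment> \<open>Exponents from \<open>M\<close> on avoid all nodes, so
    \<open>error_defect_exp\<close> applies to them and \<open>L\<close> multiplies their
    exponentials by nonzero numbers.\<close>
  obtain M :: nat where M: "\<And>k. x k < real M"
  proof -
    obtain M :: nat where "Max (range x) < real M" using reals_Archimedean2 by blast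
    then have "x k < real M" for k using Max_ge[of "range x" "x k"] by (meson finite finite_imageI le_less_trans rangeI)
    then show ?thesis using that by blast
  qed
  have s: "real (M + i) \<notin> range x" for i
  proof
    assume "real (M + i) \<in> range x"
    then obtain k where "real (M + i) = x k" by auto
    with M[of k] show False by simp
  qed
  have small: "norm (error_defect F) \<le> C0 * \<epsilon>" if \<epsilon>: "\<epsilon> > 0" for \<epsilon>
  proof -
    have cont: "continuous_on (exp ` K) (\<lambda>y. L F (ln y) / y ^ M)"
    proof -
      have "continuous_on (exp ` K) (\<lambda>y. L F (ln y))"
        by (rule continuous_on_compose2[OF L_continuous[OF F]]) (auto intro!: continuous_on_ln continuous_intros)
      then show ?thesis by (intro continuous_on_divide continuous_intros) auto
    qed
    have comp: "compact (exp ` K)"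
      using ab by (intro compact_continuous_image continuous_intros) auto
    \<comment> \<open>What gets approximated is \<open>L F\<close>, not \<open>F\<close>, since
      \<open>error_defect_bound\<close> measures functions by their image under \<open>L\<close>.
      The tolerance compensates for multiplying back by \<open>exp q ^ M\<close>, which is at most
      \<open>exp (real M * \<beta>)\<close> on \<open>K\<close>.\<close>
    obtain p where p: "real_polynomial_function p" "\<And>y. y \<in> exp ` K \<Longrightarrow> \<bar>L F (ln y) / y ^ M - p y\<bar> < \<epsilon> / exp (real M * \<beta>)"
      using Stone_Weierstrass_real_polynomial_function[OF comp cont, of "\<epsilon> / exp (real M * \<beta>)"] \<epsilon> by auto
    obtain a N where a: "p = (\<lambda>y. \<Sum>i\<le>N. a i * y ^ i)"
      using p(1) unfolding real_polynomial_function_iff_sum by blast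
    define \<pi> where "\<pi> i = (\<Prod>k\<in>UNIV. real (M + i) - x k)" for i
    have \<pi>: "\<pi> i \<noteq> 0" for i using s[of i] by (auto simp: \<pi>_def)
    \<comment> \<open>Division by \<open>\<pi> i\<close> inverts \<open>L\<close> on the
      exponential, so adding these terms to \<open>F\<close> subtracts the approximation from
      \<open>L F\<close> and leaves the defect unchanged.\<close>
    define c where "c i = - a i / \<pi> i" for i
    define G where "G N q = F q + (\<Sum>i<N. c i * exp (real (M + i) * q))" for N q
    have G: "Cn_on CARD('n) K (G N) \<and> error_defect (G N) = error_defect F \<and>
        (\<forall>q\<in>K. L (G N) q = L F q - (\<Sum>i<N. a i * exp (real (M + i) * q)))" for N
    proof (induction N)
      case 0
      then show ?case using F by (simp add: G_def[abs_def])
    next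
      case (Suc N)
      have GS: "G (Suc N) = (\<lambda>q. G N q + c N * exp (real (M + N) * q))"
        by (auto simp: G_def fun_eq_iff)
      have "L (G (Suc N)) q = L (G N) q - a N * exp (real (M + N) * q)" if q: "q \<in> K" for q
      proof -
        have "L (G (Suc N)) q = L (G N) q + c N * L (\<lambda>q. exp (real (M + N) * q)) q"
          unfolding GS using Suc q
          by (intro diff_op_prod_linear[OF ab]) (simp_all add: length_ks Cn_on_exp_linear[OF ab])
        also have "L (\<lambda>q. exp (real (M + N) * q)) q = \<pi> N * exp (real (M + N) * q)"
          unfolding \<pi>_def prod_ks[symmetric] by (rule diff_op_prod_exp[OF ab q])
        finally show ?thesis using \<pi>[of N] by (simp add: c_def)
      qed
      moreover have "error_defect (G (Suc N)) = error_defect (G N)"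
        unfolding GS using Suc s[of N]
        by (subst error_defect_linear) (simp_all add: Cn_on_exp_linear[OF ab] error_defect_exp del: of_nat_add)
      moreover have "Cn_on CARD('n) K (G (Suc N))"
        unfolding GS using Suc
        by (intro Cn_on_add[OF ab] Cn_on_mult[OF ab] Cn_on_const[OF ab] Cn_on_exp_linear[OF ab]) auto
      ultimately show ?case using Suc by (simp add: algebra_simps)
    qed
    have "\<bar>L (G (Suc N)) q\<bar> \<le> \<epsilon>" if q: "q \<in> K" for q
    proof -
      have "(\<Sum>i<Suc N. a i * exp (real (M + i) * q)) = exp q ^ M * p (exp q)"
        unfolding a sum_distrib_left lessThan_Suc_atMost
        by (rule sum.cong) (simp_all add: exp_of_nat_mult[symmetric] exp_add[symmetric] algebra_simps)
      then have "L (G (Suc N)) q = exp q ^ M * (L F (ln (exp q)) / exp q ^ M - p (exp q))"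
        using G[of "Suc N"] q by (simp add: right_diff_distrib)
      then have "\<bar>L (G (Suc N)) q\<bar> = exp q ^ M * \<bar>L F (ln (exp q)) / exp q ^ M - p (exp q)\<bar>"
        by (simp add: abs_mult)
      also have "\<dots> \<le> exp (real M * \<beta>) * (\<epsilon> / exp (real M * \<beta>))"
      proof (rule mult_mono)
        show "exp q ^ M \<le> exp (real M * \<beta>)"
          using q unfolding exp_of_nat_mult[symmetric] ab by (simp add: mult_left_mono)
        show "\<bar>L F (ln (exp q)) / exp q ^ M - p (exp q)\<bar> \<le> \<epsilon> / exp (real M * \<beta>)"
          using p(2)[of "exp q"] q by (simp add: less_imp_le)
      qed auto
      finally show ?thesis by simp
    qed
    then have "norm (error_defect (G (Suc N))) \<le> C0 * \<epsilon>"
      using C0[of "G (Suc N)" \<epsilon>] G[of "Suc N"] by blast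
    then show ?thesis using G[of "Suc N"] by simp
  qed
  have "norm (error_defect F) \<le> \<eta>" if "\<eta> > 0" for \<eta>
  proof -
    \<comment> \<open>The denominator allows for a constant \<open>C0\<close> that is zero or
      negative.\<close>
    have "norm (error_defect F) \<le> C0 * (\<eta> / (\<bar>C0\<bar> + 1))"
      using that by (intro small) (simp add: add_nonneg_pos)
    also have "\<dots> \<le> \<eta>"
      using that by (simp add: divide_le_eq mult.commute) (smt (verit) mult_left_mono mult_nonneg_nonneg abs_ge_self)
    finally show ?thesis .
  qed
  then have "norm (error_defect F) \<le> 0" by (rule field_le_epsilon) auto
  then show ?thesis by simp
qed

end

theorem corollary1:
  fixes x :: "'n::finite \<Rightarrow> real"
    and ks :: "'n list"
    and x0 :: real
    and f :: "real \<Rightarrow> real"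
    and haar :: "(complex^'n^'n) measure"
    and P :: "complex^('n option) \<Rightarrow> complex^'n^('n option)"
  defines "X \<equiv> diag_mat x"
    and "Xt \<equiv> diag_mat (case_option x0 x)"
    and "K \<equiv> convex hull (insert x0 (range x))"
  assumes "inj x"
    and "distinct ks" and "set ks = UNIV"
    and "Cn_on CARD('n) K f"
    and "is_unitary_haar haar"
    and "\<And>v. norm v = 1 \<Longrightarrow> isometry_onto_perp v (P v)"
    and "P \<in> borel_measurable (restrict_space borel (sphere 0 1))"
  shows "complex_of_real (f x0 - gauss_interpolant x f x0) =
    complex_of_real (\<Prod>k\<in>UNIV. x0 - x k) / (fact CARD('n) * unitary_Z haar X) *
    (LINT v|sphere_measure. LINT U|haar.
       exp (trace (X ** U\<^sup>\<dagger> ** (P v)\<^sup>\<dagger> ** Xt ** P v ** U)) *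
       complex_of_real (exp (- x0\<^sup>2 / 2) *
         diff_op_prod K (map x ks) (\<lambda>q. exp (q\<^sup>2 / 2) * f q) (Re (hprod v (Xt *v v)))))"
proof -
  define F where "F = (\<lambda>q. exp (q\<^sup>2 / 2) * f q)"
  have E: "exp (- z\<^sup>2 / 2) * exp (z\<^sup>2 / 2) = (1::real)" for z by (simp flip: exp_add)
  note inv = exp_matrix_invertible[OF assms(8,4)]
  obtain a where a: "\<And>m. (\<Sum>k\<in>UNIV. a k * exp (x k * x m)) = F (x m)"
    "gauss_interpolant x f = (\<lambda>y. exp (- y\<^sup>2 / 2) * (\<Sum>k\<in>UNIV. a k * exp (x k * y)))"
    using gauss_interpolant_eq[OF inv, of f] unfolding F_def by blast
  show ?thesis
  proof (cases "x0 \<in> range x")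
    case True
    then obtain m where m: "x0 = x m" by auto
    have "gauss_interpolant x f x0 = f x0"
      unfolding a(2) m a(1) F_def by (simp only: mult.assoc[symmetric] E mult_1)
    moreover have "(\<Prod>k\<in>UNIV. x0 - x k) = 0" using m by (auto intro!: prod_zero)
    ultimately show ?thesis by simp
  next
    case False
    note x0 = False
    let ?A = "\<chi> p q. exp (x q * x p) :: real^'n^'n"
    obtain B where B: "?A ** B = mat 1" using inv by (auto simp: invertible_def)
    \<comment> \<open>The weights solve the linear system that makes the error functional annihilate
      each exponential with exponent \<open>x k\<close>.\<close>
    define l where "l m = (B *v (\<chi> k. exp (x k * x0))) $ m" for m
    have l: "exp (x k * x0) = (\<Sum>m\<in>UNIV. l m * exp (x k * x m))" for k
    proof -
      have "?A *v (B *v (\<chi> k. exp (x k * x0))) = (\<chi> k. exp (x k * x0))"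
        by (simp add: matrix_vector_mul_assoc B)
      then have "exp (x k * x0) = (?A *v (B *v (\<chi> k. exp (x k * x0)))) $ k" by simp
      also have "\<dots> = (\<Sum>m\<in>UNIV. l m * exp (x m * x k))"
        by (simp add: matrix_vector_mult_def[of ?A] l_def mult.commute[of _ "exp _"])
      finally show ?thesis by (simp only: mult.commute[of "x k" "x _"])
    qed
    interpret interpolation_error haar P x x0 ks l K
      by unfold_locales (use assms(8,9,10,4) x0 assms(5,6) l in \<open>auto simp: K_def\<close>)
    obtain \<alpha> \<beta> where ab: "\<alpha> < \<beta>" "K = {\<alpha>..\<beta>}" using K_interval by blast
    have CF: "Cn_on CARD('n) K F"
      unfolding F_def
      by (intro Cn_on_mult[OF ab] Cn_on_exp[OF ab Cn_on_ident[OF ab]] assms(7)) (auto intro!: derivative_eq_intros)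
    define \<Lambda> where "\<Lambda> = (LINT v|sphere_measure. compressed_integral v * of_real (diff_op_prod K (map x ks) F (rayleigh v)))"
    define Z where "Z = unitary_Z haar X"
    define c where "c = complex_of_real (exp (- x0\<^sup>2 / 2))"
    obtain r :: "'n \<Rightarrow> nat" where r: "bij_betw r UNIV {..<CARD('n)}"
      using ex_bij_betw_finite_nat[of "UNIV :: 'n set"] by (auto simp: atLeast0LessThan)
    have Z: "Z \<noteq> 0" unfolding Z_def X_def by (rule haar_unitary_Z(1)[OF assms(8,4) r])
    have "complex_of_real (\<Prod>k\<in>UNIV. x0 - x k) * \<Lambda> = fact CARD('n) * Z * of_real (interp_error F)"
      using error_defect_zero[OF CF] by (simp add: error_defect_def \<Lambda>_def Z_def X_def)
    then have "of_real (interp_error F) = complex_of_real (\<Prod>k\<in>UNIV. x0 - x k) / (fact CARD('n) * Z) * \<Lambda>"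
      using Z by (simp add: field_simps)
    moreover have "f x0 - gauss_interpolant x f x0 = exp (- x0\<^sup>2 / 2) * interp_error F"
    proof -
      have "(\<Sum>k\<in>UNIV. a k * exp (x k * x0)) = (\<Sum>m\<in>UNIV. l m * (\<Sum>k\<in>UNIV. a k * exp (x k * x m)))"
        unfolding l sum_distrib_left by (subst sum.swap) (simp add: mult_ac)
      then have "gauss_interpolant x f x0 = exp (- x0\<^sup>2 / 2) * (\<Sum>m\<in>UNIV. l m * F (x m))"
        by (simp add: a)
      moreover have "f x0 = exp (- x0\<^sup>2 / 2) * F x0"
        unfolding F_def by (simp only: mult.assoc[symmetric] E mult_1)
      ultimately show ?thesis by (simp only: interp_error_def right_diff_distrib)
    qed
    moreover have "(LINT v|sphere_measure. LINT U|haar.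
       exp (trace (X ** U\<^sup>\<dagger> ** (P v)\<^sup>\<dagger> ** Xt ** P v ** U)) *
       complex_of_real (exp (- x0\<^sup>2 / 2) * diff_op_prod K (map x ks) F (Re (hprod v (Xt *v v))))) = \<Lambda> * c"
    proof -
      have "(LINT U|haar. exp (trace (X ** U\<^sup>\<dagger> ** (P v)\<^sup>\<dagger> ** Xt ** P v ** U)) *
           complex_of_real (exp (- x0\<^sup>2 / 2) * diff_op_prod K (map x ks) F (Re (hprod v (Xt *v v))))) =
         (compressed_integral v * of_real (diff_op_prod K (map x ks) F (rayleigh v))) * c" for v
        unfolding X_def Xt_def hprod_rayleigh integral_mult_left_zero compressed_integral_def[symmetric]
        by (simp add: c_def mult_ac)
      then show ?thesis by (simp only: integral_mult_left_zero \<Lambda>_def)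
    qed
    ultimately show ?thesis
      unfolding F_def[symmetric] Z_def[symmetric] by (simp add: c_def mult_ac)
  qed
qed

end
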